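(* Let $\nu,d\in\mathbb{N}$, let $\Psi$ be a real symmetric positive definite $\nu\times\nu$ matrix and $\Sigma$ a real symmetric positive definite $d\times d$ matrix. Let $\mathfrak{Z}\sim\mathcal{N}_{\nu\times d}(0_{\nu\times d},\Psi\otimes\Sigma)$ and $\mathfrak{T}_n\sim\mathcal{T}_{\nu\times d}(n,0_{\nu\times d},\Psi\otimes\Sigma)$ for some real $n>2$, and denote the probability measures (laws) of $\mathfrak{T}_n$ and $\mathfrak{Z}$ by $\tau_n$ and $\gamma$, respectively. Then $$d_{\mathrm{W}}(\tau_n,\gamma)\le\frac{10}{\sqrt{1-2/n}}\,\frac{(\nu d)^2}{n}\,\|\Psi\|_2^{1/2}\,\|\Sigma\|_2^{1/2}.$$ For fixed $\nu$, $d$, $\Psi$ and $\Sigma$, the $n^{-1}$ rate of this bound is optimal.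
   Context: $\|\cdot\|_2$ is the spectral norm, $\|A\|_F=\sqrt{\mathrm{tr}(A^\top A)}$ is the Frobenius norm, $|A|$ is the determinant of a square matrix $A$, $I_\nu$ is the $\nu\times\nu$ identity matrix and $0_{\nu\times d}$ is the $\nu\times d$ zero matrix. $\mathfrak{N}\sim\mathcal{N}_{\nu\times d}(M,\Psi\otimes\Sigma)$ means $\mathrm{vec}(\mathfrak{N}^\top)\sim\mathcal{N}_{\nu d}(\mathrm{vec}(M^\top),\Psi\otimes\Sigma)$, where $\mathrm{vec}$ stacks the columns of a matrix, $\otimes$ is the Kronecker product and $\mathcal{N}_{\nu d}$ is the $(\nu d)$-dimensional multivariate normal distribution. Centered matrix $T$ distribution: for real $n>0$, $\mathfrak{T}_n\sim\mathcal{T}_{\nu\times d}(n,0_{\nu\times d},\Psi\otimes\Sigma)$ means that the random matrix $\mathfrak{T}_n\in\mathbb{R}^{\nu\times d}$ has density with respect to Lebesgue measure $$p_{\mathfrak{T}_n}(X)=\frac{\Gamma_\nu((n+\nu+d-1)/2)\ \big|I_\nu+n^{-1}\Psi^{-1}X\Sigma^{-1}X^\top\big|^{-(n+\nu+d-1)/2}}{(\pi n)^{\nu d/2}\,\Gamma_\nu((n+\nu-1)/2)\,|\Psi|^{d/2}\,|\Sigma|^{\nu/2}},\qquad X\in\mathbb{R}^{\nu\times d},$$ where $\Gamma_\nu(a)=\pi^{\nu(\nu-1)/4}\prod_{j=1}^\nu\Gamma(a-(j-1)/2)$ is the multivariate gamma function. Wasserstein distance: for laws $\mu,\eta$ on $\mathbb{R}^{\nu\times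 d}$ with finite first Frobenius-norm moments, $d_{\mathrm{W}}(\mu,\eta)=\sup\{|\int g\,\mathrm{d}\mu-\int g\,\mathrm{d}\eta|\}$, the supremum being over all $g:\mathbb{R}^{\nu\times d}\to\mathbb{R}$ with $|g(X)-g(Y)|\le\|X-Y\|_F$ for all $X,Y$. *)

theory Defs
  imports "HOL-Probability.Probability"
begin

definition pos_def :: "real^'n^'n \<Rightarrow> bool" where
  "pos_def A \<longleftrightarrow> transpose A = A \<and> (\<forall>x. x \<noteq> 0 \<longrightarrow> x \<bullet> (A *v x) > 0)"

definition spectral_norm :: "real^'n^'m \<Rightarrow> real" where
  "spectral_norm A = onorm (\<lambda>x. A *v x)"

definition frobenius_norm :: "real^'n^'m \<Rightarrow> real" where
  "frobenius_norm A = sqrt (trace (transpose A ** A))"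

lemma frobenius_norm_eq_norm: "frobenius_norm A = norm A"
proof -
  have "trace (transpose A ** A) = (\<Sum>j\<in>UNIV. \<Sum>i\<in>UNIV. (A $ i $ j)\<^sup>2)"
    by (simp add: trace_def matrix_matrix_mult_def transpose_def power2_eq_square)
  also have "\<dots> = (\<Sum>i\<in>UNIV. \<Sum>j\<in>UNIV. (A $ i $ j)\<^sup>2)"
    by (rule sum.swap)
  also have "\<dots> = (norm A)\<^sup>2"
    by (simp add: norm_vec_def L2_set_def sum_nonneg)
  finally show ?thesis
    by (simp add: frobenius_norm_def)
qed

text \<open>
  Vectors in dimension \<open>\<nu> d\<close> are indexed by pairs. The first component is the block number, so
  that the lexicographic enumeration of the pairs gives the usual positions: in \<open>vec_columns\<close> it
  is the column, in \<open>kronecker\<close> it is the index of the left factor.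
\<close>

definition vec_columns :: "real^'n^'m \<Rightarrow> real^('n \<times> 'm)" where
  "vec_columns A = (\<chi> p. A $ snd p $ fst p)"

definition kronecker :: "real^'n^'m \<Rightarrow> real^'q^'p \<Rightarrow> real^('n \<times> 'q)^('m \<times> 'p)" where
  "kronecker A B = (\<chi> r c. A $ fst r $ fst c * B $ snd r $ snd c)"

text \<open>The nondegenerate normal distribution: the covariance matrix \<open>S\<close> is meant to be positive
  definite.\<close>

definition mv_normal_density :: "real^'n \<Rightarrow> real^'n^'n \<Rightarrow> real^'n \<Rightarrow> real" where
  "mv_normal_density m S x =
     exp (- ((x - m) \<bullet> (matrix_inv S *v (x - m))) / 2) / sqrt ((2 * pi) ^ CARD('n) * det S)"

definition matrix_normal_distributed ::
    "'a measure \<Rightarrow> ('a \<Rightarrow> real^'d^'v) \<Rightarrow> real^'d^'v \<Rightarrow> real^'v^'v \<Rightarrow> real^'d^'d \<Rightarrow> bool" where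
  "matrix_normal_distributed P Z M \<Psi> \<Sigma> \<longleftrightarrow>
     distributed P lborel (\<lambda>\<omega>. vec_columns (transpose (Z \<omega>)))
       (\<lambda>x. ennreal (mv_normal_density (vec_columns (transpose M)) (kronecker \<Psi> \<Sigma>) x))"

definition multivariate_Gamma :: "nat \<Rightarrow> real \<Rightarrow> real" where
  "multivariate_Gamma k a =
     pi powr (real k * (real k - 1) / 4) * (\<Prod>j=1..k. Gamma (a - (real j - 1) / 2))"

definition matrix_t_density ::
    "real \<Rightarrow> real^'v^'v \<Rightarrow> real^'d^'d \<Rightarrow> real^'d^'v \<Rightarrow> real" where
  "matrix_t_density n \<Psi> \<Sigma> X =
     (let \<nu> = real CARD('v); d = real CARD('d) in
       multivariate_Gamma CARD('v) ((n + \<nu> + d - 1) / 2)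
       * det (mat 1 + (1 / n) *\<^sub>R (matrix_inv \<Psi> ** X ** matrix_inv \<Sigma> ** transpose X))
           powr (- ((n + \<nu> + d - 1) / 2))
       / ((pi * n) powr (\<nu> * d / 2) * multivariate_Gamma CARD('v) ((n + \<nu> - 1) / 2)
          * det \<Psi> powr (d / 2) * det \<Sigma> powr (\<nu> / 2)))"

definition matrix_t_distributed ::
    "'a measure \<Rightarrow> ('a \<Rightarrow> real^'d^'v) \<Rightarrow> real \<Rightarrow> real^'v^'v \<Rightarrow> real^'d^'d \<Rightarrow> bool" where
  "matrix_t_distributed P T n \<Psi> \<Sigma> \<longleftrightarrow>
     distributed P lborel T (\<lambda>X. ennreal (matrix_t_density n \<Psi> \<Sigma> X))"

text \<open>The distance is only meaningful for laws with finite first moments. It is set to \<open>\<infinity>\<close>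
  otherwise, because the integral of a non-integrable function is \<open>0\<close> by convention.\<close>

definition wasserstein :: "(real^'d^'v) measure \<Rightarrow> (real^'d^'v) measure \<Rightarrow> ereal" where
  "wasserstein \<mu> \<eta> =
     (if integrable \<mu> frobenius_norm \<and> integrable \<eta> frobenius_norm
      then SUP g \<in> {g. \<forall>X Y. \<bar>g X - g Y\<bar> \<le> frobenius_norm (X - Y)}.
             ereal \<bar>(\<integral>X. g X \<partial>\<mu>) - (\<integral>X. g X \<partial>\<eta>)\<bar>
      else \<infinity>)"

end

theory Submission
  imports Defs
begin

text \<open>
  Write \<open>\<Psi> = A A\<^sup>T\<close> and \<open>\<Sigma> = B B\<^sup>T\<close>. The substitution \<open>X = A Y B\<^sup>T\<close> reduces both laws to identity
  matrices, and because both densities are known to have total mass 1, no normalizing constant is ever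
  computed. The reduced T density has the score \<open>s(X) = - (m / n) G X\<close> with
  \<open>G = (I + X X\<^sup>T / n)\<^sup>-\<^sup>1\<close> and \<open>m = n + \<nu> + d - 1\<close>.

  Upper bound: let \<open>T\<close> and \<open>Z\<close> be independent. Moving the rotation of \<open>(T, Z)\<close> onto the joint density gives
  \<open>d/d\<theta> E g(cos \<theta> T + sin \<theta> Z) = - E [g(cos \<theta> T + sin \<theta> Z) \<langle>Z, T + s(T)\<rangle>]\<close>
  without any smoothness of \<open>g\<close>. As \<open>E Z = 0\<close> and \<open>E |Z|\<^sup>2 \<le> \<nu> d\<close>, a Lipschitz \<open>g\<close> yields
  \<open>d\<^sub>W \<le> (\<pi> / 2) \<nu> d E |T + s(T)|\<close>. Integration by parts with the vector fields \<open>(I + X X\<^sup>T / n) X\<close>, \<open>X\<close>,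
  \<open>tr(I - G) X\<close> and \<open>G X\<close> shows \<open>E |T + s(T)|\<^sup>2 \<le> 10 (\<nu> d)\<^sup>2 / (n (n - 2))\<close>.

  Lower bound: for \<open>F(X) = max(0, 1/4 - |X|\<^sup>2)\<^sup>2 X\<close> the function \<open>g = div F - \<langle>F, X\<rangle>\<close> is Lipschitz with
  \<open>E g(Z) = 0\<close>, whereas \<open>E g(T) = - E \<langle>F(T), T + s(T)\<rangle>\<close> is at least \<open>E \<langle>F(T), T\<rangle> / (2 n)\<close>, and
  \<open>E \<langle>F(T), T\<rangle>\<close> tends to \<open>E \<langle>F(Z), Z\<rangle> > 0\<close> by the upper bound.
\<close>

section \<open>Lebesgue measure and linear maps\<close>

text \<open>The T law has only moments of order below \<open>n\<close>, and \<open>n\<close> may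
  barely exceed 2, so not even E |T|^2 < infinity is available at the start. A cutoff yields
  finiteness and bound of this moment at once. The fields X, tr(I - G) X and G X grow at most
  linearly, so this one moment then justifies their integrations by parts.

  The small size of T + s(T) is a cancellation. With N = \<nu> d, E |T + s(T)|^2 is the sum of E
  |T|^2, - 2 m E tr(I - G) and (m^2 / n^2) E |G T|^2, of leading order N, - 2 N and N. Hence each
  term must be controlled up to an error of order 1 / n^2: the field (I + X X^T / n) X handles the
  first, and the other fields give linear relations for the rest.

  The interpolation is a rotation because rotations of pairs preserve Lebesgue measure; the angle
  can then be moved from g, which is merely Lipschitz, to the smooth joint density.

  For optimality, X + s(X) is approximately - (\<nu> + d - 1) X / n + X X^T X / n. The first term
  dominates near the origin and gives a definite sign, which is why F is supported in a small
  ball.\<close>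

lemma nn_integral_lborel_translate:
  fixes f :: "'a::euclidean_space \<Rightarrow> ennreal"
  assumes [measurable]: "f \<in> borel_measurable borel"
  shows "(\<integral>\<^sup>+x. f (x + c) \<partial>lborel) = (\<integral>\<^sup>+x. f x \<partial>lborel)"
proof -
  have "(\<integral>\<^sup>+x. f x \<partial>lborel) = (\<integral>\<^sup>+x. f x \<partial>(distr lborel borel ((+) c)))"
    by (simp add: lborel_distr_plus)
  also have "\<dots> = (\<integral>\<^sup>+x. f (c + x) \<partial>lborel)"
    by (rule nn_integral_distr) auto
  finally show ?thesis by (simp add: add.commute)
qed

lemma integral_lborel_translate:
  fixes f :: "'a::euclidean_space \<Rightarrow> real"
  assumes [measurable]: "f \<in> borel_measurable borel"
  shows "(LBINT x. f (x + c)) = (LBINT x. f x)"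
proof -
  have "(LBINT x. f x) = (\<integral>x. f x \<partial>(distr lborel borel ((+) c)))"
    by (simp add: lborel_distr_plus)
  also have "\<dots> = (LBINT x. f (c + x))"
    by (rule integral_distr) auto
  finally show ?thesis by (simp add: add.commute)
qed

lemma integrable_lborel_translate:
  fixes f :: "'a::euclidean_space \<Rightarrow> real"
  assumes "integrable lborel f"
  shows "integrable lborel (\<lambda>x. f (x + c))"
proof -
  have "integrable (distr lborel borel ((+) c)) f"
    using assms by (simp add: lborel_distr_plus)
  then have "integrable lborel (\<lambda>x. f (c + x))"
    using assms by (subst (asm) integrable_distr_eq) auto
  then show ?thesis by (simp add: add.commute)
qed

lemma emeasure_lborel_ball_pos:
  "r > 0 \<Longrightarrow> emeasure lborel (ball c r :: 'a::euclidean_space set) > 0"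
  using content_ball_pos[of r c] by (auto simp: measure_def zero_less_iff_neq_zero)

text \<open>The classical uniqueness proof for Haar measure: both sides arise from
  \<open>\<integral>\<integral> f (L x) h y\<close> by translating first \<open>x\<close>, then \<open>y\<close>, then \<open>x\<close> again. It replaces the
  determinant formula, which the library has only for well-ordered index types.\<close>

lemma nn_integral_linear_haar:
  fixes L :: "'a::euclidean_space \<Rightarrow> 'b::euclidean_space" and h f :: "'b \<Rightarrow> ennreal"
  assumes "linear L" "bij L"
    and [measurable]: "f \<in> borel_measurable borel" "h \<in> borel_measurable borel"
  shows "(\<integral>\<^sup>+x. f (L x) \<partial>lborel) * (\<integral>\<^sup>+y. h y \<partial>lborel)
    = (\<integral>\<^sup>+x. h (- L x) \<partial>lborel) * (\<integral>\<^sup>+y. f y \<partial>lborel)"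
proof -
  have [measurable]: "L \<in> borel_measurable borel"
    using assms(1) by (simp add: borel_measurable_continuous_onI linear_continuous_on linear_linear)
  interpret L: linear L by fact
  have "(\<integral>\<^sup>+x. f (L x) \<partial>lborel) * (\<integral>\<^sup>+y. h y \<partial>lborel)
     = (\<integral>\<^sup>+y. (\<integral>\<^sup>+x. f (L x) * h y \<partial>lborel) \<partial>lborel)"
    by (simp add: nn_integral_multc nn_integral_cmult mult.commute)
  also have "\<dots> = (\<integral>\<^sup>+y. (\<integral>\<^sup>+x. f (L x + y) * h y \<partial>lborel) \<partial>lborel)"
  proof (rule nn_integral_cong)
    fix y
    have "L (x + inv L y) = L x + y" for x
      using assms(2) by (simp add: L.add bij_is_surj surj_f_inv_f)
    then show "(\<integral>\<^sup>+x. f (L x) * h y \<partial>lborel) = (\<integral>\<^sup>+x. f (L x + y) * h y \<partial>lborel)"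
      using nn_integral_lborel_translate[of "\<lambda>x. f (L x) * h y" "inv L y"] by simp
  qed
  also have "\<dots> = (\<integral>\<^sup>+x. (\<integral>\<^sup>+y. f (L x + y) * h y \<partial>lborel) \<partial>lborel)"
    by (rule lborel_pair.Fubini') auto
  also have "\<dots> = (\<integral>\<^sup>+x. (\<integral>\<^sup>+y. f y * h (y - L x) \<partial>lborel) \<partial>lborel)"
  proof (rule nn_integral_cong)
    fix x
    show "(\<integral>\<^sup>+y. f (L x + y) * h y \<partial>lborel) = (\<integral>\<^sup>+y. f y * h (y - L x) \<partial>lborel)"
      using nn_integral_lborel_translate[of "\<lambda>y. f y * h (y - L x)" "L x"] by (simp add: add.commute)
  qed
  also have "\<dots> = (\<integral>\<^sup>+y. (\<integral>\<^sup>+x. f y * h (y - L x) \<partial>lborel) \<partial>lborel)"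
    by (rule lborel_pair.Fubini') auto
  also have "\<dots> = (\<integral>\<^sup>+y. f y * (\<integral>\<^sup>+x. h (- L x) \<partial>lborel) \<partial>lborel)"
  proof (rule nn_integral_cong)
    fix y
    have "y - L (x + inv L y) = - L x" for x
      using assms(2) by (simp add: L.add bij_is_surj surj_f_inv_f)
    then show "(\<integral>\<^sup>+x. f y * h (y - L x) \<partial>lborel) = f y * (\<integral>\<^sup>+x. h (- L x) \<partial>lborel)"
      using nn_integral_lborel_translate[of "\<lambda>x. f y * h (y - L x)" "inv L y"]
      by (simp add: nn_integral_cmult)
  qed
  also have "\<dots> = (\<integral>\<^sup>+x. h (- L x) \<partial>lborel) * (\<integral>\<^sup>+y. f y \<partial>lborel)"
    by (simp add: nn_integral_multc mult.commute)
  finally show ?thesis .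
qed

text \<open>In the Haar identity take for \<open>h\<close> the indicator of the unit ball, which is
  invariant under the minus sign. The constant is the ratio of the volumes of the preimage of the
  unit ball and of the unit ball; both are positive and finite because \<open>L\<close> is bounded
  above and below.\<close>

lemma lborel_distr_linear:
  fixes L :: "'a::euclidean_space \<Rightarrow> 'b::euclidean_space"
  assumes "linear L" "bij L"
  obtains c :: real where "c > 0" "distr lborel borel L = density lborel (\<lambda>_. ennreal c)"
proof -
  have Lm [measurable]: "L \<in> borel_measurable borel"
    using assms(1) by (simp add: borel_measurable_continuous_onI linear_continuous_on linear_linear)
  let ?h = "indicator (cball 0 1) :: 'b \<Rightarrow> ennreal"
  define a where "a = (\<integral>\<^sup>+x. ?h (- L x) \<partial>lborel)"
  define b where "b = (\<integral>\<^sup>+x. ?h x \<partial>lborel)"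
  have b: "b = emeasure lborel (cball 0 1 :: 'b set)"
    by (simp add: b_def)
  have b_fin: "b < \<infinity>" unfolding b by (rule emeasure_lborel_cball_finite)
  have b_pos: "b > 0"
  proof -
    have "emeasure lborel (ball 0 1 :: 'b set) \<le> b" unfolding b
      by (intro emeasure_mono) auto
    moreover have "emeasure lborel (ball 0 1 :: 'b set) > 0"
      by (simp add: emeasure_lborel_ball_pos)
    ultimately show ?thesis by (metis order_less_le_trans)
  qed
  interpret L: linear L by fact
  have a: "a = emeasure lborel (L -` cball 0 1)"
  proof -
    have "?h (- L x) = indicator (L -` cball 0 1) x" for x by (auto simp: indicator_def)
    then show ?thesis unfolding a_def
      by (simp add: measurable_sets_borel[OF Lm])
  qed
  have a_fin: "a < \<infinity>"
  proof -
    obtain B where B: "B > 0" "\<And>x. B * norm x \<le> norm (L x)"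
      using linear_inj_bounded_below_pos[OF assms(1)] assms(2) by (metis bij_is_inj)
    have "L -` cball 0 1 \<subseteq> cball 0 (1 / B)"
    proof
      fix x assume "x \<in> L -` cball 0 1"
      then have "B * norm x \<le> 1" using B(2)[of x] by simp
      then show "x \<in> cball 0 (1/B)" using B(1) by (simp add: field_simps)
    qed
    then have "a \<le> emeasure lborel (cball 0 (1/B) :: 'a set)"
      unfolding a by (intro emeasure_mono) auto
    also have "\<dots> < \<infinity>" by (rule emeasure_lborel_cball_finite)
    finally show ?thesis .
  qed
  have a_pos: "a > 0"
  proof -
    obtain B where B: "B > 0" "\<And>x. norm (L x) \<le> B * norm x"
      using linear_bounded_pos[OF assms(1)] by blast
    have "ball 0 (1 / B) \<subseteq> L -` cball 0 1"
    proof
      fix x :: 'a assume "x \<in> ball 0 (1/B)"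
      then have "B * norm x \<le> 1" using B(1) by (simp add: field_simps)
      then show "x \<in> L -` cball 0 1" using B(2)[of x] by simp
    qed
    then have "emeasure lborel (ball 0 (1/B) :: 'a set) \<le> a"
      unfolding a by (intro emeasure_mono) (auto simp: measurable_sets_borel[OF Lm])
    moreover have "emeasure lborel (ball 0 (1/B) :: 'a set) > 0"
      using B by (simp add: emeasure_lborel_ball_pos)
    ultimately show ?thesis by (metis order_less_le_trans)
  qed
  obtain a' where a': "a = ennreal a'" "a' > 0" using a_fin a_pos
    by (metis ennreal_cases ennreal_less_zero_iff less_irrefl infinity_ennreal_def)
  obtain b' where b': "b = ennreal b'" "b' > 0" using b_fin b_pos
    by (metis ennreal_cases ennreal_less_zero_iff less_irrefl infinity_ennreal_def)
  show thesis
  proof (rule that[of "a' / b'"])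
    show "a' / b' > 0" using a' b' by simp
    show "distr lborel borel L = density lborel (\<lambda>_. ennreal (a' / b'))"
    proof (rule measure_eqI)
      show "sets (distr lborel borel L) = sets (density lborel (\<lambda>_. ennreal (a' / b')))" by simp
      fix S assume "S \<in> sets (distr lborel borel L)"
      then have [measurable]: "S \<in> sets borel" by simp
      have "emeasure (distr lborel borel L) S = (\<integral>\<^sup>+x. indicator S (L x) \<partial>lborel)"
        using nn_integral_distr[of L lborel borel "indicator S"] by simp
      moreover have "(\<integral>\<^sup>+x. indicator S (L x) \<partial>lborel) * b = a * emeasure lborel S"
        using nn_integral_linear_haar[OF assms, of "indicator S" ?h] unfolding a_def b_def
        by (simp add: borel_measurable_indicator)
      ultimately have "emeasure (distr lborel borel L) S * b = a * emeasure lborel S" by simp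
      then have "emeasure (distr lborel borel L) S * b * ennreal (1 / b')
          = a * emeasure lborel S * ennreal (1 / b')" by simp
      moreover have "b * ennreal (1 / b') = 1" "a * ennreal (1 / b') = ennreal (a' / b')"
        using a' b' by (simp_all add: ennreal_mult[symmetric])
      ultimately have "emeasure (distr lborel borel L) S = ennreal (a' / b') * emeasure lborel S"
        by (metis (no_types, lifting) mult.assoc mult.commute mult_1)
      then show "emeasure (distr lborel borel L) S = emeasure (density lborel (\<lambda>_. ennreal (a' / b'))) S"
        by (simp add: emeasure_density nn_integral_cmult)
    qed
  qed
qed

text \<open>The unit ball is its own preimage and has positive finite volume, so the scaling
  constant must be 1.\<close>

lemma lborel_distr_linear_isometry:
  fixes L :: "'a::euclidean_space \<Rightarrow> 'a"
  assumes "linear L" "bij L" and nrm: "\<And>x. norm (L x) = norm x"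
  shows "distr lborel borel L = lborel"
proof -
  obtain c :: real where c: "c > 0" "distr lborel borel L = density lborel (\<lambda>_. ennreal c)"
    using lborel_distr_linear[OF assms(1,2)] .
  have Lm [measurable]: "L \<in> borel_measurable borel"
    using assms(1) by (simp add: borel_measurable_continuous_onI linear_continuous_on linear_linear)
  have "L -` ball 0 1 = ball 0 1" using nrm by auto
  then have "emeasure lborel (ball 0 1 :: 'a set) = emeasure (distr lborel borel L) (ball 0 1)"
    by (simp add: emeasure_distr)
  also have "\<dots> = ennreal c * emeasure lborel (ball 0 1 :: 'a set)"
    by (simp add: c emeasure_density nn_integral_cmult_indicator)
  finally have *: "emeasure lborel (ball 0 1 :: 'a set) = ennreal c * emeasure lborel (ball 0 1 :: 'a set)" .
  have "emeasure lborel (ball 0 1 :: 'a set) > 0" by (simp add: emeasure_lborel_ball_pos)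
  moreover have "emeasure lborel (ball 0 1 :: 'a set) < \<infinity>" by (rule emeasure_lborel_ball_finite)
  ultimately obtain v where v: "emeasure lborel (ball 0 1 :: 'a set) = ennreal v" "v > 0"
    by (metis ennreal_cases ennreal_less_zero_iff less_irrefl infinity_ennreal_def)
  from * v c(1) have "v = c * v" by (simp add: ennreal_mult[symmetric])
  with v have "c = 1" by simp
  with c show ?thesis by (simp add: density_1)
qed

text \<open>Integrate \<open>f (x + e) - f x\<close>, the integral of \<open>f' (x + t e)\<close>
  over t in [0, 1], with respect to x. By translation invariance one side is 0 and the other is the
  integral of \<open>f'\<close>. Integrability thus replaces any decay at infinity.\<close>

lemma lborel_directional_derivative_integral:
  fixes f f' :: "'a::euclidean_space \<Rightarrow> real" and e :: 'a
  assumes der: "\<And>x. ((\<lambda>t. f (x + t *\<^sub>R e)) has_real_derivative f' x) (at 0)"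
    and cont: "continuous_on UNIV f'"
    and f: "integrable lborel f" and f': "integrable lborel f'"
  shows "(LBINT x. f' x) = 0"
proof -
  have [measurable]: "f' \<in> borel_measurable borel" "f \<in> borel_measurable borel"
    using f f' by (auto dest: borel_measurable_integrable)
  have der': "((\<lambda>t. f (x + t *\<^sub>R e)) has_real_derivative f' (x + t *\<^sub>R e)) (at t)" for x t
    using der[of "x + t *\<^sub>R e"] DERIV_shift[of "\<lambda>t. f (x + t *\<^sub>R e)" "f' (x + t *\<^sub>R e)" 0 t]
    by (simp add: algebra_simps)
  let ?I = "indicator {0..1::real} :: real \<Rightarrow> real"
  have ftc: "(LBINT t. ?I t * f' (x + t *\<^sub>R e)) = f (x + e) - f x" for x
  proof -
    have "(LBINT t. ?I t *\<^sub>R f' (x + t *\<^sub>R e)) = f (x + 1 *\<^sub>R e) - f (x + 0 *\<^sub>R e)"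
    proof (rule integral_FTC_atLeastAtMost)
      show "continuous_on {0..1} (\<lambda>t. f' (x + t *\<^sub>R e))"
        by (rule continuous_on_compose2[OF cont]) (auto intro!: continuous_intros)
      fix t :: real
      show "((\<lambda>t. f (x + t *\<^sub>R e)) has_vector_derivative f' (x + t *\<^sub>R e)) (at t within {0..1})"
        using der'[of x t] has_real_derivative_iff_has_vector_derivative
          has_vector_derivative_at_within by blast
    qed simp
    then show ?thesis by simp
  qed
  have int: "integrable (lborel \<Otimes>\<^sub>M lborel) (\<lambda>(t, x). ?I t * f' (x + t *\<^sub>R e))"
  proof (rule lborel_pair.Fubini_integrable)
    have "(LBINT x. norm (?I t * f' (x + t *\<^sub>R e))) = ?I t * (LBINT x. norm (f' x))" for t
      using integral_lborel_translate[of "\<lambda>x. norm (f' x)" "t *\<^sub>R e"]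
      by (simp add: abs_mult)
    then show "integrable lborel (\<lambda>t. LBINT x. norm (case (t, x) of (t, x) \<Rightarrow> ?I t * f' (x + t *\<^sub>R e)))"
      by simp
    show "AE t in lborel. integrable lborel (\<lambda>x. case (t, x) of (t, x) \<Rightarrow> ?I t * f' (x + t *\<^sub>R e))"
      using integrable_lborel_translate[OF f'] by simp
  qed auto
  have "(LBINT x. f' x) = (LBINT t. (LBINT x. ?I t * f' (x + t *\<^sub>R e)))"
    by (simp add: integral_lborel_translate)
  also have "\<dots> = (LBINT x. (LBINT t. ?I t * f' (x + t *\<^sub>R e)))"
    using lborel_pair.Fubini_integral[OF int] by simp
  also have "\<dots> = (LBINT x. f (x + e) - f x)"
    by (simp add: ftc)
  also have "\<dots> = 0"
    using f integrable_lborel_translate[OF f, of e] integral_lborel_translate[of f e] by simp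
  finally show ?thesis .
qed

section \<open>Integration by parts against a score\<close>

text \<open>For positive \<open>p\<close> the score is the gradient of log p. The product form
  involves neither logarithm nor division, and it is insensitive to a constant factor of
  \<open>p\<close>.\<close>

definition has_score :: "('a::euclidean_space \<Rightarrow> real) \<Rightarrow> ('a \<Rightarrow> 'a) \<Rightarrow> bool" where
  "has_score p s \<longleftrightarrow> (\<forall>x. 0 \<le> p x) \<and> continuous_on UNIV s
     \<and> (\<forall>x. (p has_derivative (\<lambda>h. p x * (s x \<bullet> h))) (at x))"

lemma has_score_nonneg: "has_score p s \<Longrightarrow> 0 \<le> p x"
  by (simp add: has_score_def)

lemma has_score_continuous: "has_score p s \<Longrightarrow> continuous_on UNIV p"
  unfolding has_score_def
  by (meson continuous_at_imp_continuous_on has_derivative_continuous)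

lemma has_score_cmult: "has_score p s \<Longrightarrow> 0 \<le> c \<Longrightarrow> has_score (\<lambda>x. c * p x) s"
  unfolding has_score_def by (auto intro!: derivative_eq_intros simp: algebra_simps)

lemma has_derivative_along_line:
  fixes f :: "'a::real_normed_vector \<Rightarrow> real"
  assumes "(f has_derivative f') (at x)"
  shows "((\<lambda>t. f (x + t *\<^sub>R e)) has_real_derivative f' e) (at 0)"
proof -
  have "((\<lambda>t. f (x + t *\<^sub>R e)) has_derivative (\<lambda>t. f' (t *\<^sub>R e))) (at 0)"
    by (rule has_derivative_compose[where f = "\<lambda>t. x + t *\<^sub>R e" and g = f, simplified])
       (auto intro!: derivative_eq_intros assms)
  moreover have "(\<lambda>t. f' (t *\<^sub>R e)) = (*) (f' e)"
    using linear_cmul[OF has_derivative_linear[OF assms]] by (auto simp: mult.commute)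
  ultimately show ?thesis by (simp add: has_field_derivative_def)
qed

lemma le_one_plus_square: "x \<le> 1 + (x::real)\<^sup>2"
proof -
  have "0 \<le> (x - 1 / 2)\<^sup>2" by simp
  then show ?thesis by (simp add: power2_eq_square algebra_simps)
qed

text \<open>Once the second moment is known to be finite, most later integrability claims are
  reduced to this domination.\<close>

lemma integrable_quadratic_growth:
  fixes p f :: "'a::euclidean_space \<Rightarrow> real"
  assumes p: "\<And>x. 0 \<le> p x" "continuous_on UNIV p" "integrable lborel p" "integrable lborel (\<lambda>x. p x * (norm x)\<^sup>2)"
    and f: "continuous_on UNIV f" "\<And>x. \<bar>f x\<bar> \<le> c * (1 + (norm x)\<^sup>2)"
  shows "integrable lborel (\<lambda>x. p x * f x)"
proof (rule Bochner_Integration.integrable_bound)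
  show "integrable lborel (\<lambda>x. c * (p x + p x * (norm x)\<^sup>2))" using p by auto
  show "(\<lambda>x. p x * f x) \<in> borel_measurable lborel"
    using p(2) f(1) by (auto intro!: borel_measurable_continuous_onI continuous_intros)
  show "AE x in lborel. norm (p x * f x) \<le> norm (c * (p x + p x * (norm x)\<^sup>2))"
  proof (rule AE_I2)
    fix x
    have "p x * \<bar>f x\<bar> \<le> p x * (c * (1 + (norm x)\<^sup>2))" by (intro mult_left_mono f p)
    also have "\<dots> = c * (p x + p x * (norm x)\<^sup>2)" by (simp add: algebra_simps)
    also have "\<dots> \<le> \<bar>\<dots>\<bar>" by simp
    finally show "norm (p x * f x) \<le> norm (c * (p x + p x * (norm x)\<^sup>2))"
      using p(1)[of x] by (simp add: abs_mult)
  qed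
qed

text \<open>The integrand is the divergence of \<open>p F\<close>. Each coordinate contributes the
  derivative of \<open>p (F . b)\<close> in the direction \<open>b\<close>, whose integral vanishes;
  the three integrability hypotheses cover this function and the two parts of its
  derivative.\<close>

lemma score_ibp:
  fixes p :: "'a::euclidean_space \<Rightarrow> real" and F s :: "'a \<Rightarrow> 'a"
  assumes p: "has_score p s"
    and F: "\<And>x. (F has_derivative DF x) (at x)"
    and DF: "\<And>b. b \<in> Basis \<Longrightarrow> continuous_on UNIV (\<lambda>x. DF x b)"
    and i1: "integrable lborel (\<lambda>x. p x * norm (F x))"
    and i2: "\<And>b. b \<in> Basis \<Longrightarrow> integrable lborel (\<lambda>x. p x * norm (DF x b))"
    and i3: "integrable lborel (\<lambda>x. p x * (norm (F x) * norm (s x)))"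
  shows "(LBINT x. p x * ((\<Sum>b\<in>Basis. DF x b \<bullet> b) + F x \<bullet> s x)) = 0"
proof -
  have cF: "continuous_on UNIV F"
    using F by (meson continuous_at_imp_continuous_on has_derivative_continuous)
  have cp: "continuous_on UNIV p" using p by (rule has_score_continuous)
  have cs: "continuous_on UNIV s" and p0: "\<And>x. 0 \<le> p x"
    and dp: "\<And>x. (p has_derivative (\<lambda>h. p x * (s x \<bullet> h))) (at x)"
    using p by (auto simp: has_score_def)
  define f' where "f' b x = p x * (DF x b \<bullet> b) + p x * ((F x \<bullet> b) * (s x \<bullet> b))" for b x
  have meas: "g \<in> borel_measurable lborel" if "continuous_on UNIV g" for g :: "'a \<Rightarrow> real"
    using that by (simp add: borel_measurable_continuous_onI)
  have int1: "integrable lborel (\<lambda>x. p x * (DF x b \<bullet> b))" if "b \<in> Basis" for b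
    using i2[OF that]
  proof (rule Bochner_Integration.integrable_bound)
    show "(\<lambda>x. p x * (DF x b \<bullet> b)) \<in> borel_measurable lborel"
      by (intro meas continuous_intros cp DF that)
    show "AE x in lborel. norm (p x * (DF x b \<bullet> b)) \<le> norm (p x * norm (DF x b))"
      using p0 that by (auto simp: abs_mult intro!: mult_left_mono Basis_le_norm)
  qed
  have int2: "integrable lborel (\<lambda>x. p x * ((F x \<bullet> b) * (s x \<bullet> b)))" if "b \<in> Basis" for b
    using i3
  proof (rule Bochner_Integration.integrable_bound)
    show "(\<lambda>x. p x * ((F x \<bullet> b) * (s x \<bullet> b))) \<in> borel_measurable lborel"
      by (intro meas continuous_intros cp cF cs)
    show "AE x in lborel. norm (p x * ((F x \<bullet> b) * (s x \<bullet> b))) \<le> norm (p x * (norm (F x) * norm (s x)))"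
      using p0 that by (auto simp: abs_mult intro!: mult_left_mono mult_mono Basis_le_norm)
  qed
  have int3: "integrable lborel (\<lambda>x. p x * (F x \<bullet> b))" if "b \<in> Basis" for b
    using i1
  proof (rule Bochner_Integration.integrable_bound)
    show "(\<lambda>x. p x * (F x \<bullet> b)) \<in> borel_measurable lborel"
      by (intro meas continuous_intros cp cF)
    show "AE x in lborel. norm (p x * (F x \<bullet> b)) \<le> norm (p x * norm (F x))"
      using p0 that by (auto simp: abs_mult intro!: mult_left_mono Basis_le_norm)
  qed
  have int: "integrable lborel (f' b)" if "b \<in> Basis" for b
    using int1[OF that] int2[OF that] unfolding f'_def by auto
  have zero: "(LBINT x. f' b x) = 0" if b: "b \<in> Basis" for b
  proof (rule lborel_directional_derivative_integral[where f = "\<lambda>x. p x * (F x \<bullet> b)" and e = b])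
    fix x
    have "((\<lambda>x. p x * (F x \<bullet> b)) has_derivative
        (\<lambda>h. p x * (DF x h \<bullet> b) + p x * (s x \<bullet> h) * (F x \<bullet> b))) (at x)"
      by (rule derivative_eq_intros dp F | simp)+
    from has_derivative_along_line[OF this, of b]
    show "((\<lambda>t. p (x + t *\<^sub>R b) * (F (x + t *\<^sub>R b) \<bullet> b)) has_real_derivative f' b x) (at 0)"
      by (simp add: f'_def mult_ac)
  next
    show "continuous_on UNIV (f' b)" unfolding f'_def
      by (intro continuous_intros cp DF b cF cs)
  qed (use int int3 b in auto)
  have "p x * ((\<Sum>b\<in>Basis. DF x b \<bullet> b) + F x \<bullet> s x) = (\<Sum>b\<in>Basis. f' b x)" for x
    unfolding f'_def by (subst euclidean_inner) (simp add: sum.distrib sum_distrib_left algebra_simps)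
  then have "(LBINT x. p x * ((\<Sum>b\<in>Basis. DF x b \<bullet> b) + F x \<bullet> s x))
     = (\<Sum>b\<in>Basis. LBINT x. f' b x)"
    using int by (simp add: Bochner_Integration.integral_sum)
  then show ?thesis using zero by simp
qed

text \<open>The square makes the positive part continuously differentiable. Divided by
  \<open>b^2\<close> it increases to 1 as \<open>b\<close> grows, and it decreases radially.\<close>

definition cutoff :: "real \<Rightarrow> 'a::real_inner \<Rightarrow> real" where
  "cutoff b x = (max 0 (b - x \<bullet> x))\<^sup>2"

lemma has_derivative_max_0_square:
  fixes r :: real
  shows "((\<lambda>r. (max 0 r)\<^sup>2) has_real_derivative 2 * max 0 r) (at r)"
proof -
  consider "r > 0" | "r < 0" | "r = 0" by linarith
  then show ?thesis
  proof cases
    case 1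
    have "((\<lambda>r. r\<^sup>2) has_real_derivative 2 * max 0 r) (at r)"
      using 1 by (auto intro!: derivative_eq_intros)
    then show ?thesis
      by (rule has_field_derivative_transform_within_open[where S = "{0<..}"]) (use 1 in auto)
  next
    case 2
    have "((\<lambda>r. 0) has_real_derivative 2 * max 0 r) (at r)"
      using 2 by (auto intro!: derivative_eq_intros)
    then show ?thesis
      by (rule has_field_derivative_transform_within_open[where S = "{..<0}"]) (use 2 in auto)
  next
    case 3
    have "(\<lambda>h. (max 0 h)\<^sup>2 / h) \<midarrow>0\<rightarrow> (0::real)"
    proof (rule Lim_null_comparison)
      show "\<forall>\<^sub>F h in at 0. norm ((max 0 h)\<^sup>2 / h) \<le> \<bar>h::real\<bar>"
        by (auto simp: max_def power2_eq_square)
      show "(\<lambda>h::real. \<bar>h\<bar>) \<midarrow>0\<rightarrow> 0" by (rule tendsto_rabs_zero) (rule tendsto_ident_at)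
    qed
    then show ?thesis using 3 by (simp add: DERIV_def)
  qed
qed

lemma has_derivative_cutoff [derivative_intros]:
  "(cutoff b has_derivative (\<lambda>h. - 4 * max 0 (b - x \<bullet> x) * (x \<bullet> h))) (at x)"
proof -
  have "((\<lambda>x. b - x \<bullet> x) has_derivative (\<lambda>h. - (2 * (x \<bullet> h)))) (at x)"
    by (auto intro!: derivative_eq_intros simp: inner_commute)
  from has_derivative_compose[OF this has_derivative_max_0_square[THEN has_field_derivative_imp_has_derivative]]
  show ?thesis unfolding cutoff_def by (simp add: algebra_simps)
qed

lemma continuous_on_cutoff [continuous_intros]: "continuous_on S (cutoff b)"
  unfolding cutoff_def by (intro continuous_intros)

lemma cutoff_nonneg: "0 \<le> cutoff b x" by (simp add: cutoff_def)

lemma cutoff_eq_0: "b \<le> x \<bullet> x \<Longrightarrow> cutoff b x = 0" by (simp add: cutoff_def)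

lemma integrable_lborel_compact_support:
  fixes f :: "'a::euclidean_space \<Rightarrow> real"
  assumes "continuous_on UNIV f" "\<And>x. b \<le> x \<bullet> x \<Longrightarrow> f x = 0"
  shows "integrable lborel f"
proof -
  have "integrable lborel (\<lambda>x. indicator (cball 0 (sqrt \<bar>b\<bar>)) x *\<^sub>R f x)"
    by (rule borel_integrable_compact) (auto intro: continuous_on_subset[OF assms(1)])
  moreover have "indicator (cball 0 (sqrt \<bar>b\<bar>)) x *\<^sub>R f x = f x" for x
  proof (cases "x \<in> cball 0 (sqrt \<bar>b\<bar>)")
    case False
    then have "sqrt \<bar>b\<bar> < sqrt (x \<bullet> x)" by (simp add: norm_eq_sqrt_inner)
    then have "b \<le> x \<bullet> x" by simp
    then show ?thesis using assms(2) by simp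
  qed simp
  then have "(\<lambda>x. indicator (cball 0 (sqrt \<bar>b\<bar>)) x *\<^sub>R f x) = f" by blast
  ultimately show ?thesis by metis
qed

text \<open>Compact support supplies every integrability hypothesis of \<open>score_ibp\<close>. The
  price is the term from the gradient of the cutoff, which is - 4 max(0, r - |x|^2) x.\<close>

lemma score_ibp_cutoff:
  fixes p :: "'a::euclidean_space \<Rightarrow> real" and F s :: "'a \<Rightarrow> 'a"
  assumes p: "has_score p s"
    and F: "\<And>x. (F has_derivative DF x) (at x)"
    and DF: "\<And>b. b \<in> Basis \<Longrightarrow> continuous_on UNIV (\<lambda>x. DF x b)"
  shows "(LBINT x. p x * (cutoff r x * ((\<Sum>b\<in>Basis. DF x b \<bullet> b) + F x \<bullet> s x)
            - 4 * max 0 (r - x \<bullet> x) * (x \<bullet> F x))) = 0"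
proof -
  have cF: "continuous_on UNIV F"
    using F by (meson continuous_at_imp_continuous_on has_derivative_continuous)
  have cp: "continuous_on UNIV p" using p by (rule has_score_continuous)
  have cs: "continuous_on UNIV s"
    using p by (auto simp: has_score_def)
  define D where "D x h = cutoff r x *\<^sub>R DF x h + (- 4 * max 0 (r - x \<bullet> x) * (x \<bullet> h)) *\<^sub>R F x" for x h
  have cD: "continuous_on UNIV (\<lambda>x. D x b)" if "b \<in> Basis" for b
    unfolding D_def by (rule continuous_intros DF[OF that] cF)+
  have "(LBINT x. p x * ((\<Sum>b\<in>Basis. D x b \<bullet> b) + (cutoff r x *\<^sub>R F x) \<bullet> s x)) = 0"
  proof (rule score_ibp[OF p])
    show "((\<lambda>x. cutoff r x *\<^sub>R F x) has_derivative D x) (at x)" for x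
      unfolding D_def by (rule derivative_eq_intros F | simp)+
    show "integrable lborel (\<lambda>x. p x * norm (cutoff r x *\<^sub>R F x))"
      by (rule integrable_lborel_compact_support[of _ r])
         (auto intro!: continuous_intros cp cF simp: cutoff_eq_0)
    show "integrable lborel (\<lambda>x. p x * (norm (cutoff r x *\<^sub>R F x) * norm (s x)))"
      by (rule integrable_lborel_compact_support[of _ r])
         (auto intro!: continuous_intros cp cF cs simp: cutoff_eq_0)
    fix b :: 'a assume b: "b \<in> Basis"
    show "integrable lborel (\<lambda>x. p x * norm (D x b))"
      by (rule integrable_lborel_compact_support[of _ r])
         (auto intro!: continuous_intros cp cF DF b simp: D_def cutoff_eq_0)
  qed (rule cD)
  moreover have "(\<Sum>b\<in>Basis. D x b \<bullet> b) + (cutoff r x *\<^sub>R F x) \<bullet> s x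
     = cutoff r x * ((\<Sum>b\<in>Basis. DF x b \<bullet> b) + F x \<bullet> s x) - 4 * max 0 (r - x \<bullet> x) * (x \<bullet> F x)" for x
  proof -
    have "(\<Sum>b\<in>Basis. D x b \<bullet> b) = cutoff r x * (\<Sum>b\<in>Basis. DF x b \<bullet> b)
       - 4 * max 0 (r - x \<bullet> x) * (\<Sum>b\<in>Basis. (x \<bullet> b) * (F x \<bullet> b))"
      unfolding D_def by (simp add: inner_add_left inner_diff_left sum_subtractf sum.distrib sum_distrib_left sum_negf mult_ac)
    then show ?thesis by (simp add: euclidean_inner[of x "F x"] algebra_simps)
  qed
  ultimately show ?thesis by simp
qed

text \<open>The term with the derivative of the cutoff has a favourable sign, so the moment need not be known
  to be finite beforehand.\<close>

lemma score_moment_bound: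
  fixes p :: "'a::euclidean_space \<Rightarrow> real" and F s :: "'a \<Rightarrow> 'a"
  assumes p: "has_score p s" and ip: "integrable lborel p"
    and F: "\<And>x. (F has_derivative DF x) (at x)"
    and DF: "\<And>b. b \<in> Basis \<Longrightarrow> continuous_on UNIV (\<lambda>x. DF x b)"
    and Fx: "\<And>x. 0 \<le> x \<bullet> F x"
    and AB: "\<And>x. (\<Sum>b\<in>Basis. DF x b \<bullet> b) + F x \<bullet> s x = A - B x"
    and A: "0 \<le> A" and B: "\<And>x. 0 \<le> B x" and cB: "continuous_on UNIV B"
  shows "integrable lborel (\<lambda>x. p x * B x)" "(LBINT x. p x * B x) \<le> A * (LBINT x. p x)"
proof -
  have cF: "continuous_on UNIV F"
    using F by (meson continuous_at_imp_continuous_on has_derivative_continuous)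
  have cp: "continuous_on UNIV p" using p by (rule has_score_continuous)
  have p0: "0 \<le> p x" for x using p by (auto simp: has_score_def)
  have meas[measurable]: "p \<in> borel_measurable borel" "B \<in> borel_measurable borel"
    "(\<lambda>x::'a. cutoff r x) \<in> borel_measurable borel" for r
    using cp cB by (auto intro!: borel_measurable_continuous_onI continuous_intros)
  define M where "M = A * (LBINT x. p x)"
  have M0: "M \<ge> 0" unfolding M_def using A p0 by (intro mult_nonneg_nonneg integral_nonneg_AE) auto
  \<comment> \<open>This is uniform in \<open>r\<close>: the nonnegative term with
    \<open>x . F x\<close> is dropped, and the cutoff is at most \<open>r^2\<close>.\<close>
  have bound: "(\<integral>\<^sup>+x. ennreal (p x * (cutoff r x / r\<^sup>2) * B x) \<partial>lborel) \<le> ennreal M" if r: "r > 0" for r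
  proof -
    have i1: "integrable lborel (\<lambda>x. p x * cutoff r x * B x)"
      by (rule integrable_lborel_compact_support[of _ r])
         (auto intro!: continuous_intros cp cB simp: cutoff_eq_0)
    have i2: "integrable lborel (\<lambda>x. p x * cutoff r x)"
      by (rule integrable_lborel_compact_support[of _ r])
         (auto intro!: continuous_intros cp simp: cutoff_eq_0)
    have i3: "integrable lborel (\<lambda>x. p x * (4 * max 0 (r - x \<bullet> x) * (x \<bullet> F x)))"
      by (rule integrable_lborel_compact_support[of _ r])
         (auto intro!: continuous_intros cp cF)
    have "0 = (LBINT x. A * (p x * cutoff r x) - p x * cutoff r x * B x
         - p x * (4 * max 0 (r - x \<bullet> x) * (x \<bullet> F x)))"
      using score_ibp_cutoff[OF p F DF, of r] unfolding AB by (simp add: algebra_simps)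
    also have "\<dots> = A * (LBINT x. p x * cutoff r x) - (LBINT x. p x * cutoff r x * B x)
         - (LBINT x. p x * (4 * max 0 (r - x \<bullet> x) * (x \<bullet> F x)))"
      using i1 i2 i3 by simp
    finally have eq: "(LBINT x. p x * cutoff r x * B x) = A * (LBINT x. p x * cutoff r x)
        - (LBINT x. p x * (4 * max 0 (r - x \<bullet> x) * (x \<bullet> F x)))" by simp
    have "0 \<le> (LBINT x. p x * (4 * max 0 (r - x \<bullet> x) * (x \<bullet> F x)))"
      using p0 Fx by (intro integral_nonneg_AE) (auto intro!: mult_nonneg_nonneg)
    with eq have "(LBINT x. p x * cutoff r x * B x) \<le> A * (LBINT x. p x * cutoff r x)" by simp
    also have "\<dots> \<le> A * (LBINT x. p x * r\<^sup>2)"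
      using i2 ip A p0 r
      by (intro mult_left_mono integral_mono) (auto simp: cutoff_def intro!: mult_left_mono power_mono)
    also have "\<dots> = M * r\<^sup>2" by (simp add: M_def)
    finally have le: "(LBINT x. p x * cutoff r x * B x) / r\<^sup>2 \<le> M" using r by (simp add: field_simps)
    have "(\<integral>\<^sup>+x. ennreal (p x * (cutoff r x / r\<^sup>2) * B x) \<partial>lborel)
       = ennreal (LBINT x. p x * (cutoff r x / r\<^sup>2) * B x)"
    proof (rule nn_integral_eq_integral)
      show "integrable lborel (\<lambda>x. p x * (cutoff r x / r\<^sup>2) * B x)"
        using integrable_divide_zero[of "r\<^sup>2", OF i1] by (simp add: field_simps)
      show "AE x in lborel. 0 \<le> p x * (cutoff r x / r\<^sup>2) * B x"
        using p0 B by (auto intro!: mult_nonneg_nonneg simp: cutoff_nonneg)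
    qed
    also have "(LBINT x. p x * (cutoff r x / r\<^sup>2) * B x) = (LBINT x. p x * cutoff r x * B x / r\<^sup>2)"
      by (simp add: field_simps)
    finally show ?thesis using le by (simp add: ennreal_leI)
  qed
  have lim: "(\<lambda>n. cutoff (Suc n) x / (real (Suc n))\<^sup>2) \<longlonglongrightarrow> 1" for x :: 'a
  proof -
    have "(\<lambda>n. (max 0 (1 - (x \<bullet> x) / real (Suc n)))\<^sup>2) \<longlonglongrightarrow> (max 0 (1 - 0))\<^sup>2"
      by (intro tendsto_intros LIMSEQ_Suc[OF lim_const_over_n])
    moreover have "(max 0 (1 - (x \<bullet> x) / real (Suc n)))\<^sup>2 = cutoff (Suc n) x / (real (Suc n))\<^sup>2" for n
      unfolding cutoff_def power_divide[symmetric] by (simp add: max_def field_simps)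
    ultimately show ?thesis by simp
  qed
  \<comment> \<open>Fatou's lemma is the right limit theorem here, since integrability of
    \<open>p B\<close> is part of the claim.\<close>
  have "(\<integral>\<^sup>+x. ennreal (p x * B x) \<partial>lborel)
     = (\<integral>\<^sup>+x. liminf (\<lambda>n. ennreal (p x * (cutoff (Suc n) x / (real (Suc n))\<^sup>2) * B x)) \<partial>lborel)"
  proof (rule nn_integral_cong)
    fix x
    have "(\<lambda>n. ennreal (p x * (cutoff (Suc n) x / (real (Suc n))\<^sup>2) * B x)) \<longlonglongrightarrow> ennreal (p x * 1 * B x)"
      by (intro tendsto_intros lim)
    then show "ennreal (p x * B x) = liminf (\<lambda>n. ennreal (p x * (cutoff (Suc n) x / (real (Suc n))\<^sup>2) * B x))"
      by (simp add: lim_imp_Liminf)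
  qed
  also have "\<dots> \<le> liminf (\<lambda>n. \<integral>\<^sup>+x. ennreal (p x * (cutoff (Suc n) x / (real (Suc n))\<^sup>2) * B x) \<partial>lborel)"
    by (rule nn_integral_liminf) simp
  also have "\<dots> \<le> liminf (\<lambda>n::nat. ennreal M)"
    by (rule Liminf_mono) (use bound in \<open>auto simp del: of_nat_Suc\<close>)
  also have "\<dots> = ennreal M" by (simp add: Liminf_const)
  finally have fin: "(\<integral>\<^sup>+x. ennreal (p x * B x) \<partial>lborel) \<le> ennreal M" .
  show int: "integrable lborel (\<lambda>x. p x * B x)"
  proof (rule integrableI_nonneg)
    show "(\<integral>\<^sup>+x. ennreal (p x * B x) \<partial>lborel) < \<infinity>"
      using fin by (simp add: order_le_less_trans)
  qed (use p0 B in auto)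
  have "ennreal (LBINT x. p x * B x) \<le> ennreal M"
    using fin nn_integral_eq_integral[OF int] p0 B by simp
  then show "(LBINT x. p x * B x) \<le> A * (LBINT x. p x)"
    using M0 by (simp add: M_def)
qed

section \<open>Factorization and differentiation of matrices\<close>

text \<open>The leading coefficient may be 0, as it will be for degenerate semidefinite forms, so
  the linear case is treated separately.\<close>

lemma nonneg_quadratic_discriminant:
  fixes a b c :: real
  assumes "\<And>t. 0 \<le> a + 2 * b * t + c * t\<^sup>2"
  shows "b\<^sup>2 \<le> a * c"
proof (cases "c = 0")
  case True
  have "b = 0"
  proof (rule ccontr)
    assume "b \<noteq> 0"
    then have "a + 2 * b * (- (a + 1) / (2 * b)) = -1" by (simp add: field_simps)
    with assms[of "- (a + 1) / (2 * b)"] True show False by simp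
  qed
  then show ?thesis using True by simp
next
  case False
  have "0 \<le> c"
  proof (rule ccontr)
    assume "\<not> 0 \<le> c"
    then have c: "c < 0" by simp
    \<comment> \<open>At this point \<open>c t\<close> outweighs \<open>2 b\<close> by at least
      \<open>|a| + 1\<close>, and \<open>t\<close> is at least 1, so the polynomial is
      negative.\<close>
    define t where "t = (\<bar>a\<bar> + 2 * \<bar>b\<bar> + 1) / (- c) + 1"
    have "0 \<le> (\<bar>a\<bar> + 2 * \<bar>b\<bar> + 1) / (- c)" using c by (intro divide_nonneg_nonneg) auto
    then have t: "t \<ge> 1" unfolding t_def by linarith
    have ct: "c * t = - (\<bar>a\<bar> + 2 * \<bar>b\<bar> + 1) + c" unfolding t_def using c by (simp add: field_simps)
    have "2 * b + c * t \<le> - \<bar>a\<bar> - 1" using ct c by linarith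
    then have "t * (2 * b + c * t) \<le> t * (- \<bar>a\<bar> - 1)" using t by (intro mult_left_mono) auto
    also have "\<dots> \<le> 1 * (- \<bar>a\<bar> - 1)" using t by (intro mult_right_mono_neg) auto
    finally have "a + 2 * b * t + c * t\<^sup>2 < 0" by (simp add: power2_eq_square algebra_simps)
    with assms[of t] show False by simp
  qed
  with False have c: "c > 0" by simp
  \<comment> \<open>The minimum of the polynomial is attained at t = - b / c.\<close>
  have "0 \<le> a + 2 * b * (- b / c) + c * (- b / c)\<^sup>2" by (rule assms)
  also have "\<dots> = a - b\<^sup>2 / c" using c by (simp add: field_simps power2_eq_square)
  finally show ?thesis using c by (simp add: field_simps)
qed

lemma inner_symmetric_matrix:
  fixes A :: "real^'n^'n"
  assumes "transpose A = A"
  shows "x \<bullet> (A *v y) = y \<bullet> (A *v x)"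
  by (metis assms dot_lmul_matrix inner_commute transpose_matrix_vector)

lemma psd_Cauchy_Schwarz:
  fixes A :: "real^'n^'n"
  assumes sym: "transpose A = A" and psd: "\<And>x. 0 \<le> x \<bullet> (A *v x)"
  shows "(x \<bullet> (A *v y))\<^sup>2 \<le> (x \<bullet> (A *v x)) * (y \<bullet> (A *v y))"
proof (rule nonneg_quadratic_discriminant)
  fix t
  have "0 \<le> (x + t *\<^sub>R y) \<bullet> (A *v (x + t *\<^sub>R y))" by (rule psd)
  also have "\<dots> = x \<bullet> (A *v x) + 2 * (x \<bullet> (A *v y)) * t + y \<bullet> (A *v y) * t\<^sup>2"
    using inner_symmetric_matrix[OF sym, of x y]
    by (simp add: matrix_vector_right_distrib matrix_vector_mult_scaleR inner_add_left inner_add_right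
        power2_eq_square algebra_simps)
  finally show "0 \<le> x \<bullet> (A *v x) + 2 * (x \<bullet> (A *v y)) * t + y \<bullet> (A *v y) * t\<^sup>2" .
qed

text \<open>Cholesky factorization by induction on the set of rows that may be nonzero: subtracting
  the outer product of the scaled column \<open>k\<close> clears row and column \<open>k\<close>,
  and the remaining Schur complement is again semidefinite.\<close>

lemma psd_sum_of_squares:
  fixes A :: "real^'n^'n"
  assumes "finite S" "transpose A = A" "\<And>x. 0 \<le> x \<bullet> (A *v x)" "\<And>i j. i \<notin> S \<Longrightarrow> A $ i $ j = 0"
  shows "\<exists>v :: 'n \<Rightarrow> real^'n. \<forall>i j. A $ i $ j = (\<Sum>k\<in>S. v k $ i * v k $ j :: real)"
  using assms
proof (induction S arbitrary: A rule: finite_induct)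
  case empty
  show ?case by (intro exI allI) (simp only: sum.empty empty.prems(3) empty_iff not_False_eq_True)
next
  case (insert k S)
  note sym = insert.prems(1) and psd = insert.prems(2)
  have sym': "A $ i $ j = A $ j $ i" for i j
    using arg_cong[OF sym, of "\<lambda>B. B $ j $ i"] by (simp add: transpose_def)
  \<comment> \<open>If \<open>A $ k $ k = 0\<close>, division by zero makes \<open>w\<close> zero.
    This is consistent, because Cauchy-Schwarz then forces the whole column \<open>k\<close> to
    vanish.\<close>
  define w :: "real^'n" where "w = (\<chi> i. A $ i $ k / sqrt (A $ k $ k))"
  define A' :: "real^'n^'n" where "A' = (\<chi> i j. A $ i $ j - w $ i * w $ j)"
  have ax: "(A *v axis j 1) $ i = A $ i $ j" for i j
    by (simp add: matrix_vector_mult_basis column_def)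
  have "0 \<le> axis k 1 \<bullet> (A *v axis k 1)" by (rule psd)
  then have akk: "0 \<le> A $ k $ k" by (simp add: inner_axis' ax)
  have cs: "(x \<bullet> column k A)\<^sup>2 \<le> (x \<bullet> (A *v x)) * A $ k $ k" for x
    using psd_Cauchy_Schwarz[OF sym psd, of x "axis k 1"]
    by (simp add: matrix_vector_mult_basis inner_axis') (simp add: column_def)
  have akj: "A $ j $ k = 0" if "A $ k $ k = 0" for j
    using cs[of "axis j 1"] that by (simp add: inner_axis' column_def)
  have wk: "w $ k * w $ j = A $ k $ j" for j
    using akj[of j] akk by (cases "A $ k $ k = 0") (auto simp: w_def sym'[of k j] real_sqrt_mult_self)
  have "\<exists>v :: 'n \<Rightarrow> real^'n. \<forall>i j. A' $ i $ j = (\<Sum>k\<in>S. v k $ i * v k $ j)"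
  proof (rule insert.IH)
    show "transpose A' = A'" by (simp add: A'_def transpose_def vec_eq_iff sym' mult.commute)
    fix x
    have "(A' *v x) $ i = (A *v x) $ i - w $ i * (w \<bullet> x)" for i
      by (simp add: A'_def matrix_vector_mult_def inner_vec_def sum_subtractf sum_distrib_left
          left_diff_distrib mult.assoc)
    then have "A' *v x = A *v x - (w \<bullet> x) *\<^sub>R w"
      by (simp add: vec_eq_iff)
    then have eq: "x \<bullet> (A' *v x) = x \<bullet> (A *v x) - (x \<bullet> w)\<^sup>2"
      by (simp add: inner_diff_right power2_eq_square inner_commute)
    have xw: "x \<bullet> w = (x \<bullet> column k A) / sqrt (A $ k $ k)"
      by (simp add: inner_vec_def w_def column_def sum_divide_distrib)
    \<comment> \<open>This is Cauchy-Schwarz for the form of \<open>A\<close> between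
      \<open>x\<close> and the axis vector \<open>k\<close>; it says that the Schur complement is
      semidefinite.\<close>
    have "(x \<bullet> w)\<^sup>2 \<le> x \<bullet> (A *v x)"
    proof (cases "A $ k $ k = 0")
      case True
      then show ?thesis using psd by (simp add: xw)
    next
      case False
      then show ?thesis using cs[of x] akk by (simp add: xw power_divide field_simps)
    qed
    then show "0 \<le> x \<bullet> (A' *v x)" by (simp add: eq)
  next
    fix i j assume i: "i \<notin> S"
    show "A' $ i $ j = 0"
    proof (cases "i = k")
      case True
      then show ?thesis using wk by (simp add: A'_def)
    next
      case False
      with i insert.prems(3) show ?thesis by (simp add: A'_def w_def)
    qed
  qed
  then obtain v where v: "\<And>i j. A' $ i $ j = (\<Sum>k\<in>S. v k $ i * v k $ j)" by blast
  have "A $ i $ j = (\<Sum>l\<in>insert k S. (v(k := w)) l $ i * (v(k := w)) l $ j)" for i j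
  proof -
    have "(\<Sum>l\<in>S. (v(k := w)) l $ i * (v(k := w)) l $ j) = (\<Sum>l\<in>S. v l $ i * v l $ j)"
      using insert.hyps by (intro sum.cong) auto
    then show ?thesis using insert.hyps v[of i j] by (simp add: A'_def)
  qed
  then show ?case by blast
qed

text \<open>The vectors of the sum of squares become the columns of \<open>B\<close>. A kernel
  vector of \<open>transpose B\<close> would annihilate the quadratic form, so definiteness makes
  \<open>B\<close> invertible.\<close>

lemma pos_def_factorization:
  fixes A :: "real^'n^'n"
  assumes "pos_def A"
  obtains B :: "real^'n^'n" where "A = B ** transpose B" "invertible B"
proof -
  have sym: "transpose A = A" and pd: "\<And>x. x \<noteq> 0 \<Longrightarrow> 0 < x \<bullet> (A *v x)"
    using assms by (auto simp: pos_def_def)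
  have psd: "0 \<le> x \<bullet> (A *v x)" for x using pd[of x] by (cases "x = 0") auto
  obtain v :: "'n \<Rightarrow> real^'n" where v: "\<And>i j. A $ i $ j = (\<Sum>k\<in>UNIV. v k $ i * v k $ j :: real)"
    using psd_sum_of_squares[OF finite_class.finite_UNIV sym psd] by auto
  define B :: "real^'n^'n" where "B = (\<chi> i k. v k $ i)"
  have A: "A = B ** transpose B"
    by (simp add: vec_eq_iff v B_def matrix_matrix_mult_def transpose_def)
  have "x = 0" if "transpose B *v x = 0" for x
  proof (rule ccontr)
    assume "x \<noteq> 0"
    moreover have "x \<bullet> (A *v x) = 0"
      using that by (simp add: A matrix_vector_mul_assoc[symmetric])
    ultimately show False using pd by fastforce
  qed
  then have "invertible (transpose B)"
    by (metis invertible_left_inverse matrix_left_invertible_ker)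
  then have "invertible B" by (simp add: invertible_det_nz)
  with A show thesis by (rule that)
qed

lemma pos_def_det_pos: 
  fixes A :: "real^'n^'n"
  assumes "pos_def A"
  shows "0 < det A"
proof -
  from assms
  obtain B :: "real^'n^'n" where "A = B ** transpose B" "invertible B" by (rule pos_def_factorization)
  then show ?thesis by (simp add: det_mul invertible_det_nz) (metis not_square_less_zero not_less_iff_gr_or_eq mult_eq_0_iff)
qed

section \<open>Differential calculus of matrix products, determinants and inverses\<close>

lemma bounded_bilinear_matrix_mult:
  "bounded_bilinear ((**) :: real^'n^'m \<Rightarrow> real^'p^'n \<Rightarrow> real^'p^'m)"
  unfolding bilinear_conv_bounded_bilinear[symmetric] bilinear_def
proof (intro conjI allI linearI)
  fix A A' :: "real^'n^'m" and B B' :: "real^'p^'n" and c :: real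
  show "A ** (B + B') = A ** B + A ** B'" by (rule matrix_add_ldistrib)
  show "(A + A') ** B = A ** B + A' ** B"
    by (simp add: vec_eq_iff matrix_matrix_mult_def sum.distrib distrib_right)
  show "A ** (c *\<^sub>R B) = c *\<^sub>R (A ** B)" "(c *\<^sub>R A) ** B = c *\<^sub>R (A ** B)"
    by (simp_all add: vec_eq_iff matrix_matrix_mult_def sum_distrib_left mult.left_commute mult.assoc)
qed

lemma bounded_linear_transpose: "bounded_linear (transpose :: real^'n^'m \<Rightarrow> real^'m^'n)"
  unfolding linear_conv_bounded_linear[symmetric]
  by (auto intro!: linearI simp: transpose_def vec_eq_iff)

lemma bounded_linear_trace: "bounded_linear (trace :: real^'n^'n \<Rightarrow> real)"
  unfolding linear_conv_bounded_linear[symmetric]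
  by (auto intro!: linearI simp: trace_def sum.distrib sum_distrib_left)

lemmas has_derivative_matrix_mult [derivative_intros] =
  bounded_bilinear.FDERIV[OF bounded_bilinear_matrix_mult]
lemmas has_derivative_transpose [derivative_intros] =
  bounded_linear.has_derivative[OF bounded_linear_transpose]
lemmas has_derivative_trace [derivative_intros] =
  bounded_linear.has_derivative[OF bounded_linear_trace]
lemmas continuous_on_matrix_mult [continuous_intros] =
  bounded_bilinear.continuous_on[OF bounded_bilinear_matrix_mult]
lemmas continuous_on_transpose [continuous_intros] =
  bounded_linear.continuous_on[OF bounded_linear_transpose]
lemmas continuous_on_trace [continuous_intros] =
  bounded_linear.continuous_on[OF bounded_linear_trace]

text \<open>In the Leibniz expansion only the identity permutation contributes to first order: every
  other permutation moves at least two indices, so a zero off-diagonal factor survives when the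
  product rule removes one factor.\<close>

lemma has_derivative_det_mat_1:
  "(det has_derivative (trace :: real^'n^'n \<Rightarrow> real)) (at (mat 1))"
proof -
  let ?P = "{p. p permutes (UNIV :: 'n set)}"
  let ?D = "\<lambda>p (H::real^'n^'n). \<Sum>i\<in>UNIV. H $ i $ p i * (\<Prod>j\<in>UNIV - {i}. (mat 1 :: real^'n^'n) $ j $ p j)"
  have "((\<lambda>A::real^'n^'n. \<Sum>p\<in>?P. of_int (sign p) * (\<Prod>i\<in>UNIV. A $ i $ p i)) has_derivative
      (\<lambda>H. \<Sum>p\<in>?P. of_int (sign p) * ?D p H)) (at (mat 1))"
  proof (rule has_derivative_sum)
    fix p
    have "((\<lambda>A::real^'n^'n. \<Prod>i\<in>UNIV. A $ i $ p i) has_derivative ?D p) (at (mat 1))"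
      by (rule has_derivative_prod)
         (auto intro!: bounded_linear.has_derivative[OF bounded_linear_vec_nth] has_derivative_ident)
    then show "((\<lambda>A::real^'n^'n. of_int (sign p) * (\<Prod>i\<in>UNIV. A $ i $ p i)) has_derivative
      (\<lambda>H. of_int (sign p) * ?D p H)) (at (mat 1))"
      by (rule has_derivative_mult_right)
  qed
  moreover have *: "?D p H = (if p = id then trace H else 0)" if p: "p \<in> ?P" for p H
  proof (cases "p = id")
    case True
    then show ?thesis by (simp add: trace_def mat_def)
  next
    case False
    then obtain k where k: "p k \<noteq> k" by fastforce
    \<comment> \<open>Both \<open>k\<close> and \<open>p k\<close> are moved; whichever index
      \<open>i\<close> is removed, one of them remains.\<close>
    have pk: "p (p k) \<noteq> p k" using k p by (metis mem_Collect_eq permutes_inj injD)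
    have "(\<Prod>j\<in>UNIV - {i}. (mat 1 :: real^'n^'n) $ j $ p j) = 0" for i
    proof (rule prod_zero)
      show "\<exists>j\<in>UNIV - {i}. (mat 1 :: real^'n^'n) $ j $ p j = 0"
        using k pk by (intro bexI[of _ "if i = k then p k else k"]) (auto simp: mat_def)
    qed simp
    then have "?D p H = 0" by (simp only: mult_zero_right sum.neutral_const)
    then show ?thesis using False by simp
  qed
  have "(\<Sum>p\<in>?P. of_int (sign p) * ?D p H) = (\<Sum>p\<in>?P. if p = id then trace H else 0)" for H
    by (rule sum.cong[OF refl]) (simp only: *, simp)
  then have "(\<Sum>p\<in>?P. of_int (sign p) * ?D p H) = trace H" for H
    by (simp add: sum.delta permutes_id)
  ultimately show ?thesis unfolding det_def[abs_def] by simp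
qed

text \<open>Writing det X = det A * det (B X) moves the point of differentiation to the identity
  matrix.\<close>

lemma has_derivative_det:
  fixes A B :: "real^'n^'n"
  assumes AB: "A ** B = mat 1" "B ** A = mat 1"
  shows "(det has_derivative (\<lambda>H. det A * trace (B ** H))) (at A)"
proof -
  have 1: "((\<lambda>X. B ** X) has_derivative (\<lambda>H. B ** H)) (at A)"
    by (rule bounded_linear_imp_has_derivative[OF bounded_bilinear.bounded_linear_right[OF bounded_bilinear_matrix_mult]])
  have "((\<lambda>X. det A * det (B ** X)) has_derivative (\<lambda>H. det A * trace (B ** H))) (at A)"
    by (rule has_derivative_mult_right, rule has_derivative_compose[OF 1]) (simp add: AB has_derivative_det_mat_1)
  moreover have "det A * det (B ** X) = det X" for X
    by (simp add: det_mul[symmetric] matrix_mul_assoc AB)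
  ultimately show ?thesis by simp
qed

text \<open>The identity \<open>G y = G x - G y (M y - M x) G x\<close> expresses \<open>G\<close>
  through a product whose second factor vanishes at \<open>x\<close>. Such a product is
  differentiable as soon as \<open>G\<close> is continuous there, so no differentiability of
  \<open>G\<close> has to be presupposed.\<close>

lemma has_derivative_matrix_inverse:
  fixes M G :: "'a::real_normed_vector \<Rightarrow> real^'n^'n"
  assumes M: "(M has_derivative M') (at x)"
    and MG: "\<And>y. M y ** G y = mat 1" "\<And>y. G y ** M y = mat 1"
    and G: "isCont G x"
  shows "(G has_derivative (\<lambda>h. - (G x ** M' h ** G x))) (at x)"
proof -
  note mm = bounded_bilinear_matrix_mult[where 'n='n and 'm='n and 'p='n]
  note diffs = bounded_bilinear.diff_left[OF mm] bounded_bilinear.diff_right[OF mm] bounded_bilinear.zero_right[OF mm]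
  from bounded_bilinear.pos_bounded[OF mm] obtain K
    where K: "K > 0" "\<forall>(A :: real^'n^'n) (B :: real^'n^'n). norm (A ** B) \<le> norm A * norm B * K"
    by (elim exE conjE) (rule that)
  note K = K(1) K(2)[rule_format]
  have blM: "bounded_linear M'" using M by (rule has_derivative_bounded_linear)
  from bounded_linear.pos_bounded[OF blM] obtain C
    where C: "C > 0" "\<forall>h. norm (M' h) \<le> norm h * C" by (elim exE conjE) (rule that)
  note C = C(1) C(2)[rule_format]
  have gen: "\<bar>inverse n\<bar> * N \<le> R" if "0 < n" "N \<le> R * n" for n N R :: real
    using that by (simp add: field_simps)
  define e where "e y = norm (M y - M x - M' (y - x)) / norm (y - x)" for y
  have "((\<lambda>y. inverse (norm (y - x)) *\<^sub>R (M y - M x - M' (y - x))) \<longlongrightarrow> 0) (at x)"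
    using M by (simp add: has_derivative_at_within)
  then have e: "(e \<longlongrightarrow> 0) (at x)" unfolding e_def[abs_def]
    by (rule tendsto_norm_zero[THEN tendsto_cong[THEN iffD1, rotated]]) (simp add: divide_inverse mult.commute)
  have "((\<lambda>y. G y ** (M y - M x)) has_derivative (\<lambda>h. G x ** M' h)) (at x)"
    unfolding has_derivative_at_within
  proof
    show "bounded_linear (\<lambda>h. G x ** M' h)"
      by (intro bounded_linear_compose[OF bounded_bilinear.bounded_linear_right[OF mm] blM])
    let ?R = "\<lambda>y. inverse (norm (y - x)) *\<^sub>R (G y ** (M y - M x) - G x ** (M x - M x) - G x ** M' (y - x))"
    show "(?R \<longlongrightarrow> 0) (at x)"
    proof (rule Lim_null_comparison)
      show "((\<lambda>y. norm (G y - G x) * C * K + norm (G y) * e y * K) \<longlongrightarrow> 0) (at x)"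
      proof -
        have "((\<lambda>y. norm (G y - G x) * C * K + norm (G y) * e y * K)
            \<longlongrightarrow> norm (G x - G x) * C * K + norm (G x) * 0 * K) (at x)"
          by (intro tendsto_intros e) (use G in \<open>auto simp: isCont_def\<close>)
        then show ?thesis by simp
      qed
      show "\<forall>\<^sub>F y in at x. norm (?R y)
         \<le> norm (G y - G x) * C * K + norm (G y) * e y * K"
      proof (rule eventually_at_filter[THEN iffD2], rule always_eventually, intro allI impI)
        \<comment> \<open>The remainder splits into the variation of \<open>G\<close> times the
          linear part and \<open>G y\<close> times the remainder of \<open>M\<close>.\<close>
        fix y assume "y \<noteq> x"
        then have nz: "norm (y - x) > 0" by simp
        have eq: "G y ** (M y - M x) - G x ** (M x - M x) - G x ** M' (y - x)
           = (G y - G x) ** M' (y - x) + G y ** (M y - M x - M' (y - x))"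
          by (simp add: diffs)
        have "norm ((G y - G x) ** M' (y - x)) \<le> norm (G y - G x) * (norm (y - x) * C) * K"
          using K(1) by (intro order_trans[OF K(2)] mult_right_mono mult_left_mono C(2)) auto
        moreover have "norm (G y ** (M y - M x - M' (y - x))) \<le> norm (G y) * (e y * norm (y - x)) * K"
          using K(2) nz by (simp add: e_def)
        ultimately have "norm ((G y - G x) ** M' (y - x) + G y ** (M y - M x - M' (y - x)))
          \<le> (norm (G y - G x) * C * K + norm (G y) * e y * K) * norm (y - x)"
          by (intro order_trans[OF norm_triangle_ineq]) (simp add: algebra_simps)
        then show "norm (?R y)
         \<le> norm (G y - G x) * C * K + norm (G y) * e y * K"
          unfolding eq norm_scaleR by (rule gen[OF nz])
      qed
    qed
  qed
  then have "((\<lambda>y. G x - (G y ** (M y - M x)) ** G x) has_derivative (\<lambda>h. 0 - (G x ** M' h ** G x))) (at x)"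
    by (intro has_derivative_diff has_derivative_const bounded_linear.has_derivative[OF bounded_bilinear.bounded_linear_left[OF mm]])
  moreover have "G x - (G y ** (M y - M x)) ** G x = G y" for y
    by (simp add: diffs MG matrix_mul_assoc[symmetric])
  ultimately show ?thesis by simp
qed

section \<open>The score of the matrix T density\<close>

lemma inner_matrix_trace: "(A::real^'d^'v) \<bullet> B = trace (A ** transpose B)"
  by (simp add: inner_vec_def trace_def matrix_matrix_mult_def transpose_def)

lemma inner_matrix_mult_left: "(A ** B) \<bullet> C = (B::real^'d^'v) \<bullet> (transpose A ** C)"
proof -
  have "trace (A ** B ** transpose C) = trace (B ** (transpose C ** A))"
    by (metis matrix_mul_assoc trace_mul_sym)
  then show ?thesis by (simp add: inner_matrix_trace matrix_transpose_mul)
qed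

lemma inner_transpose: "transpose A \<bullet> transpose B = (A::real^'d^'v) \<bullet> B"
proof -
  have "transpose A \<bullet> transpose B = (\<Sum>i\<in>UNIV. \<Sum>j\<in>UNIV. A $ j $ i * B $ j $ i)"
    by (simp add: inner_vec_def transpose_def)
  also have "\<dots> = A \<bullet> B" by (subst sum.swap) (simp add: inner_vec_def)
  finally show ?thesis .
qed

lemma inner_matrix_mult_right: "(A ** B) \<bullet> C = (A::real^'d^'v) \<bullet> (C ** transpose B)"
proof -
  have "(A ** B) \<bullet> C = (transpose B ** transpose A) \<bullet> transpose C"
    by (simp add: inner_transpose flip: matrix_transpose_mul)
  also have "\<dots> = transpose A \<bullet> transpose (C ** transpose B)"
    by (simp add: inner_matrix_mult_left matrix_transpose_mul transpose_transpose)
  finally show ?thesis by (simp add: inner_transpose)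
qed

section \<open>Traces of linear maps on matrix space\<close>

lemma sum_Basis_matrix:
  "(\<Sum>b\<in>(Basis :: (real^'d^'v) set). f b) = (\<Sum>i\<in>UNIV. \<Sum>j\<in>UNIV. f (axis i (axis j 1)))"
proof -
  have B: "(Basis :: (real^'d^'v) set) = (\<lambda>(i, j). axis i (axis j 1)) ` (UNIV \<times> UNIV)"
    by (auto simp: Basis_vec_def image_iff)
  have "inj_on (\<lambda>(i, j). axis i (axis j 1) :: real^'d^'v) (UNIV \<times> UNIV)"
    by (auto simp: inj_on_def axis_eq_axis)
  then show ?thesis unfolding B
    by (simp add: sum.reindex sum.cartesian_product case_prod_beta')
qed

lemma inner_axis_axis: "(A::real^'d^'v) \<bullet> axis i (axis j 1) = A $ i $ j"
  by (simp add: inner_axis)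

lemma axis_axis_nth: "(axis i (axis j (1::real)) :: real^'d^'v) $ k $ l = (if k = i then (if l = j then 1 else 0) else 0)"
  by (simp add: axis_def)

text \<open>This is the trace of the map X -> A X B, whose matrix is a Kronecker product. Together
  with its transposed variant it evaluates the divergences of the matrix fields below.\<close>

lemma sum_Basis_sandwich:
  fixes A :: "real^'v^'v" and B :: "real^'d^'d"
  shows "(\<Sum>b\<in>(Basis :: (real^'d^'v) set). (A ** b ** B) \<bullet> b) = trace A * trace B"
proof -
  have "(A ** axis i (axis j 1) ** B) \<bullet> axis i (axis j 1) = A $ i $ i * B $ j $ j" for i j
  proof -
    have "(A ** axis i (axis j 1 :: real^'d)) $ i $ k = (if k = j then A $ i $ i else 0)" for k
      by (simp add: matrix_matrix_mult_def axis_axis_nth if_distrib[of "\<lambda>x. _ * x"] cong: if_cong)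
    then show ?thesis
      by (simp add: inner_axis_axis matrix_matrix_mult_def[of _ B] if_distrib[of "\<lambda>x. x * _"] cong: if_cong)
  qed
  then show ?thesis
    by (simp add: sum_Basis_matrix trace_def sum_product)
qed

lemma sum_Basis_sandwich_transpose:
  fixes A B :: "real^'d^'v"
  shows "(\<Sum>b\<in>(Basis :: (real^'d^'v) set). (A ** transpose b ** B) \<bullet> b) = A \<bullet> B"
proof -
  have "(A ** transpose (axis i (axis j 1)) ** B) \<bullet> axis i (axis j 1) = A $ i $ j * B $ i $ j" for i j
  proof -
    have "(A ** transpose (axis i (axis j 1 :: real^'d))) $ i $ k = (if k = i then A $ i $ j else 0)" for k
      by (simp add: matrix_matrix_mult_def transpose_def axis_axis_nth if_distrib[of "\<lambda>x. _ * x"] cong: if_cong)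
    then show ?thesis
      by (simp add: inner_axis_axis matrix_matrix_mult_def[of _ B] if_distrib[of "\<lambda>x. x * _"] cong: if_cong)
  qed
  then show ?thesis by (simp add: sum_Basis_matrix inner_vec_def)
qed

section \<open>The resolvent of the Gram matrix: contraction, continuity and derivative\<close>

lemma matrix_inv_mult:
  assumes "invertible A"
  shows "A ** matrix_inv A = mat 1" "matrix_inv A ** A = mat 1"
  using someI_ex[OF assms[unfolded invertible_def]] unfolding matrix_inv_def by auto

definition gram :: "real \<Rightarrow> real^'d^'v \<Rightarrow> real^'v^'v" where
  "gram n X = mat 1 + (1 / n) *\<^sub>R (X ** transpose X)"

definition resolvent :: "real \<Rightarrow> real^'d^'v \<Rightarrow> real^'v^'v" where
  "resolvent n X = matrix_inv (gram n X)"

lemma transpose_scaleR: "transpose (c *\<^sub>R A) = c *\<^sub>R transpose (A :: real^'n^'m)"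
  by (simp add: transpose_def vec_eq_iff)

lemma transpose_add: "transpose (A + B) = transpose A + transpose (B :: real^'n^'m)"
  by (simp add: transpose_def vec_eq_iff)

lemma matrix_mult_scaleR:
  "(A :: real^'n^'m) ** (c *\<^sub>R B) = c *\<^sub>R (A ** B)" "(c *\<^sub>R A) ** (B :: real^'p^'n) = c *\<^sub>R (A ** B)"
  using bounded_bilinear.scaleR_left[OF bounded_bilinear_matrix_mult]
    bounded_bilinear.scaleR_right[OF bounded_bilinear_matrix_mult] by auto

lemma matrix_mult_add:
  "(A :: real^'n^'m) ** (B + B') = A ** B + A ** B'" "(A + A') ** (B :: real^'p^'n) = A ** B + A' ** B"
  using bounded_bilinear.add_left[OF bounded_bilinear_matrix_mult]
    bounded_bilinear.add_right[OF bounded_bilinear_matrix_mult] by auto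

lemma matrix_mult_minus:
  "(A :: real^'n^'m) ** (- B) = - (A ** B)" "(- A) ** (B :: real^'p^'n) = - (A ** B)"
  using bounded_bilinear.minus_left[OF bounded_bilinear_matrix_mult]
    bounded_bilinear.minus_right[OF bounded_bilinear_matrix_mult] by auto

lemma matrix_mult_diff:
  "(A :: real^'n^'m) ** (B - B') = A ** B - A ** B'" "(A - A') ** (B :: real^'p^'n) = A ** B - A' ** B"
  using bounded_bilinear.diff_left[OF bounded_bilinear_matrix_mult]
    bounded_bilinear.diff_right[OF bounded_bilinear_matrix_mult] by auto

lemma transpose_gram: "transpose (gram n X) = gram n X"
  by (simp add: gram_def transpose_add transpose_scaleR matrix_transpose_mul transpose_transpose transpose_mat)

lemma inner_gram: "v \<bullet> (gram n X *v v) = v \<bullet> v + (1 / n) * (norm (transpose X *v v))\<^sup>2"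
proof -
  have "(X ** transpose X) *v v = X *v (transpose X *v v)"
    by (simp only: matrix_vector_mul_assoc)
  then have "gram n X *v v = v + (1 / n) *\<^sub>R (X *v (transpose X *v v))"
    by (simp add: gram_def matrix_vector_mult_add_rdistrib scaleR_matrix_vector_assoc[symmetric])
  moreover have "v \<bullet> (X *v (transpose X *v v)) = (norm (transpose X *v v))\<^sup>2"
    by (simp add: dot_lmul_matrix[symmetric] transpose_matrix_vector power2_norm_eq_inner)
  ultimately show ?thesis by (simp add: inner_add_right)
qed

text \<open>The Gram matrix dominates the identity as a quadratic form, and Cauchy-Schwarz turns
  this into a lower norm bound. Its consequence, that the resolvent is a contraction, drives the
  later growth estimates.\<close>

lemma norm_gram_ge:
  assumes "n > 0"
  shows "norm v \<le> norm (gram n X *v v)"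
proof (cases "v = 0")
  case False
  have "norm v * norm v \<le> v \<bullet> (gram n X *v v)"
    using assms by (simp add: inner_gram norm_eq_sqrt_inner)
  also have "\<dots> \<le> norm v * norm (gram n X *v v)" by (rule norm_cauchy_schwarz)
  finally show ?thesis using False by simp
qed simp

lemma pos_def_gram: "n > 0 \<Longrightarrow> pos_def (gram n X)"
  unfolding pos_def_def by (simp add: transpose_gram inner_gram add_pos_nonneg)

lemma det_gram_pos: "n > 0 \<Longrightarrow> 0 < det (gram n X)"
  by (intro pos_def_det_pos pos_def_gram)

lemma gram_resolvent:
  assumes "n > 0"
  shows "gram n X ** resolvent n X = mat 1" "resolvent n X ** gram n X = mat 1"
proof -
  have "invertible (gram n X)"
    using det_gram_pos[OF assms, of X] by (simp add: invertible_det_nz)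
  then show "gram n X ** resolvent n X = mat 1" "resolvent n X ** gram n X = mat 1"
    unfolding resolvent_def by (simp_all add: matrix_inv_mult)
qed

lemma transpose_resolvent: "n > 0 \<Longrightarrow> transpose (resolvent n X) = resolvent n X"
proof -
  assume n: "n > 0"
  have "transpose (resolvent n X) ** gram n X = mat 1"
    using arg_cong[OF gram_resolvent(1)[OF n, of X], of transpose]
    by (simp add: matrix_transpose_mul transpose_gram transpose_mat)
  then have "transpose (resolvent n X) ** (gram n X ** resolvent n X) = resolvent n X"
    by (simp add: matrix_mul_assoc)
  then show ?thesis by (simp add: gram_resolvent[OF n])
qed

lemma norm_resolvent_vector: "n > 0 \<Longrightarrow> norm (resolvent n X *v v) \<le> norm v"
  using norm_gram_ge[of n "resolvent n X *v v" X]
  by (simp add: matrix_vector_mul_assoc gram_resolvent)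

lemma norm_matrix_columns: "(norm (A::real^'d^'v))\<^sup>2 = (\<Sum>j\<in>UNIV. (norm (column j A))\<^sup>2)"
proof -
  have "(norm A)\<^sup>2 = (\<Sum>i\<in>UNIV. \<Sum>j\<in>UNIV. (A $ i $ j)\<^sup>2)"
    by (simp add: norm_vec_def L2_set_def sum_nonneg)
  also have "\<dots> = (\<Sum>j\<in>UNIV. \<Sum>i\<in>UNIV. (A $ i $ j)\<^sup>2)" by (rule sum.swap)
  finally show ?thesis by (simp add: norm_vec_def L2_set_def sum_nonneg column_def)
qed

text \<open>The squared Frobenius norm is the sum of the squared column norms, and \<open>A\<close>
  acts on each column separately.\<close>

lemma norm_matrix_mult_le:
  fixes A :: "real^'v^'w" and V :: "real^'d^'v"
  assumes "\<And>v. norm (A *v v) \<le> c * norm v" "c \<ge> 0"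
  shows "norm (A ** V) \<le> c * norm V"
proof -
  have "column j (A ** V) = A *v column j V" for j
    by (simp add: column_def vec_eq_iff matrix_matrix_mult_def matrix_vector_mult_def)
  then have "(norm (A ** V))\<^sup>2 = (\<Sum>j\<in>UNIV. (norm (A *v column j V))\<^sup>2)"
    by (simp add: norm_matrix_columns)
  also have "\<dots> \<le> (\<Sum>j\<in>UNIV. (c * norm (column j V))\<^sup>2)"
    by (intro sum_mono power_mono assms) auto
  also have "\<dots> = (c * norm V)\<^sup>2"
    by (simp add: norm_matrix_columns[of V] power_mult_distrib sum_distrib_left)
  finally show ?thesis using assms(2) by (simp add: power2_le_iff_abs_le)
qed

lemma norm_resolvent_mult: "n > 0 \<Longrightarrow> norm (resolvent n X ** V) \<le> norm V"
  using norm_matrix_mult_le[of "resolvent n X" 1 V] norm_resolvent_vector[of n X] by simp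

lemma has_derivative_gram:
  "(gram n has_derivative (\<lambda>H. (1 / n) *\<^sub>R (X ** transpose H + H ** transpose X))) (at X)"
  unfolding gram_def[abs_def]
  by (rule has_derivative_eq_rhs,
      rule has_derivative_add[OF has_derivative_const has_derivative_scaleR_right],
      rule has_derivative_matrix_mult[OF has_derivative_ident has_derivative_transpose[OF has_derivative_ident]]) simp

lemma continuous_on_gram [continuous_intros]:
  "continuous_on S f \<Longrightarrow> continuous_on S (\<lambda>x. gram n (f x))"
  unfolding gram_def by (intro continuous_intros)

text \<open>By the resolvent identity the increment is \<open>- G Y (M Y - M X) G X\<close> with
  \<open>M\<close> the Gram matrix, and the contraction \<open>G Y\<close> can be discarded. This
  supplies the continuity required by \<open>has_derivative_matrix_inverse\<close>.\<close>

lemma isCont_resolvent: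
  fixes X :: "real^'d^'v"
  assumes n: "n > 0"
  shows "isCont (resolvent n) X"
proof -
  have "((\<lambda>Y. resolvent n Y - resolvent n X) \<longlongrightarrow> 0) (at X)"
  proof (rule Lim_null_comparison)
    have "continuous_on UNIV (\<lambda>Y :: real^'d^'v. (gram n Y - gram n X) ** resolvent n X)"
      by (intro continuous_intros)
    then have "isCont (\<lambda>Y. (gram n Y - gram n X) ** resolvent n X) X"
      by (simp add: continuous_on_eq_continuous_at)
    then show "((\<lambda>Y. norm ((gram n Y - gram n X) ** resolvent n X)) \<longlongrightarrow> 0) (at X)"
      by (intro tendsto_norm_zero) (simp add: isCont_def bounded_bilinear.zero_left[OF bounded_bilinear_matrix_mult])
    have "resolvent n Y - resolvent n X = - (resolvent n Y ** ((gram n Y - gram n X) ** resolvent n X))" for Y :: "real^'d^'v"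
      by (simp add: matrix_mult_diff gram_resolvent n matrix_mul_assoc)
    then show "\<forall>\<^sub>F Y in at X. norm (resolvent n Y - resolvent n X) \<le> norm ((gram n Y - gram n X) ** resolvent n X)"
      by (intro always_eventually allI) (simp add: norm_resolvent_mult n)
  qed
  then show ?thesis by (simp add: isCont_def LIM_zero_iff)
qed

lemma continuous_on_resolvent [continuous_intros]:
  "n > 0 \<Longrightarrow> continuous_on S f \<Longrightarrow> continuous_on S (\<lambda>x. resolvent n (f x))"
  by (rule continuous_on_compose2[of UNIV "resolvent n"])
     (auto intro: continuous_at_imp_continuous_on isCont_resolvent)

lemma has_derivative_resolvent:
  assumes n: "n > 0"
  shows "(resolvent n has_derivative (\<lambda>H. - (1 / n) *\<^sub>R
     (resolvent n X ** X ** transpose H ** resolvent n X + resolvent n X ** H ** transpose X ** resolvent n X))) (at X)"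
proof -
  have "(resolvent n has_derivative (\<lambda>H. - (resolvent n X ** ((1 / n) *\<^sub>R (X ** transpose H + H ** transpose X))
     ** resolvent n X))) (at X)"
    by (rule has_derivative_matrix_inverse[OF has_derivative_gram])
       (simp_all add: gram_resolvent n isCont_resolvent)
  then show ?thesis
    by (simp add: matrix_mult_scaleR matrix_mult_add matrix_mul_assoc)
qed

text \<open>The T density for identity matrices, stripped of its constant. The exponent parameter is
  kept separate from \<open>n\<close>.\<close>

definition t_kernel :: "real \<Rightarrow> real \<Rightarrow> real^'d^'v \<Rightarrow> real" where
  "t_kernel n m X = det (gram n X) powr (- (m / 2))"

definition t_score :: "real \<Rightarrow> real \<Rightarrow> real^'d^'v \<Rightarrow> real^'d^'v" where
  "t_score n m X = - (m / n) *\<^sub>R (resolvent n X ** X)"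

text \<open>The logarithmic derivative of the determinant is the trace of \<open>G\<close> times the
  derivative of the Gram matrix. By symmetry of \<open>G\<close> both terms of that derivative equal
  \<open>(1 / n) (G X . H)\<close>, and 2 / n times - m / 2 gives the factor - m / n.\<close>

lemma has_score_t_kernel:
  assumes n: "n > 0"
  shows "has_score (t_kernel n m :: real^'d^'v \<Rightarrow> real) (t_score n m)"
  unfolding has_score_def
proof (intro conjI allI)
  fix X :: "real^'d^'v"
  show "0 \<le> t_kernel n m X" by (simp add: t_kernel_def)
  show "continuous_on UNIV (t_score n m :: real^'d^'v \<Rightarrow> _)"
    unfolding t_score_def[abs_def] by (intro continuous_intros n)
  let ?G = "resolvent n X" and ?D = "det (gram n X)"
  have "((\<lambda>X. det (gram n X)) has_derivative
      (\<lambda>H. ?D * trace (?G ** ((1 / n) *\<^sub>R (X ** transpose H + H ** transpose X))))) (at X)"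
    by (rule has_derivative_compose[OF has_derivative_gram has_derivative_det])
       (simp_all add: gram_resolvent n)
  moreover have "trace (?G ** ((1 / n) *\<^sub>R (X ** transpose H + H ** transpose X))) = (2 / n) * ((?G ** X) \<bullet> H)" for H
  proof -
    have "trace (?G ** (X ** transpose H)) = (?G ** X) \<bullet> H"
      by (simp add: inner_matrix_trace matrix_mul_assoc)
    moreover have "trace (?G ** (H ** transpose X)) = (?G ** X) \<bullet> H"
    proof -
      have "trace (?G ** (H ** transpose X)) = (?G ** H) \<bullet> X"
        by (simp add: inner_matrix_trace matrix_mul_assoc)
      then show ?thesis by (simp add: inner_matrix_mult_left transpose_resolvent n inner_commute[of H])
    qed
    ultimately show ?thesis
      by (simp add: matrix_mult_scaleR matrix_mult_add trace_add
          linear_cmul[OF bounded_linear.linear[OF bounded_linear_trace]])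
  qed
  ultimately have d: "((\<lambda>X. det (gram n X)) has_derivative (\<lambda>H. ?D * ((2 / n) * ((?G ** X) \<bullet> H)))) (at X)"
    by simp
  have "((\<lambda>y. y powr (- (m / 2))) has_derivative (\<lambda>h. h * (- (m / 2) * ?D powr (- (m / 2) - 1)))) (at ?D)"
    using has_real_derivative_powr[OF det_gram_pos[OF n, of X], of "- (m / 2)"]
    by (simp only: has_field_derivative_def mult_commute_abs)
  from has_derivative_compose[OF d this]
  have "((\<lambda>X. det (gram n X) powr (- (m / 2))) has_derivative
    (\<lambda>H. ?D * ((2 / n) * ((?G ** X) \<bullet> H)) * (- (m / 2) * ?D powr (- (m / 2) - 1)))) (at X)" .
  moreover have "?D * ((2 / n) * ((?G ** X) \<bullet> H)) * (- (m / 2) * ?D powr (- (m / 2) - 1))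
     = t_kernel n m X * (t_score n m X \<bullet> H)" for H
    using det_gram_pos[OF n, of X]
    by (simp add: t_kernel_def t_score_def powr_diff)
  ultimately show "(t_kernel n m has_derivative (\<lambda>H. t_kernel n m X * (t_score n m X \<bullet> H))) (at X)"
    unfolding t_kernel_def[abs_def] by simp
qed

lemma norm_transpose: "norm (transpose A) = norm (A::real^'d^'v)"
  by (simp add: norm_eq_sqrt_inner inner_transpose)

lemma norm_matrix_vector_le: "norm ((A::real^'d^'v) *v x) \<le> norm A * norm x"
proof -
  have "(norm (A *v x))\<^sup>2 = (\<Sum>i\<in>UNIV. ((A $ i) \<bullet> x)\<^sup>2)"
    by (simp add: norm_vec_def L2_set_def sum_nonneg matrix_vector_mult_def inner_vec_def)
  also have "\<dots> \<le> (\<Sum>i\<in>UNIV. (norm (A $ i))\<^sup>2 * (norm x)\<^sup>2)"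
    by (intro sum_mono) (metis Cauchy_Schwarz_ineq power2_norm_eq_inner)
  also have "\<dots> = (norm A * norm x)\<^sup>2"
    by (simp add: norm_vec_def[of A] L2_set_def sum_nonneg sum_distrib_right[symmetric] power_mult_distrib)
  finally show ?thesis by (simp add: power2_le_iff_abs_le)
qed

lemma norm_matrix_mult_frobenius: "norm ((A::real^'v^'w) ** (B::real^'d^'v)) \<le> norm A * norm B"
  by (rule norm_matrix_mult_le[OF norm_matrix_vector_le]) simp

text \<open>This is tr(I - G). It is bounded, and \<open>X . t_score n m X\<close> is - m times it,
  so it is the natural scalar for the moment relations.\<close>

definition deficiency :: "real \<Rightarrow> real^'d^'v \<Rightarrow> real" where
  "deficiency n X = real CARD('v) - trace (resolvent n X)"

lemma continuous_on_deficiency [continuous_intros]: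
  "n > 0 \<Longrightarrow> continuous_on S f \<Longrightarrow> continuous_on S (\<lambda>x. deficiency n (f x))"
  unfolding deficiency_def by (intro continuous_intros)

lemma resolvent_outer:
  assumes n: "n > 0"
  shows "resolvent n X ** (X ** transpose X) = n *\<^sub>R (mat 1 - resolvent n X)"
proof -
  have "(1 / n) *\<^sub>R (resolvent n X ** (X ** transpose X)) = mat 1 - resolvent n X"
    using gram_resolvent(2)[OF n, of X]
    by (simp add: gram_def matrix_mult_add matrix_mult_scaleR eq_diff_eq add.commute)
  then have "n *\<^sub>R ((1 / n) *\<^sub>R (resolvent n X ** (X ** transpose X))) = n *\<^sub>R (mat 1 - resolvent n X)"
    by (rule arg_cong)
  then show ?thesis using n by simp
qed

lemma inner_resolvent_mult: "n > 0 \<Longrightarrow> X \<bullet> (resolvent n X ** X) = n * deficiency n X"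
proof -
  assume n: "n > 0"
  have "X \<bullet> (resolvent n X ** X) = trace (resolvent n X ** (X ** transpose X))"
    by (subst inner_commute) (simp add: inner_matrix_trace matrix_mul_assoc)
  also have "\<dots> = n * trace (mat 1 - resolvent n X)"
    by (simp add: resolvent_outer n linear_cmul[OF bounded_linear.linear[OF bounded_linear_trace]])
  finally show ?thesis by (simp add: deficiency_def trace_sub trace_I)
qed

text \<open>In terms of \<open>G\<close> this is tr(G (I - G)) \<le> tr(I - G). The proof expands
  \<open>X . G X\<close> after writing X as the Gram matrix times \<open>G X\<close>.\<close>

lemma norm_resolvent_mult_le_deficiency:
  assumes n: "n > 0"
  shows "(norm (resolvent n X ** X))\<^sup>2 \<le> n * deficiency n X"
proof -
  let ?Y = "resolvent n X ** X"
  have "X = gram n X ** ?Y" by (simp add: matrix_mul_assoc gram_resolvent n)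
  then have "X \<bullet> ?Y = (gram n X ** ?Y) \<bullet> ?Y" by simp
  also have "\<dots> = ?Y \<bullet> ?Y + (1 / n) * ((X ** (transpose X ** ?Y)) \<bullet> ?Y)"
    by (simp add: gram_def matrix_mult_add matrix_mult_scaleR inner_add_left matrix_mul_assoc)
  also have "(X ** (transpose X ** ?Y)) \<bullet> ?Y = (norm (transpose X ** ?Y))\<^sup>2"
    by (simp only: inner_matrix_mult_left power2_norm_eq_inner)
  finally have "n * deficiency n X = (norm ?Y)\<^sup>2 + (1 / n) * (norm (transpose X ** ?Y))\<^sup>2"
    by (simp add: inner_resolvent_mult n power2_norm_eq_inner)
  then show ?thesis using n by simp
qed

text \<open>Contraction puts every diagonal entry of the resolvent between -1 and 1. The bound
  serves only for integrability, so its crude factor 2 does not enter any constant of the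
  theorem.\<close>

lemma abs_deficiency_le:
  fixes X :: "real^'d^'v"
  assumes n: "n > 0"
  shows "\<bar>deficiency n X\<bar> \<le> 2 * real CARD('v)"
proof -
  have "\<bar>resolvent n X $ i $ i\<bar> \<le> 1" for i
  proof -
    have "\<bar>(resolvent n X *v axis i 1) $ i\<bar> \<le> norm (resolvent n X *v axis i 1)"
      by (rule component_le_norm_cart)
    also have "\<dots> \<le> 1" using norm_resolvent_vector[OF n, of X "axis i 1"] by simp
    finally show ?thesis by (simp add: matrix_vector_mult_basis column_def)
  qed
  then have "\<bar>trace (resolvent n X)\<bar> \<le> (\<Sum>i\<in>(UNIV :: 'v set). 1)"
    unfolding trace_def by (intro order_trans[OF sum_abs] sum_mono) auto
  then show ?thesis by (simp add: deficiency_def)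
qed

lemma has_derivative_deficiency:
  assumes n: "n > 0"
  shows "(deficiency n has_derivative
    (\<lambda>H. (2 / n) * ((resolvent n X ** (resolvent n X ** X)) \<bullet> H))) (at X)"
proof -
  let ?G = "resolvent n X"
  have "trace (?G ** X ** transpose H ** ?G) = (?G ** (?G ** X)) \<bullet> H" for H
    by (metis inner_matrix_trace matrix_mul_assoc trace_mul_sym)
  moreover have "trace (?G ** H ** transpose X ** ?G) = (?G ** (?G ** X)) \<bullet> H" for H
  proof -
    have "trace (?G ** H ** transpose X ** ?G) = (?G ** (?G ** H)) \<bullet> X"
      by (metis inner_matrix_trace matrix_mul_assoc trace_mul_sym)
    then show ?thesis by (simp add: inner_matrix_mult_left transpose_resolvent n inner_commute[of X])
  qed
  moreover have "(deficiency n has_derivative (\<lambda>H. 0 - trace (- (1 / n) *\<^sub>R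
     (?G ** X ** transpose H ** ?G + ?G ** H ** transpose X ** ?G)))) (at X)"
    unfolding deficiency_def[abs_def]
    by (intro has_derivative_diff has_derivative_const has_derivative_trace has_derivative_resolvent n)
  ultimately show ?thesis
    by (simp add: linear_cmul[OF bounded_linear.linear[OF bounded_linear_trace]] trace_add
        linear_neg[OF bounded_linear.linear[OF bounded_linear_trace]])
qed

text \<open>The summand is the derivative of X -> G X in the direction \<open>b\<close>. The three
  sums are \<open>d tr G\<close>, \<open>|G X|^2\<close> and \<open>tr G tr(X^T G X)\<close>, where
  tr G is \<nu> minus the deficiency and tr(X^T G X) is \<open>n\<close> times the
  deficiency.\<close>

lemma divergence_resolvent:
  fixes X :: "real^'d^'v"
  assumes n: "n > 0"
  shows "(\<Sum>b\<in>Basis. (resolvent n X ** b - (1 / n) *\<^sub>R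
      (resolvent n X ** X ** transpose b ** (resolvent n X ** X)
       + resolvent n X ** b ** (transpose X ** (resolvent n X ** X)))) \<bullet> b)
   = (real CARD('d) - deficiency n X) * (real CARD('v) - deficiency n X) - (norm (resolvent n X ** X))\<^sup>2 / n"
proof -
  let ?G = "resolvent n X"
  have 1: "(\<Sum>b\<in>(Basis :: (real^'d^'v) set). (?G ** b) \<bullet> b) = trace ?G * real CARD('d)"
    using sum_Basis_sandwich[of ?G "mat 1 :: real^'d^'d"] by (simp add: trace_I)
  have 2: "(\<Sum>b\<in>Basis. (?G ** X ** transpose b ** (?G ** X)) \<bullet> b) = (norm (?G ** X))\<^sup>2"
    by (simp only: sum_Basis_sandwich_transpose power2_norm_eq_inner)
  have "trace (transpose X ** (?G ** X)) = n * deficiency n X"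
    using inner_resolvent_mult[OF n, of X]
    by (metis inner_commute inner_matrix_trace trace_mul_sym)
  then have 3: "(\<Sum>b\<in>(Basis :: (real^'d^'v) set). (?G ** b ** (transpose X ** (?G ** X))) \<bullet> b) = trace ?G * (n * deficiency n X)"
    by (simp only: sum_Basis_sandwich)
  have "(\<Sum>b\<in>Basis. (?G ** b - (1 / n) *\<^sub>R
      (?G ** X ** transpose b ** (?G ** X) + ?G ** b ** (transpose X ** (?G ** X)))) \<bullet> b)
    = (\<Sum>b\<in>(Basis :: (real^'d^'v) set). (?G ** b) \<bullet> b) - (1 / n) * ((\<Sum>b\<in>Basis. (?G ** X ** transpose b ** (?G ** X)) \<bullet> b)
     + (\<Sum>b\<in>Basis. (?G ** b ** (transpose X ** (?G ** X))) \<bullet> b))"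
    by (simp only: inner_diff_left inner_add_left inner_scaleR_left sum_subtractf sum.distrib sum_distrib_left[symmetric])
  also have "\<dots> = trace ?G * real CARD('d) - (1 / n) * ((norm (?G ** X))\<^sup>2 + trace ?G * (n * deficiency n X))"
    by (simp only: 1 2 3)
  also have "\<dots> = (real CARD('d) - deficiency n X) * (real CARD('v) - deficiency n X) - (norm (?G ** X))\<^sup>2 / n"
    using n by (simp add: deficiency_def field_simps)
  finally show ?thesis .
qed

text \<open>The summand is the derivative of X -> \<open>gram n X ** X\<close> in the direction
  \<open>b\<close>.\<close>

lemma divergence_gram:
  fixes X :: "real^'d^'v"
  assumes n: "n > 0"
  shows "(\<Sum>b\<in>Basis. (gram n X ** b + (1 / n) *\<^sub>R (X ** transpose b ** X + b ** (transpose X ** X))) \<bullet> b)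
   = real CARD('v) * real CARD('d) + (real CARD('v) + real CARD('d) + 1) * (norm X)\<^sup>2 / n"
proof -
  have tr: "trace (gram n X) = real CARD('v) + (norm X)\<^sup>2 / n"
    by (simp add: gram_def trace_add trace_I linear_cmul[OF bounded_linear.linear[OF bounded_linear_trace]]
        inner_matrix_trace[symmetric] power2_norm_eq_inner)
  have 1: "(\<Sum>b\<in>(Basis :: (real^'d^'v) set). (gram n X ** b) \<bullet> b) = trace (gram n X) * real CARD('d)"
    using sum_Basis_sandwich[of "gram n X" "mat 1 :: real^'d^'d"] by (simp add: trace_I)
  have 2: "(\<Sum>b\<in>Basis. (X ** transpose b ** X) \<bullet> b) = (norm X)\<^sup>2"
    by (simp only: sum_Basis_sandwich_transpose power2_norm_eq_inner)
  have "trace (transpose X ** X) = (norm X)\<^sup>2"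
    by (metis inner_matrix_trace power2_norm_eq_inner trace_mul_sym)
  then have 3: "(\<Sum>b\<in>(Basis :: (real^'d^'v) set). (b ** (transpose X ** X)) \<bullet> b) = real CARD('v) * (norm X)\<^sup>2"
    using sum_Basis_sandwich[of "mat 1 :: real^'v^'v" "transpose X ** X"] by (simp add: trace_I)
  have "(\<Sum>b\<in>Basis. (gram n X ** b + (1 / n) *\<^sub>R (X ** transpose b ** X + b ** (transpose X ** X))) \<bullet> b)
    = (\<Sum>b\<in>(Basis :: (real^'d^'v) set). (gram n X ** b) \<bullet> b) + (1 / n) * ((\<Sum>b\<in>Basis. (X ** transpose b ** X) \<bullet> b)
     + (\<Sum>b\<in>(Basis :: (real^'d^'v) set). (b ** (transpose X ** X)) \<bullet> b))"
    by (simp only: inner_add_left inner_scaleR_left sum.distrib sum_distrib_left[symmetric])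
  then show ?thesis using n by (simp only: 1 2 3 tr) (simp add: field_simps)
qed

lemma score_ibp_quadratic_growth:
  fixes p :: "'a::euclidean_space \<Rightarrow> real" and F s :: "'a \<Rightarrow> 'a"
  assumes p: "has_score p s"
    and ip: "integrable lborel p" and ip2: "integrable lborel (\<lambda>x. p x * (norm x)\<^sup>2)"
    and F: "\<And>x. (F has_derivative DF x) (at x)"
    and DF: "\<And>b. b \<in> Basis \<Longrightarrow> continuous_on UNIV (\<lambda>x. DF x b)"
    and b1: "\<And>x. norm (F x) \<le> C * (1 + (norm x)\<^sup>2)"
    and b2: "\<And>b x. b \<in> Basis \<Longrightarrow> norm (DF x b) \<le> C * (1 + (norm x)\<^sup>2)"
    and b3: "\<And>x. norm (F x) * norm (s x) \<le> C * (1 + (norm x)\<^sup>2)"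
  shows "(LBINT x. p x * ((\<Sum>b\<in>Basis. DF x b \<bullet> b) + F x \<bullet> s x)) = 0"
proof -
  have cF: "continuous_on UNIV F"
    using F by (meson continuous_at_imp_continuous_on has_derivative_continuous)
  have cp: "continuous_on UNIV p" using p by (rule has_score_continuous)
  have cs: "continuous_on UNIV s" and p0: "\<And>x. 0 \<le> p x"
    using p by (auto simp: has_score_def)
  note dom = integrable_quadratic_growth[OF p0 cp ip ip2, where c = C]
  show ?thesis
    by (rule score_ibp[OF p F DF]; (intro dom continuous_intros cF cs DF)?)
       (auto intro: b1 b2 b3 simp: abs_mult)
qed

text \<open>Here N = \<nu> d and k = \<nu> + d, while \<open>S\<close>, \<open>E1\<close>,
  \<open>E2\<close> and \<open>A\<close> are the expectations of |T|^2, of the deficiency, of its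
  square and of |G T|^2 / n. The relations eliminate \<open>E1\<close> and \<open>E2\<close>; after
  that the leading parts of the three terms cancel.\<close>

lemma t_discrepancy_arithmetic:
  fixes n N k m E1 E2 A S :: real
  assumes n: "n > 2" and N: "N \<ge> 1" and k: "2 \<le> k" "k \<le> N + 1" and m: "m = n + k - 1"
    and E1: "m * E1 = N" and E2: "m * E2 = N * E1 + 2 * A" and A: "(m + 1) * A = N - k * E1 + E2"
    and AE: "A \<le> E1" and S: "(n - 2) / n * S \<le> N"
  shows "S - 2 * m * E1 + m\<^sup>2 / n * A \<le> 10 * N\<^sup>2 / (n * (n - 2))"
proof -
  have m0: "m > 0" using n k m by simp
  have mE2: "m * E2 \<le> (N + 2) * E1" using E2 AE by (simp add: algebra_simps)
  have "m\<^sup>2 * ((m + 1) * A) = m\<^sup>2 * N - k * m * (m * E1) + m * (m * E2)"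
    unfolding A by (simp add: algebra_simps power2_eq_square)
  also have "\<dots> \<le> m\<^sup>2 * N - k * m * N + m * ((N + 2) * E1)"
    unfolding E1 using mE2 m0 by simp
  also have "m * ((N + 2) * E1) = (N + 2) * (m * E1)" by simp
  also have "m\<^sup>2 * N - k * m * N + (N + 2) * (m * E1) = N * (m * (m - k) + N + 2)"
    unfolding E1 by (simp add: algebra_simps power2_eq_square)
  \<comment> \<open>Splitting off a multiple of m + 1 isolates the main term
    \<open>N (n - 2)\<close> in the division that follows.\<close>
  also have "m * (m - k) = (m + 1) * (n - 2) + (k + 1)"
    unfolding m by (simp add: algebra_simps)
  finally have "(m\<^sup>2 * A) * (m + 1) \<le> N * ((m + 1) * (n - 2) + (k + 1) + N + 2)"
    by (simp add: algebra_simps)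
  then have "m\<^sup>2 * A \<le> N * ((m + 1) * (n - 2) + (k + 1) + N + 2) / (m + 1)"
    using m0 by (simp add: pos_le_divide_eq)
  also have "\<dots> = N * (n - 2) + N * (k + N + 3) / (m + 1)"
    using m0 by (simp add: field_simps)
  \<comment> \<open>From k \<le> N + 1 the numerator is at most \<open>N (2 N + 4)\<close>, and m +
    1 = n + k exceeds n - 2.\<close>
  also have "N * (k + N + 3) / (m + 1) \<le> N * (2 * N + 4) / (n - 2)"
    using n N k m by (intro frac_le mult_left_mono) auto
  finally have mA: "m\<^sup>2 * A \<le> N * (n - 2) + N * (2 * N + 4) / (n - 2)" by simp
  have "m\<^sup>2 / n * A = (m\<^sup>2 * A) / n" by simp
  also have "\<dots> \<le> (N * (n - 2) + N * (2 * N + 4) / (n - 2)) / n"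
    using mA n by (intro divide_right_mono) auto
  finally have 1: "m\<^sup>2 / n * A \<le> (N * (n - 2) + N * (2 * N + 4) / (n - 2)) / n" .
  have 2: "S \<le> n * N / (n - 2)" using S n by (simp add: field_simps)
  have "S - 2 * m * E1 + m\<^sup>2 / n * A \<le> n * N / (n - 2) - 2 * N + (N * (n - 2) + N * (2 * N + 4) / (n - 2)) / n"
    using 1 2 E1 by simp
  \<comment> \<open>Over the common denominator the terms in N form n^2 - 2 n (n - 2) + (n - 2)^2 =
    4, so no power of \<open>n\<close> survives in the numerator. The constant 10 then comes from 2
    N + 8 \<le> 10 N.\<close>
  also have "\<dots> = N * (2 * N + 8) / (n * (n - 2))"
    using n by (simp add: divide_simps) (simp add: algebra_simps)
  also have "\<dots> \<le> N * (10 * N) / (n * (n - 2))"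
    using n N by (intro divide_right_mono mult_left_mono) auto
  also have "\<dots> = 10 * N\<^sup>2 / (n * (n - 2))"
    by (simp add: power2_eq_square)
  finally show ?thesis .
qed

section \<open>Moments of the matrix T density and its score\<close>

text \<open>In the field \<open>gram n X ** X\<close> the Gram matrix cancels the resolvent of the
  score, leaving - (m / n) |X|^2. With the divergence this is N - ((n - 2) / n) |X|^2, whose
  coefficient is where n > 2 enters; \<open>score_moment_bound\<close> then gives finiteness and the
  bound together.\<close>

lemma t_second_moment:
  fixes p :: "real^'d^'v \<Rightarrow> real"
  assumes n: "n > 2" and m: "m = n + real CARD('v) + real CARD('d) - 1"
    and p: "has_score p (t_score n m)" and ip: "integrable lborel p" and p1: "(LBINT x. p x) = 1"
  shows "integrable lborel (\<lambda>x. p x * (norm x)\<^sup>2)"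
    "(n - 2) / n * (LBINT x. p x * (norm x)\<^sup>2) \<le> real CARD('v) * real CARD('d)"
proof -
  have n0: "n > 0" using n by simp
  let ?N = "real CARD('v) * real CARD('d)"
  let ?B = "\<lambda>X :: real^'d^'v. (n - 2) / n * (norm X)\<^sup>2"
  let ?D = "\<lambda>X b :: real^'d^'v. gram n X ** b + (1 / n) *\<^sub>R (X ** transpose b ** X + b ** (transpose X ** X))"
  have F: "((\<lambda>X. gram n X ** X) has_derivative ?D X) (at X)" for X :: "real^'d^'v"
    by (rule has_derivative_eq_rhs[OF has_derivative_matrix_mult[OF has_derivative_gram has_derivative_ident]])
       (simp add: matrix_mult_scaleR matrix_mult_add matrix_mul_assoc)
  have DF: "continuous_on UNIV (\<lambda>X. ?D X b)" for b by (intro continuous_intros)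
  have Fx: "0 \<le> X \<bullet> (gram n X ** X)" for X :: "real^'d^'v"
  proof -
    have "X \<bullet> (gram n X ** X) = X \<bullet> X + (1 / n) * (X \<bullet> (X ** (transpose X ** X)))"
      by (simp add: gram_def matrix_mult_add matrix_mult_scaleR inner_add_right matrix_mul_assoc)
    also have "X \<bullet> (X ** (transpose X ** X)) = (transpose X ** X) \<bullet> (transpose X ** X)"
      by (subst inner_commute) (simp add: inner_matrix_mult_left)
    finally show ?thesis using n0 by simp
  qed
  have AB: "(\<Sum>b\<in>Basis. ?D X b \<bullet> b) + (gram n X ** X) \<bullet> t_score n m X = ?N - ?B X" for X :: "real^'d^'v"
  proof -
    have "(gram n X ** X) \<bullet> (resolvent n X ** X) = (norm X)\<^sup>2"
      by (simp add: inner_matrix_mult_left[of "gram n X"] transpose_gram matrix_mul_assoc gram_resolvent n0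
          power2_norm_eq_inner)
    then show ?thesis
      unfolding divergence_gram[OF n0] t_score_def using n0 by (simp add: m field_simps)
  qed
  have B: "0 \<le> ?B X" for X :: "real^'d^'v" using n by simp
  have cB: "continuous_on UNIV ?B" by (intro continuous_intros)
  note mb = score_moment_bound[OF p ip F DF Fx AB _ B cB]
  have "integrable lborel (\<lambda>x. n / (n - 2) * (p x * ?B x))"
    using mb(1) by (intro integrable_mult_right) auto
  moreover have "n / (n - 2) * (p x * ?B x) = p x * (norm x)\<^sup>2" for x
    using n by (simp add: field_simps)
  ultimately show "integrable lborel (\<lambda>x. p x * (norm x)\<^sup>2)" by simp
  have "(LBINT x. p x * ?B x) = (LBINT x. (n - 2) / n * (p x * (norm x)\<^sup>2))"
    by (rule Bochner_Integration.integral_cong) auto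
  also have "\<dots> = (n - 2) / n * (LBINT x. p x * (norm x)\<^sup>2)"
    by (simp only: integral_mult_right_zero)
  finally have eq: "(LBINT x. p x * ?B x) = (n - 2) / n * (LBINT x. p x * (norm x)\<^sup>2)" .
  have "(LBINT x. p x * ?B x) \<le> ?N * (LBINT x. p x)" by (rule mb(2)) simp
  then show "(n - 2) / n * (LBINT x. p x * (norm x)\<^sup>2) \<le> ?N"
    by (simp only: eq p1 mult_1_right)
qed

lemma norm_t_score_le:
  assumes "n > 0" "m > 0"
  shows "norm (t_score n m X) \<le> m / n * norm X"
  using assms by (simp add: t_score_def mult_left_mono divide_right_mono norm_resolvent_mult)

text \<open>With u the deficiency, divergence plus score term is N - m u for the field X, N u + 2 a
  - m u^2 for the field u X, and N - k u + u^2 - (m + 1) a for the field G X. Integration turns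
  these into the three equations.\<close>

lemma t_score_moments:
  fixes p :: "real^'d^'v \<Rightarrow> real"
  defines "N \<equiv> real CARD('v) * real CARD('d)" and "k \<equiv> real CARD('v) + real CARD('d)"
  assumes n: "n > 2" and m: "m = n + real CARD('v) + real CARD('d) - 1"
    and p: "has_score p (t_score n m)" and ip: "integrable lborel p" and p1: "(LBINT x. p x) = 1"
  defines "a \<equiv> \<lambda>X. (norm (resolvent n X ** X))\<^sup>2 / n"
  shows "integrable lborel (\<lambda>X. p X * deficiency n X)" (is ?i1)
    and "integrable lborel (\<lambda>X. p X * (deficiency n X)\<^sup>2)" (is ?i2)
    and "integrable lborel (\<lambda>X. p X * a X)" (is ?i3)
    and "m * (LBINT X. p X * deficiency n X) = N" (is ?t1)
    and "m * (LBINT X. p X * (deficiency n X)\<^sup>2)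
       = N * (LBINT X. p X * deficiency n X) + 2 * (LBINT X. p X * a X)" (is ?t2)
    and "(m + 1) * (LBINT X. p X * a X)
       = N - k * (LBINT X. p X * deficiency n X) + (LBINT X. p X * (deficiency n X)\<^sup>2)" (is ?t3)
proof -
  let ?G = "resolvent n"
  let ?Du = "\<lambda>X b. deficiency n X *\<^sub>R b + ((2 / n) * ((?G X ** (?G X ** X)) \<bullet> b)) *\<^sub>R X"
  let ?DG = "\<lambda>X b. ?G X ** b - (1 / n) *\<^sub>R (?G X ** X ** transpose b ** (?G X ** X) + ?G X ** b ** (transpose X ** (?G X ** X)))"
  have n0: "n > 0" using n by simp
  have v1: "real CARD('v) \<ge> 1" "real CARD('d) \<ge> 1"
    by (simp_all add: Suc_le_eq)
  have m0: "m > 0" using n v1 unfolding m by linarith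
  have p0: "0 \<le> p x" for x using p by (rule has_score_nonneg)
  have cp: "continuous_on UNIV p" using p by (rule has_score_continuous)
  have ip2: "integrable lborel (\<lambda>x. p x * (norm x)\<^sup>2)" by (rule t_second_moment[OF n m p ip p1])
  have ca: "continuous_on UNIV a" unfolding a_def by (intro continuous_intros n0) (use n0 in auto)
  have a_le: "a X \<le> deficiency n X" for X
    unfolding a_def using norm_resolvent_mult_le_deficiency[OF n0, of X] n0 by (simp add: field_simps)
  have a0: "0 \<le> a X" for X unfolding a_def using n0 by simp
  have u0: "0 \<le> deficiency n X" for X :: "real^'d^'v" using a0 a_le order_trans by blast
  define K where "K = 2 * real CARD('v)"
  have uK: "deficiency n X \<le> K" for X :: "real^'d^'v"
    using abs_deficiency_le[OF n0, of X] by (simp add: K_def)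
  have K1: "K \<ge> 1" using v1 unfolding K_def by linarith
  have K_up: "t \<le> K\<^sup>2 * (1 + (norm X)\<^sup>2)" if "t \<le> K\<^sup>2" for t and X :: "real^'d^'v"
    using that mult_left_mono[of 1 "1 + (norm X)\<^sup>2" "K\<^sup>2"] by simp
  have KK: "K \<le> K\<^sup>2" using K1 by (simp add: power2_eq_square)
  note dom = integrable_quadratic_growth[OF p0 cp ip ip2, where c = "K\<^sup>2"]
  show ?i1
    by (rule dom) (use u0 uK KK in \<open>auto intro!: continuous_intros n0 K_up intro: order_trans\<close>)
  show ?i2
    by (rule dom) (use u0 uK in \<open>auto intro!: continuous_intros n0 K_up power_mono\<close>)
  show ?i3
    by (rule dom) (use a0 ca KK order_trans[OF a_le uK] in \<open>auto intro!: K_up intro: order_trans\<close>)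
  have q1: "norm X \<le> 1 + (norm X)\<^sup>2" for X :: "real^'d^'v"
    by (rule le_one_plus_square)
  have sX: "norm (t_score n m X) \<le> m / n * norm X" for X :: "real^'d^'v"
    by (rule norm_t_score_le[OF n0 m0])
  have sF: "norm F * norm (t_score n m X) \<le> C * (m / n) * (1 + (norm X)\<^sup>2)"
    if "norm F \<le> C * norm X" "C \<ge> 0" for F X :: "real^'d^'v" and C
  proof -
    have "norm F * norm (t_score n m X) \<le> (C * norm X) * (m / n * norm X)"
      using that by (intro mult_mono sX) auto
    also have "\<dots> = C * (m / n) * (norm X)\<^sup>2" by (simp add: power2_eq_square)
    also have "\<dots> \<le> C * (m / n) * (1 + (norm X)\<^sup>2)"
      using that n0 m0 by (intro mult_left_mono) auto
    finally show ?thesis .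
  qed
  have Xs: "X \<bullet> t_score n m X = - m * deficiency n X" for X :: "real^'d^'v"
    using n0 by (simp add: t_score_def inner_resolvent_mult)
  have GX: "norm (?G X ** X) \<le> norm X" for X :: "real^'d^'v"
    by (rule norm_resolvent_mult[OF n0])
  have GGX: "norm (?G X ** (?G X ** X)) \<le> norm X" for X :: "real^'d^'v"
    using norm_resolvent_mult[OF n0] GX order_trans by blast
  \<comment> \<open>One constant dominating all growth coefficients that occur for the three
    fields.\<close>
  define C1 where "C1 = K + K * (m / n) + 2 / n + 1 + m / n"
  have C1: "1 \<le> C1" "1 * (m / n) \<le> C1" "K \<le> C1" "K * (m / n) \<le> C1" "2 / n + K \<le> C1" "2 / n + 1 \<le> C1"
    unfolding C1_def using n0 m0 K1 by auto
  have up: "t \<le> C1 * (1 + (norm X)\<^sup>2)" if "t \<le> c * (1 + (norm X)\<^sup>2)" "c \<le> C1" for t c and X :: "real^'d^'v"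
    using that(1) by (rule order_trans) (intro mult_right_mono that(2), simp)
  have up1: "t \<le> C1 * (1 + (norm X)\<^sup>2)" if "t \<le> c * norm X" "c \<le> C1" "c \<ge> 0" for t c and X :: "real^'d^'v"
  proof (rule up[OF _ that(2)])
    show "t \<le> c * (1 + (norm X)\<^sup>2)"
      using that(1) mult_left_mono[OF q1[of X] that(3)] by linarith
  qed
  have "(LBINT X. p X * ((\<Sum>b\<in>(Basis :: (real^'d^'v) set). b \<bullet> b) + X \<bullet> t_score n m X)) = 0"
  proof (rule score_ibp_quadratic_growth[OF p ip ip2, where F = "\<lambda>X. X" and DF = "\<lambda>X b. b" and C = C1])
    fix X :: "real^'d^'v"
    show "norm X \<le> C1 * (1 + (norm X)\<^sup>2)" by (rule up1[of _ 1]) (use C1 in auto)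
    show "norm X * norm (t_score n m X) \<le> C1 * (1 + (norm X)\<^sup>2)"
      by (rule up[OF sF[of _ 1]]) (use C1 in auto)
    fix b :: "real^'d^'v" assume "b \<in> Basis"
    then show "norm b \<le> C1 * (1 + (norm X)\<^sup>2)"
      using C1 by (intro up[of _ 1]) auto
  qed (auto intro!: derivative_eq_intros continuous_intros)
  moreover have "(\<Sum>b\<in>(Basis :: (real^'d^'v) set). b \<bullet> b) = N"
    by (simp add: N_def inner_same_Basis cong: sum.cong)
  ultimately have "(LBINT X. N * p X - m * (p X * deficiency n X)) = 0"
    by (simp add: Xs algebra_simps)
  then show ?t1 using \<open>?i1\<close> ip p1 by simp
  have I2: "(LBINT X. p X * ((\<Sum>b\<in>Basis. (?Du X b) \<bullet> b)
       + (deficiency n X *\<^sub>R X) \<bullet> t_score n m X)) = 0"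
  proof (rule score_ibp_quadratic_growth[OF p ip ip2, where C = C1])
    fix X :: "real^'d^'v"
    show "((\<lambda>X. deficiency n X *\<^sub>R X) has_derivative (\<lambda>H. deficiency n X *\<^sub>R H
       + ((2 / n) * ((?G X ** (?G X ** X)) \<bullet> H)) *\<^sub>R X)) (at X)"
      by (rule has_derivative_scaleR[OF has_derivative_deficiency[OF n0] has_derivative_ident])
    have nF: "norm (deficiency n X *\<^sub>R X) \<le> K * norm X"
      using u0[of X] uK[of X] by (simp add: mult_right_mono)
    show "norm (deficiency n X *\<^sub>R X) \<le> C1 * (1 + (norm X)\<^sup>2)"
      by (rule up1[OF nF]) (use C1 K1 in auto)
    show "norm (deficiency n X *\<^sub>R X) * norm (t_score n m X) \<le> C1 * (1 + (norm X)\<^sup>2)"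
      by (rule up[OF sF[OF nF]]) (use C1 K1 in auto)
    fix b :: "real^'d^'v" assume b: "b \<in> Basis"
    show "norm (?Du X b)
       \<le> C1 * (1 + (norm X)\<^sup>2)"
    proof (rule up)
      have "\<bar>(?G X ** (?G X ** X)) \<bullet> b\<bar> \<le> norm X"
        using Basis_le_norm[OF b, of "?G X ** (?G X ** X)"] GGX[of X] by linarith
      then have "2 / n * \<bar>(?G X ** (?G X ** X)) \<bullet> b\<bar> * norm X \<le> 2 / n * norm X * norm X"
        using n0 by (intro mult_right_mono mult_left_mono) auto
      moreover have "norm (?Du X b)
        \<le> deficiency n X + 2 / n * \<bar>(?G X ** (?G X ** X)) \<bullet> b\<bar> * norm X"
        using u0[of X] b n0 by (intro order_trans[OF norm_triangle_ineq]) (simp add: abs_mult)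
      moreover have "2 / n * norm X * norm X + K \<le> (2 / n + K) * (1 + (norm X)\<^sup>2)"
        using n0 K1 by (simp add: power2_eq_square algebra_simps)
      ultimately show "norm (?Du X b)
        \<le> (2 / n + K) * (1 + (norm X)\<^sup>2)"
        using uK[of X] by linarith
    qed (rule C1)
  next
    fix b :: "real^'d^'v"
    show "continuous_on UNIV (\<lambda>X. ?Du X b)"
      by (intro continuous_intros n0)
  qed
  \<comment> \<open>The gradient of the deficiency contributes (2 / n) (G G X . X) = 2 |G X|^2 / n,
    by symmetry of \<open>G\<close>.\<close>
  have E2: "(\<Sum>b\<in>Basis. (?Du X b) \<bullet> b)
       + (deficiency n X *\<^sub>R X) \<bullet> t_score n m X = N * deficiency n X + 2 * a X - m * (deficiency n X)\<^sup>2" for X :: "real^'d^'v"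
  proof -
    have "(\<Sum>b\<in>Basis. (?Du X b) \<bullet> b)
      = deficiency n X * (\<Sum>b\<in>(Basis :: (real^'d^'v) set). b \<bullet> b)
        + (2 / n) * (\<Sum>b\<in>Basis. ((?G X ** (?G X ** X)) \<bullet> b) * (X \<bullet> b))"
      by (simp add: inner_add_left sum.distrib sum_distrib_left mult.assoc)
    also have "(\<Sum>b\<in>Basis. ((?G X ** (?G X ** X)) \<bullet> b) * (X \<bullet> b))
        = (?G X ** (?G X ** X)) \<bullet> X"
      by (rule euclidean_inner[symmetric])
    also have "\<dots> = (norm (?G X ** X))\<^sup>2"
      by (simp add: inner_matrix_mult_left[of "?G X" "?G X ** X"] transpose_resolvent n0
          power2_norm_eq_inner)
    also have "(\<Sum>b\<in>(Basis :: (real^'d^'v) set). b \<bullet> b) = N"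
      by (simp add: N_def inner_same_Basis cong: sum.cong)
    finally show ?thesis by (simp add: Xs a_def power2_eq_square)
  qed
  have "(LBINT X. N * (p X * deficiency n X) + 2 * (p X * a X) - m * (p X * (deficiency n X)\<^sup>2)) = 0"
    using I2[unfolded E2] by (simp add: algebra_simps)
  then show ?t2 using \<open>?i1\<close> \<open>?i2\<close> \<open>?i3\<close> by simp
  have I3: "(LBINT X. p X * ((\<Sum>b\<in>Basis. (?DG X b) \<bullet> b)
       + (?G X ** X) \<bullet> t_score n m X)) = 0"
  proof (rule score_ibp_quadratic_growth[OF p ip ip2, where C = C1])
    fix X :: "real^'d^'v"
    show "((\<lambda>X. ?G X ** X) has_derivative (\<lambda>b. ?DG X b)) (at X)"
      by (rule has_derivative_eq_rhs[OF has_derivative_matrix_mult[OF has_derivative_resolvent[OF n0] has_derivative_ident]])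
         (simp add: matrix_mult_scaleR matrix_mult_add matrix_mult_minus matrix_mul_assoc)
    have nF: "norm (?G X ** X) \<le> 1 * norm X" using GX by simp
    show "norm (?G X ** X) \<le> C1 * (1 + (norm X)\<^sup>2)"
      by (rule up1[OF nF]) (use C1 in auto)
    show "norm (?G X ** X) * norm (t_score n m X) \<le> C1 * (1 + (norm X)\<^sup>2)"
      by (rule up[OF sF[OF nF]]) (use C1 in auto)
    fix b :: "real^'d^'v" assume b: "b \<in> Basis"
    show "norm (?DG X b) \<le> C1 * (1 + (norm X)\<^sup>2)"
    proof (rule up)
      have 1: "norm (?G X ** b) \<le> 1"
        using norm_resolvent_mult[OF n0, of X b] b by simp
      have "norm (?G X ** X ** transpose b ** (?G X ** X))
          \<le> norm (?G X ** X) * norm (transpose b) * norm (?G X ** X)"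
        by (intro order_trans[OF norm_matrix_mult_frobenius] mult_right_mono norm_matrix_mult_frobenius) auto
      also have "\<dots> \<le> norm X * 1 * norm X"
        using b by (intro mult_mono GX) (auto simp: norm_transpose)
      finally have 2: "norm (?G X ** X ** transpose b ** (?G X ** X)) \<le> (norm X)\<^sup>2"
        by (simp add: power2_eq_square)
      have "norm (?G X ** b ** (transpose X ** (?G X ** X)))
          \<le> norm (?G X ** b) * (norm (transpose X) * norm (?G X ** X))"
        by (intro order_trans[OF norm_matrix_mult_frobenius] mult_left_mono norm_matrix_mult_frobenius) auto
      also have "\<dots> \<le> 1 * (norm X * norm X)"
        by (intro mult_mono GX 1) (auto simp: norm_transpose)
      finally have 3: "norm (?G X ** b ** (transpose X ** (?G X ** X))) \<le> (norm X)\<^sup>2"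
        by (simp add: power2_eq_square)
      have "norm ((1 / n) *\<^sub>R (?G X ** X ** transpose b ** (?G X ** X)
       + ?G X ** b ** (transpose X ** (?G X ** X)))) \<le> (1 / n) * ((norm X)\<^sup>2 + (norm X)\<^sup>2)"
        unfolding norm_scaleR using n0
        by (intro mult_mono order_trans[OF norm_triangle_ineq] add_mono 2 3) auto
      with 1 have "norm (?DG X b) \<le> 1 + (1 / n) * ((norm X)\<^sup>2 + (norm X)\<^sup>2)"
        by (intro order_trans[OF norm_triangle_ineq4] add_mono)
      also have "\<dots> \<le> (2 / n + 1) * (1 + (norm X)\<^sup>2)"
        using n0 by (simp add: algebra_simps add_divide_distrib)
      finally show "norm (?DG X b) \<le> (2 / n + 1) * (1 + (norm X)\<^sup>2)" .
    qed (rule C1)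
  next
    fix b :: "real^'d^'v"
    show "continuous_on UNIV (\<lambda>X. ?DG X b)"
      by (intro continuous_intros n0)
  qed
  have E3: "(?G X ** X) \<bullet> t_score n m X = - m * a X" for X :: "real^'d^'v"
    by (simp add: t_score_def a_def power2_norm_eq_inner)
  have aX: "(norm (?G X ** X))\<^sup>2 / n = a X" for X by (simp add: a_def)
  have "(LBINT X. N * p X - k * (p X * deficiency n X) + p X * (deficiency n X)\<^sup>2 - (m + 1) * (p X * a X)) = 0"
    using I3[unfolded divergence_resolvent[OF n0] E3 aX]
    by (simp add: N_def k_def power2_eq_square[where a = "deficiency n X" for X] algebra_simps)
  then show ?t3 using \<open>?i1\<close> \<open>?i2\<close> \<open>?i3\<close> ip p1 by simp
qed

text \<open>A Jensen inequality through f \<le> f^2 / (2 C) + C / 2, which also gives integrability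
  by domination.\<close>

lemma weighted_integral_le_sqrt:
  fixes p f :: "'a::euclidean_space \<Rightarrow> real"
  assumes p: "\<And>x. 0 \<le> p x" "integrable lborel p" "(LBINT x. p x) = 1"
    and f: "\<And>x. 0 \<le> f x" "continuous_on UNIV f" "integrable lborel (\<lambda>x. p x * (f x)\<^sup>2)"
    and C: "0 < C" "(LBINT x. p x * (f x)\<^sup>2) \<le> C\<^sup>2"
  shows "integrable lborel (\<lambda>x. p x * f x)" "(LBINT x. p x * f x) \<le> C"
proof -
  let ?g = "\<lambda>x. (1 / (2 * C)) * (p x * (f x)\<^sup>2) + (C / 2) * p x"
  have ig: "integrable lborel ?g" using p f by auto
  have [measurable]: "f \<in> borel_measurable borel" using f(2) by (rule borel_measurable_continuous_onI)
  have [measurable]: "p \<in> borel_measurable borel" using p(2) by (auto dest: borel_measurable_integrable)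
  have le: "p x * f x \<le> ?g x" for x
  proof -
    have "0 \<le> (f x - C)\<^sup>2" by simp
    then have "f x \<le> (1 / (2 * C)) * (f x)\<^sup>2 + C / 2"
      using C(1) by (simp add: field_simps power2_eq_square)
    from mult_left_mono[OF this p(1)[of x]] show ?thesis by (simp add: algebra_simps)
  qed
  show i: "integrable lborel (\<lambda>x. p x * f x)"
  proof (rule Bochner_Integration.integrable_bound[OF ig])
    show "AE x in lborel. norm (p x * f x) \<le> norm (?g x)"
    proof (rule AE_I2)
      fix x
      show "norm (p x * f x) \<le> norm (?g x)" using le[of x] p(1)[of x] f(1)[of x] by simp
    qed
  qed simp
  have "(LBINT x. p x * f x) \<le> (LBINT x. ?g x)" by (rule integral_mono[OF i ig le])
  also have "\<dots> = (1 / (2 * C)) * (LBINT x. p x * (f x)\<^sup>2) + C / 2" using p f by simp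
  also have "\<dots> \<le> (1 / (2 * C)) * C\<^sup>2 + C / 2" using C by (intro add_right_mono mult_left_mono) auto
  also have "\<dots> = C" using C(1) by (simp add: power2_eq_square)
  finally show "(LBINT x. p x * f x) \<le> C" .
qed

text \<open>X + s(X) measures the failure of the Gaussian score equation s(X) = - X. Its squared
  norm expands into the moments above, and n (n - 2) = n^2 (1 - 2 / n) gives the square root in the
  bound.\<close>

lemma t_stein_discrepancy:
  fixes p :: "real^'d^'v \<Rightarrow> real"
  assumes n: "n > 2" and m: "m = n + real CARD('v) + real CARD('d) - 1"
    and p: "has_score p (t_score n m)" and ip: "integrable lborel p" and p1: "(LBINT x. p x) = 1"
  shows "integrable lborel (\<lambda>X. p X * norm (X + t_score n m X))"
    "(LBINT X. p X * norm (X + t_score n m X))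
       \<le> sqrt 10 * (real CARD('v) * real CARD('d)) / (n * sqrt (1 - 2 / n))"
proof -
  define N where "N = real CARD('v) * real CARD('d)"
  define k where "k = real CARD('v) + real CARD('d)"
  define a where "a X = (norm (resolvent n X ** X))\<^sup>2 / n" for X :: "real^'d^'v"
  have n0: "n > 0" using n by simp
  have v1: "1 \<le> real CARD('v)" "1 \<le> real CARD('d)" by (simp_all add: Suc_le_eq)
  have k: "2 \<le> k" using v1 unfolding k_def by linarith
  \<comment> \<open>Expanding this product gives \<nu> + d \<le> \<nu> d + 1.\<close>
  have "0 \<le> (real CARD('v) - 1) * (real CARD('d) - 1)"
    using v1 by (intro mult_nonneg_nonneg) auto
  then have kN: "k \<le> N + 1" by (simp add: k_def N_def algebra_simps)
  then have N1: "1 \<le> N" using k by linarith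
  note mom = t_score_moments[OF n m p ip p1, folded N_def k_def, folded a_def]
  note sec = t_second_moment[OF n m p ip p1, folded N_def]
  have p0: "0 \<le> p X" for X using p by (rule has_score_nonneg)
  have cs: "continuous_on UNIV (t_score n m :: real^'d^'v \<Rightarrow> _)" using p by (simp add: has_score_def)
  have sq: "(norm (X + t_score n m X))\<^sup>2 = (norm X)\<^sup>2 - 2 * m * deficiency n X + m\<^sup>2 / n * a X" for X :: "real^'d^'v"
  proof -
    have "(norm (X + t_score n m X))\<^sup>2 = (norm X)\<^sup>2 + 2 * (X \<bullet> t_score n m X) + (norm (t_score n m X))\<^sup>2"
      by (simp add: power2_norm_eq_inner inner_add_left inner_add_right inner_commute)
    also have "X \<bullet> t_score n m X = - m * deficiency n X"
      using n0 by (simp add: t_score_def inner_resolvent_mult)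
    also have "(norm (t_score n m X))\<^sup>2 = m\<^sup>2 / n * a X"
      by (simp add: t_score_def a_def power_mult_distrib power_divide power2_eq_square)
    finally show ?thesis by simp
  qed
  have eq: "p X * (norm (X + t_score n m X))\<^sup>2 = p X * (norm X)\<^sup>2 - (2 * m) * (p X * deficiency n X) + (m\<^sup>2 / n) * (p X * a X)" for X
    unfolding sq by (simp add: algebra_simps)
  have i: "integrable lborel (\<lambda>X. p X * (norm (X + t_score n m X))\<^sup>2)"
    unfolding eq using mom(1,3) sec(1)
    by (intro Bochner_Integration.integrable_add Bochner_Integration.integrable_diff integrable_mult_right) auto
  have "(LBINT X. p X * (norm (X + t_score n m X))\<^sup>2) = (LBINT X. p X * (norm X)\<^sup>2)
     - 2 * m * (LBINT X. p X * deficiency n X) + m\<^sup>2 / n * (LBINT X. p X * a X)"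
    unfolding eq using mom(1,3) sec(1) by simp
  also have "\<dots> \<le> 10 * N\<^sup>2 / (n * (n - 2))"
  proof (rule t_discrepancy_arithmetic[OF n N1 k kN _ mom(4-6) _ sec(2)])
    show "m = n + k - 1" by (simp add: m k_def)
    show "(LBINT X. p X * a X) \<le> (LBINT X. p X * deficiency n X)"
    proof (rule integral_mono[OF mom(3,1)])
      fix X
      have "a X \<le> deficiency n X"
        using norm_resolvent_mult_le_deficiency[OF n0, of X] n0 by (simp add: a_def field_simps)
      then show "p X * a X \<le> p X * deficiency n X" by (intro mult_left_mono p0)
    qed
  qed
  also have "\<dots> = (sqrt 10 * N / (n * sqrt (1 - 2 / n)))\<^sup>2"
  proof -
    have "(n * sqrt (1 - 2 / n))\<^sup>2 = n * (n - 2)"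
      using n by (simp add: power_mult_distrib) (simp add: power2_eq_square field_simps)
    then show ?thesis by (simp add: power_divide power_mult_distrib)
  qed
  finally have le: "(LBINT X. p X * (norm (X + t_score n m X))\<^sup>2) \<le> (sqrt 10 * N / (n * sqrt (1 - 2 / n)))\<^sup>2" .
  have pos: "0 < sqrt 10 * N / (n * sqrt (1 - 2 / n))"
    using n N1 by (intro divide_pos_pos mult_pos_pos) auto
  have cn: "continuous_on UNIV (\<lambda>X :: real^'d^'v. norm (X + t_score n m X))" by (intro continuous_intros cs)
  show "integrable lborel (\<lambda>X. p X * norm (X + t_score n m X))"
    by (rule weighted_integral_le_sqrt(1)[OF p0 ip p1 _ cn i pos le]) simp
  show "(LBINT X. p X * norm (X + t_score n m X))
       \<le> sqrt 10 * (real CARD('v) * real CARD('d)) / (n * sqrt (1 - 2 / n))"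
    using weighted_integral_le_sqrt(2)[OF p0 ip p1 _ cn i pos le] by (simp add: N_def)
qed

section \<open>Comparison with a Gaussian density by rotation\<close>

lemma integral_lborel_distr_invariant:
  fixes f :: "'a::euclidean_space \<Rightarrow> real"
  assumes R: "distr lborel borel R = (lborel :: 'a measure)" "R \<in> borel_measurable borel"
    and [measurable]: "f \<in> borel_measurable borel"
  shows "(LBINT x. f (R x)) = (LBINT x. f x)"
    "integrable lborel (\<lambda>x. f (R x)) \<longleftrightarrow> integrable lborel f"
  using integral_distr[of R lborel borel f] integrable_distr_eq[of R lborel borel f] R by auto

definition rotation :: "real \<Rightarrow> 'a::real_vector \<times> 'a \<Rightarrow> 'a \<times> 'a" where
  "rotation \<theta> v = (cos \<theta> *\<^sub>R fst v - sin \<theta> *\<^sub>R snd v, sin \<theta> *\<^sub>R fst v + cos \<theta> *\<^sub>R snd v)"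

text \<open>Evaluated at a rotated pair, the interpolation cos x + sin z returns the original first
  component. So after the substitution the argument of g no longer depends on the angle.\<close>

lemma fst_rotation_inverse:
  "cos \<theta> *\<^sub>R fst (rotation \<theta> v) + sin \<theta> *\<^sub>R snd (rotation \<theta> v) = fst v"
  "cos \<theta> *\<^sub>R snd (rotation \<theta> v) - sin \<theta> *\<^sub>R fst (rotation \<theta> v) = snd v"
proof -
  have *: "a *\<^sub>R a *\<^sub>R x + b *\<^sub>R b *\<^sub>R x = x" if "a\<^sup>2 + b\<^sup>2 = 1" for a b :: real and x :: 'a
    using that by (simp add: scaleR_add_left[symmetric] power2_eq_square)
  show "cos \<theta> *\<^sub>R fst (rotation \<theta> v) + sin \<theta> *\<^sub>R snd (rotation \<theta> v) = fst v"
    using *[of "cos \<theta>" "sin \<theta>" "fst v"]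
    by (simp add: rotation_def scaleR_add_right scaleR_diff_right mult.commute)
  show "cos \<theta> *\<^sub>R snd (rotation \<theta> v) - sin \<theta> *\<^sub>R fst (rotation \<theta> v) = snd v"
    using *[of "cos \<theta>" "sin \<theta>" "snd v"]
    by (simp add: rotation_def scaleR_add_right scaleR_diff_right mult.commute)
qed

lemma linear_rotation: "linear (rotation \<theta>)"
  by (rule linearI) (auto simp: rotation_def algebra_simps)

lemma bij_rotation: "bij (rotation \<theta> :: 'a::real_vector \<times> 'a \<Rightarrow> _)"
proof (rule o_bij[of "rotation (- \<theta>)"])
  have "rotation (- \<theta>) (rotation \<theta> v) = v" for \<theta> and v :: "'a \<times> 'a"
    by (rule prod_eqI) (use fst_rotation_inverse[of \<theta> v] in \<open>simp_all add: rotation_def[of "- \<theta>"] add.commute\<close>)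
  from this[of \<theta>] this[of "- \<theta>"]
  show "rotation (- \<theta>) \<circ> rotation \<theta> = (id :: 'a \<times> 'a \<Rightarrow> _)"
    "rotation \<theta> \<circ> rotation (- \<theta>) = (id :: 'a \<times> 'a \<Rightarrow> _)"
    by (auto simp: fun_eq_iff)
qed

lemma norm_rotation: "norm (rotation \<theta> v) = norm (v :: 'a::real_inner \<times> 'a)"
proof -
  obtain y w where v: "v = (y, w)" by force
  have "(a *\<^sub>R y - b *\<^sub>R w) \<bullet> (a *\<^sub>R y - b *\<^sub>R w) + (b *\<^sub>R y + a *\<^sub>R w) \<bullet> (b *\<^sub>R y + a *\<^sub>R w)
      = (a\<^sup>2 + b\<^sup>2) * (y \<bullet> y + w \<bullet> w)" for a b :: real
    by (simp add: inner_add_left inner_add_right inner_diff_left inner_diff_right inner_commute[of w y]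
        power2_eq_square algebra_simps)
  from this[of "cos \<theta>" "sin \<theta>"]
  show ?thesis by (simp add: v rotation_def norm_eq_sqrt_inner)
qed

lemma lborel_distr_rotation:
  "distr lborel borel (rotation \<theta>) = (lborel :: ('a::euclidean_space \<times> 'a) measure)"
  by (intro lborel_distr_linear_isometry linear_rotation bij_rotation norm_rotation)

lemma borel_measurable_rotation:
  "(rotation \<theta> :: 'a::euclidean_space \<times> 'a \<Rightarrow> _) \<in> borel_measurable borel"
  by (intro borel_measurable_continuous_onI linear_continuous_on)
     (simp add: linear_conv_bounded_linear[symmetric] linear_rotation)

lemma integrable_lborel_product:
  fixes f :: "'a::euclidean_space \<Rightarrow> real" and h :: "'b::euclidean_space \<Rightarrow> real"
  assumes f: "integrable lborel f" and h: "integrable lborel h"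
  shows "integrable lborel (\<lambda>u. f (fst u) * h (snd u))"
    "(LBINT u. f (fst u) * h (snd u)) = (LBINT x. f x) * (LBINT y. h y)"
proof -
  have [measurable]: "f \<in> borel_measurable borel" "h \<in> borel_measurable borel"
    using f h by (auto dest: borel_measurable_integrable)
  have i: "integrable (lborel \<Otimes>\<^sub>M lborel) (\<lambda>u. f (fst u) * h (snd u))"
    by (rule lborel_pair.Fubini_integrable) (use f h in \<open>auto simp: abs_mult\<close>)
  then show "integrable lborel (\<lambda>u. f (fst u) * h (snd u))" by (simp add: lborel_prod)
  show "(LBINT u. f (fst u) * h (snd u)) = (LBINT x. f x) * (LBINT y. h y)"
    using lborel_pair.integral_fst'[OF i] by (simp add: lborel_prod)
qed

text \<open>The identity field gives the second moment, a constant field the vanishing mean. Only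
  the score and the total mass of the density enter.\<close>

lemma gaussian_score_moments:
  fixes \<phi> :: "'a::euclidean_space \<Rightarrow> real"
  assumes \<phi>: "has_score \<phi> uminus" and i: "integrable lborel \<phi>" and 1: "(LBINT x. \<phi> x) = 1"
  shows "integrable lborel (\<lambda>x. \<phi> x * (norm x)\<^sup>2)"
    and "(LBINT x. \<phi> x * (norm x)\<^sup>2) \<le> real DIM('a)"
    and "(LBINT x. \<phi> x * (x \<bullet> e)) = 0"
proof -
  have F: "((\<lambda>x::'a. x) has_derivative (\<lambda>h. h)) (at x)" for x by (rule has_derivative_ident)
  have AB: "(\<Sum>b\<in>(Basis :: 'a set). b \<bullet> b) + x \<bullet> - x = real DIM('a) - (norm x)\<^sup>2" for x :: 'a
    by (simp add: inner_same_Basis power2_norm_eq_inner cong: sum.cong)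
  show i2: "integrable lborel (\<lambda>x. \<phi> x * (norm x)\<^sup>2)"
    by (rule score_moment_bound(1)[OF \<phi> i F _ _ AB]) (auto intro!: continuous_intros)
  have "(LBINT x. \<phi> x * (norm x)\<^sup>2) \<le> real DIM('a) * (LBINT x. \<phi> x)"
    by (rule score_moment_bound(2)[OF \<phi> i F _ _ AB]) (auto intro!: continuous_intros)
  then show "(LBINT x. \<phi> x * (norm x)\<^sup>2) \<le> real DIM('a)" by (simp add: 1)
  have \<phi>0: "0 \<le> \<phi> x" for x using \<phi> by (rule has_score_nonneg)
  have c\<phi>: "continuous_on UNIV \<phi>" using \<phi> by (rule has_score_continuous)
  have ix: "integrable lborel (\<lambda>x. \<phi> x * (norm e * norm x))"
  proof (rule integrable_quadratic_growth[OF \<phi>0 c\<phi> i i2])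
    show "\<bar>norm e * norm x\<bar> \<le> norm e * (1 + (norm x)\<^sup>2)" for x :: 'a
      using mult_left_mono[OF le_one_plus_square[of "norm x"], of "norm e"] by simp
  qed (intro continuous_intros)
  have "(LBINT x. \<phi> x * ((\<Sum>b\<in>(Basis :: 'a set). 0 \<bullet> b) + e \<bullet> - x)) = 0"
    by (rule score_ibp[OF \<phi>, where F = "\<lambda>_. e" and DF = "\<lambda>_ _. 0"])
       (use i ix in \<open>auto intro!: derivative_eq_intros\<close>)
  then show "(LBINT x. \<phi> x * (x \<bullet> e)) = 0" by (simp add: inner_commute)
qed

lemma lipschitz_continuous_on_UNIV:
  fixes g :: "'a::real_normed_vector \<Rightarrow> real"
  assumes "\<And>x y. \<bar>g x - g y\<bar> \<le> norm (x - y)"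
  shows "continuous_on UNIV g"
  unfolding continuous_on_iff dist_norm real_norm_def using assms by (meson order_le_less_trans)

text \<open>The rotated density is differentiated pointwise, and Fubini exchanges angle and space;
  no differentiation under the integral sign occurs. The angle runs over an interval of length pi /
  2, which explains that factor.\<close>

lemma gaussian_comparison:
  fixes q \<phi> g :: "'a::euclidean_space \<Rightarrow> real" and s :: "'a \<Rightarrow> 'a"
  assumes q: "has_score q s" and iq: "integrable lborel q" and q1: "(LBINT x. q x) = 1"
    and q2: "integrable lborel (\<lambda>x. q x * (norm x)\<^sup>2)" and s: "\<And>x. norm (s x) \<le> C * norm x"
    and \<phi>: "has_score \<phi> uminus" and i\<phi>: "integrable lborel \<phi>" and \<phi>1: "(LBINT x. \<phi> x) = 1"
    and g: "\<And>x y. \<bar>g x - g y\<bar> \<le> norm (x - y)"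
  shows "integrable lborel (\<lambda>x. q x * g x)" "integrable lborel (\<lambda>x. \<phi> x * g x)"
    "\<bar>(LBINT x. q x * g x) - (LBINT x. \<phi> x * g x)\<bar>
       \<le> pi / 2 * (real DIM('a) * (LBINT x. q x * norm (x + s x)))"
proof -
  have q0: "0 \<le> q x" and \<phi>0: "0 \<le> \<phi> x" for x using q \<phi> by (auto intro: has_score_nonneg)
  have cq: "continuous_on UNIV q" and c\<phi>: "continuous_on UNIV \<phi>"
    using q \<phi> by (auto intro: has_score_continuous)
  have cs: "continuous_on UNIV s" using q by (simp add: has_score_def)
  have cg: "continuous_on UNIV g"
    using g by (rule lipschitz_continuous_on_UNIV)
  define H where "H x = x + s x" for x
  have cH: "continuous_on UNIV H" unfolding H_def by (intro continuous_intros cs)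
  have H: "norm (H x) \<le> norm x + C * norm x" for x
    unfolding H_def using s[of x] norm_triangle_ineq[of x "s x"] by linarith
  have meas: "f \<in> borel_measurable lborel" if "continuous_on UNIV f" for f :: "'b::euclidean_space \<Rightarrow> real"
    using that by (simp add: borel_measurable_continuous_onI)
  have n1: "norm x \<le> 1 * (1 + (norm x)\<^sup>2)" for x :: 'a
    using le_one_plus_square[of "norm x"] by simp
  have gle: "\<bar>g x\<bar> \<le> \<bar>g 0\<bar> + norm x" for x using g[of x 0] by simp
  have gle': "\<bar>g x\<bar> \<le> (\<bar>g 0\<bar> + 1) * (1 + (norm x)\<^sup>2)" for x
  proof -
    have "\<bar>g 0\<bar> * 1 \<le> \<bar>g 0\<bar> * (1 + (norm x)\<^sup>2)" by (intro mult_left_mono) auto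
    then show ?thesis using gle[of x] n1[of x] unfolding distrib_right by linarith
  qed
  note g\<phi>2 = gaussian_score_moments[OF \<phi> i\<phi> \<phi>1]
  note domq = integrable_quadratic_growth[OF q0 cq iq q2]
    and dom\<phi> = integrable_quadratic_growth[OF \<phi>0 c\<phi> i\<phi> g\<phi>2(1)]
  show iqg: "integrable lborel (\<lambda>x. q x * g x)" by (rule domq[OF cg gle'])
  show i\<phi>g: "integrable lborel (\<lambda>x. \<phi> x * g x)" by (rule dom\<phi>[OF cg gle'])
  have Hb: "norm (H x) \<le> (1 + \<bar>C\<bar>) * norm x" for x
    using H[of x] mult_right_mono[OF abs_ge_self[of C] norm_ge_zero[of x]] unfolding distrib_right by linarith
  have iqH: "integrable lborel (\<lambda>x. q x * norm (H x))"
  proof (rule domq)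
    show "\<bar>norm (H x)\<bar> \<le> (1 + \<bar>C\<bar>) * (1 + (norm x)\<^sup>2)" for x
      using Hb[of x] mult_left_mono[OF n1[of x], of "1 + \<bar>C\<bar>"] by simp
  qed (intro continuous_intros cH)
  have iqHx: "integrable lborel (\<lambda>x. q x * (norm (H x) * norm x))"
  proof (rule domq)
    fix x
    have "norm (H x) * norm x \<le> (1 + \<bar>C\<bar>) * norm x * norm x" by (intro mult_right_mono Hb) auto
    also have "\<dots> = (1 + \<bar>C\<bar>) * (norm x)\<^sup>2" by (simp add: power2_eq_square)
    also have "\<dots> \<le> (1 + \<bar>C\<bar>) * (1 + (norm x)\<^sup>2)" by (intro mult_left_mono) auto
    finally show "\<bar>norm (H x) * norm x\<bar> \<le> (1 + \<bar>C\<bar>) * (1 + (norm x)\<^sup>2)" by simp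
  qed (intro continuous_intros cH)
  have i\<phi>z: "integrable lborel (\<lambda>z. \<phi> z * norm z)"
    by (rule dom\<phi>[where c = 1]) (use n1 in \<open>auto intro!: continuous_intros\<close>)
  \<comment> \<open>\<open>K\<close> at the rotated pair is the derivative in the angle of the
    rotated product density: the first component moves with velocity minus the second, the second
    with velocity the first.\<close>
  define K where "K u = - (snd u \<bullet> H (fst u)) * (q (fst u) * \<phi> (snd u))" for u
  define J where "J \<theta> u = g (cos \<theta> *\<^sub>R fst u + sin \<theta> *\<^sub>R snd u) * K u" for \<theta> u
  \<comment> \<open>A dominating function independent of the angle, from |g y| \<le> |g 0| + |y|.
    Each summand is a product of a function of x and a function of z.\<close>
  define D where "D u = (q (fst u) * norm (H (fst u))) * (\<bar>g 0\<bar> * (\<phi> (snd u) * norm (snd u)))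
     + (q (fst u) * (norm (H (fst u)) * norm (fst u))) * (\<phi> (snd u) * norm (snd u))
     + (q (fst u) * norm (H (fst u))) * (\<phi> (snd u) * (norm (snd u))\<^sup>2)" for u
  have iD: "integrable lborel D" unfolding D_def
    by (intro Bochner_Integration.integrable_add integrable_lborel_product integrable_mult_right iqH iqHx i\<phi>z g\<phi>2)
  have cK: "continuous_on UNIV K" unfolding K_def
    by (intro continuous_intros continuous_on_compose2[OF cH] continuous_on_compose2[OF cq]
        continuous_on_compose2[OF c\<phi>]) auto
  have cJ: "continuous_on UNIV (J \<theta>)" for \<theta> unfolding J_def
    by (intro continuous_intros continuous_on_compose2[OF cg] cK) auto
  have JD: "\<bar>J \<theta> u\<bar> \<le> D u" for \<theta> u
  proof -
    obtain x z where u: "u = (x, z)" by force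
    have "norm (cos \<theta> *\<^sub>R x + sin \<theta> *\<^sub>R z) \<le> \<bar>cos \<theta>\<bar> * norm x + \<bar>sin \<theta>\<bar> * norm z"
      by (intro order_trans[OF norm_triangle_ineq]) simp
    also have "\<dots> \<le> 1 * norm x + 1 * norm z"
      by (intro add_mono mult_right_mono abs_cos_le_one abs_sin_le_one) auto
    finally have "\<bar>g (cos \<theta> *\<^sub>R x + sin \<theta> *\<^sub>R z)\<bar> \<le> \<bar>g 0\<bar> + norm x + norm z"
      using gle[of "cos \<theta> *\<^sub>R x + sin \<theta> *\<^sub>R z"] by linarith
    moreover have "\<bar>K u\<bar> \<le> (norm z * norm (H x)) * (q x * \<phi> z)"
      unfolding K_def u using q0 \<phi>0 by (auto simp: abs_mult intro!: mult_right_mono Cauchy_Schwarz_ineq2)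
    ultimately have "\<bar>J \<theta> u\<bar> \<le> (\<bar>g 0\<bar> + norm x + norm z) * ((norm z * norm (H x)) * (q x * \<phi> z))"
      unfolding J_def u abs_mult by (intro mult_mono) auto
    also have "\<dots> = D u" by (simp add: D_def u power2_eq_square algebra_simps)
    finally show ?thesis .
  qed
  have iJ: "integrable lborel (J \<theta>)" for \<theta>
    using JD by (intro Bochner_Integration.integrable_bound[OF iD meas[OF cJ]] AE_I2)
      (metis abs_ge_self order_trans real_norm_def)
  have Rint: "(LBINT v. f (rotation \<theta> v)) = (LBINT u. f u)"
      "integrable lborel (\<lambda>v. f (rotation \<theta> v)) \<longleftrightarrow> integrable lborel f"
    if "f \<in> borel_measurable borel" for \<theta> and f :: "'a \<times> 'a \<Rightarrow> real"
    by (rule integral_lborel_distr_invariant[OF lborel_distr_rotation borel_measurable_rotation that])+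
  let ?I = "indicator {0..pi / 2} :: real \<Rightarrow> real"
  \<comment> \<open>\<open>f\<close> is written in coordinates where \<open>g\<close> stands still
    and the density turns; \<open>J\<close> is the same integrand in the rotated
    coordinates.\<close>
  define f where "f = (\<lambda>(\<theta>, v). ?I \<theta> * (g (fst v) * K (rotation \<theta> v)))"
  have fJ: "g (fst v) * K (rotation \<theta> v) = J \<theta> (rotation \<theta> v)" for \<theta> v
    by (simp add: J_def fst_rotation_inverse)
  have cont3: "continuous_on UNIV (\<lambda>x :: real \<times> ('a \<times> 'a). g (fst (snd x)) * K (rotation (fst x) (snd x)))"
    unfolding rotation_def
    by (intro continuous_intros continuous_on_compose2[OF cg] continuous_on_compose2[OF cK]) auto
  have fm: "f \<in> borel_measurable (lborel \<Otimes>\<^sub>M lborel)"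
  proof -
    have [measurable]: "(\<lambda>x :: real \<times> ('a \<times> 'a). g (fst (snd x)) * K (rotation (fst x) (snd x))) \<in> borel_measurable (borel \<Otimes>\<^sub>M borel)"
      using borel_measurable_continuous_onI[OF cont3] by (simp add: borel_prod)
    have "(\<lambda>x :: real \<times> ('a \<times> 'a). ?I (fst x) * (g (fst (snd x)) * K (rotation (fst x) (snd x)))) \<in> borel_measurable (lborel \<Otimes>\<^sub>M lborel)"
      by measurable
    then show ?thesis by (simp add: f_def case_prod_beta')
  qed
  have mJ: "J \<theta> \<in> borel_measurable borel" for \<theta> using meas[OF cJ] by simp
  have mJa: "(\<lambda>u. \<bar>J \<theta> u\<bar>) \<in> borel_measurable borel" for \<theta> using mJ by simp
  have intf: "integrable (lborel \<Otimes>\<^sub>M lborel) f"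
  proof (rule lborel_pair.Fubini_integrable[OF fm])
    show "integrable lborel (\<lambda>\<theta>. LBINT v. norm (f (\<theta>, v)))"
    proof (rule Bochner_Integration.integrable_bound)
      show "integrable lborel (\<lambda>\<theta>. ?I \<theta> * (LBINT u. D u))" by auto
      show "(\<lambda>\<theta>. LBINT v. norm (f (\<theta>, v))) \<in> borel_measurable lborel"
        using fm by measurable
      show "AE \<theta> in lborel. norm (LBINT v. norm (f (\<theta>, v))) \<le> norm (?I \<theta> * (LBINT u. D u))"
      proof (rule AE_I2)
        fix \<theta>
        have "(LBINT v. norm (f (\<theta>, v))) = ?I \<theta> * (LBINT v. \<bar>J \<theta> (rotation \<theta> v)\<bar>)"
          by (simp add: f_def fJ abs_mult)
        also have "(LBINT v. \<bar>J \<theta> (rotation \<theta> v)\<bar>) = (LBINT u. \<bar>J \<theta> u\<bar>)"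
          by (rule Rint(1)[OF mJa])
        finally have eq: "(LBINT v. norm (f (\<theta>, v))) = ?I \<theta> * (LBINT u. \<bar>J \<theta> u\<bar>)" .
        have "(LBINT u. \<bar>J \<theta> u\<bar>) \<le> (LBINT u. D u)"
          using iJ iD JD by (intro integral_mono) auto
        moreover have "0 \<le> (LBINT u. \<bar>J \<theta> u\<bar>)" by simp
        ultimately show "norm (LBINT v. norm (f (\<theta>, v))) \<le> norm (?I \<theta> * (LBINT u. D u))"
          unfolding eq by (simp add: abs_mult mult_left_mono)
      qed
    qed
    show "AE \<theta> in lborel. integrable lborel (\<lambda>v. f (\<theta>, v))"
      by (rule AE_I2) (simp add: f_def fJ Rint(2)[OF mJ] iJ)
  qed
  have ftc: "(LBINT \<theta>. f (\<theta>, v))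
      = g (fst v) * (q (fst (rotation (pi / 2) v)) * \<phi> (snd (rotation (pi / 2) v))
          - q (fst (rotation 0 v)) * \<phi> (snd (rotation 0 v)))" for v
  proof -
    let ?\<Phi> = "\<lambda>\<theta>. q (fst (rotation \<theta> v)) * \<phi> (snd (rotation \<theta> v))"
    have der: "(?\<Phi> has_real_derivative K (rotation \<theta> v)) (at \<theta>)" for \<theta>
    proof -
      let ?x = "fst (rotation \<theta> v)" and ?z = "snd (rotation \<theta> v)"
      have dx: "((\<lambda>\<theta>. fst (rotation \<theta> v)) has_derivative (\<lambda>t. t *\<^sub>R (- ?z))) (at \<theta>)"
        unfolding rotation_def fst_conv snd_conv
        by (auto intro!: derivative_eq_intros simp: algebra_simps)
      have dz: "((\<lambda>\<theta>. snd (rotation \<theta> v)) has_derivative (\<lambda>t. t *\<^sub>R ?x)) (at \<theta>)"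
        unfolding rotation_def fst_conv snd_conv
        by (auto intro!: derivative_eq_intros simp: algebra_simps)
      have dq: "((\<lambda>\<theta>. q (fst (rotation \<theta> v))) has_derivative (\<lambda>t. q ?x * (s ?x \<bullet> (t *\<^sub>R (- ?z))))) (at \<theta>)"
        by (rule has_derivative_compose[OF dx]) (use q in \<open>auto simp: has_score_def\<close>)
      have d\<phi>: "((\<lambda>\<theta>. \<phi> (snd (rotation \<theta> v))) has_derivative (\<lambda>t. \<phi> ?z * (- ?z \<bullet> (t *\<^sub>R ?x)))) (at \<theta>)"
        by (rule has_derivative_compose[OF dz]) (use \<phi> in \<open>auto simp: has_score_def\<close>)
      have "(?\<Phi> has_derivative (\<lambda>t. t * K (rotation \<theta> v))) (at \<theta>)"
        by (rule has_derivative_eq_rhs[OF has_derivative_mult[OF dq d\<phi>]])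
           (simp add: K_def H_def fun_eq_iff inner_add_right inner_commute algebra_simps)
      then show ?thesis by (simp add: has_field_derivative_def mult_commute_abs)
    qed
    have "(LBINT \<theta>. ?I \<theta> *\<^sub>R (g (fst v) * K (rotation \<theta> v))) = g (fst v) * ?\<Phi> (pi / 2) - g (fst v) * ?\<Phi> 0"
    proof (rule integral_FTC_atLeastAtMost)
      show "continuous_on {0..pi / 2} (\<lambda>\<theta>. g (fst v) * K (rotation \<theta> v))"
        by (rule continuous_on_compose2[OF cont3, of _ "\<lambda>\<theta>. (\<theta>, v)", simplified]) (auto intro!: continuous_intros)
      fix \<theta> :: real
      have "((\<lambda>\<theta>. g (fst v) * ?\<Phi> \<theta>) has_real_derivative g (fst v) * K (rotation \<theta> v)) (at \<theta>)"
        by (rule DERIV_cmult[OF der])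
      then show "((\<lambda>\<theta>. g (fst v) * ?\<Phi> \<theta>) has_vector_derivative g (fst v) * K (rotation \<theta> v)) (at \<theta> within {0..pi / 2})"
        using has_real_derivative_iff_has_vector_derivative has_vector_derivative_at_within by blast
    qed simp
    then show ?thesis by (simp add: f_def algebra_simps)
  qed
  have "(LBINT \<theta>. (LBINT v. f (\<theta>, v))) = (LBINT v. (LBINT \<theta>. f (\<theta>, v)))"
    using lborel_pair.Fubini_integral[of "\<lambda>\<theta> v. f (\<theta>, v)"] intf by simp
  \<comment> \<open>At angle pi / 2 the rotation sends (x, z) to (- z, x), so the Gaussian density
    sits on the argument of \<open>g\<close> and the other factor integrates to 1.\<close>
  also have "\<dots> = (LBINT v. q (- snd v) * (\<phi> (fst v) * g (fst v)) - (q (fst v) * g (fst v)) * \<phi> (snd v))"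
    unfolding ftc by (intro Bochner_Integration.integral_cong refl) (simp add: rotation_def algebra_simps)
  also have "\<dots> = (LBINT x. \<phi> x * g x) - (LBINT x. q x * g x)"
  proof -
    have "distr lborel borel uminus = (lborel :: 'a measure)"
      by (rule lborel_distr_linear_isometry) (auto intro!: linearI o_bij[of uminus])
    from integral_lborel_distr_invariant[OF this _ ]
    have qm: "(LBINT x. q (- x)) = 1" "integrable lborel (\<lambda>x. q (- x))"
      using meas[OF cq] q1 iq by auto
    have A: "integrable lborel (\<lambda>v. (\<phi> (fst v) * g (fst v)) * q (- snd v))"
        "(LBINT v. (\<phi> (fst v) * g (fst v)) * q (- snd v)) = (LBINT x. \<phi> x * g x)"
      using integrable_lborel_product[OF i\<phi>g qm(2)] qm(1) by simp_all
    have B: "integrable lborel (\<lambda>v. (q (fst v) * g (fst v)) * \<phi> (snd v))"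
        "(LBINT v. (q (fst v) * g (fst v)) * \<phi> (snd v)) = (LBINT x. q x * g x)"
      using integrable_lborel_product[OF iqg i\<phi>] \<phi>1 by simp_all
    show ?thesis
      using A B by (subst mult.commute) simp
  qed
  finally have main: "(LBINT x. \<phi> x * g x) - (LBINT x. q x * g x)
      = (LBINT \<theta>. (LBINT v. f (\<theta>, v)))" by simp
  let ?B = "real DIM('a) * (LBINT x. q x * norm (H x))"
  have JB: "\<bar>LBINT u. J \<theta> u\<bar> \<le> ?B" for \<theta>
  proof -
    have iJ': "integrable (lborel \<Otimes>\<^sub>M lborel) (J \<theta>)" using iJ by (simp add: lborel_prod)
    have inner: "\<bar>LBINT z. J \<theta> (x, z)\<bar> \<le> q x * norm (H x) * real DIM('a)" for x
    proof -
      \<comment> \<open>Since the Gaussian mean is zero, \<open>g (cos \<theta> x)\<close>, which is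
        constant in z, may be subtracted. Only the increment of \<open>g\<close> remains, of size at
        most |z|; with the factor z of \<open>K\<close> this produces the Gaussian second
        moment.\<close>
      let ?d = "\<lambda>z. g (cos \<theta> *\<^sub>R x + sin \<theta> *\<^sub>R z) - g (cos \<theta> *\<^sub>R x)"
      let ?h = "\<lambda>z. \<phi> z * (z \<bullet> H x)"
      have ih: "integrable lborel ?h"
      proof (rule dom\<phi>)
        show "\<bar>z \<bullet> H x\<bar> \<le> norm (H x) * (1 + (norm z)\<^sup>2)" for z
          using Cauchy_Schwarz_ineq2[of z "H x"] mult_left_mono[OF n1[of z], of "norm (H x)"]
          by (simp add: mult.commute)
      qed (intro continuous_intros)
      let ?k = "\<lambda>z. \<phi> z * (?d z * (z \<bullet> H x))"
      have kb: "\<bar>?d z * (z \<bullet> H x)\<bar> \<le> norm (H x) * (norm z)\<^sup>2" for z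
      proof -
        have "\<bar>?d z\<bar> \<le> \<bar>sin \<theta>\<bar> * norm z"
          using g[of "cos \<theta> *\<^sub>R x + sin \<theta> *\<^sub>R z" "cos \<theta> *\<^sub>R x"] by simp
        also have "\<dots> \<le> 1 * norm z" by (intro mult_right_mono abs_sin_le_one) auto
        finally have "\<bar>?d z * (z \<bullet> H x)\<bar> \<le> norm z * (norm z * norm (H x))"
          unfolding abs_mult by (intro mult_mono Cauchy_Schwarz_ineq2) auto
        then show ?thesis by (simp add: power2_eq_square mult_ac)
      qed
      have ik: "integrable lborel ?k"
      proof (rule dom\<phi>)
        show "\<bar>?d z * (z \<bullet> H x)\<bar> \<le> norm (H x) * (1 + (norm z)\<^sup>2)" for z
          using kb[of z] by (simp add: algebra_simps) (smt (verit) norm_ge_zero)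
      qed (intro continuous_intros continuous_on_compose2[OF cg], auto)
      have "J \<theta> (x, z) = - q x * (?k z + g (cos \<theta> *\<^sub>R x) * ?h z)" for z
        by (simp add: J_def K_def algebra_simps)
      then have "(LBINT z. J \<theta> (x, z)) = - q x * (LBINT z. ?k z + g (cos \<theta> *\<^sub>R x) * ?h z)"
        by simp
      also have "(LBINT z. ?k z + g (cos \<theta> *\<^sub>R x) * ?h z) = (LBINT z. ?k z)"
        using ik ih g\<phi>2(3)[of "H x"] by simp
      finally have eq: "\<bar>LBINT z. J \<theta> (x, z)\<bar> = q x * \<bar>LBINT z. ?k z\<bar>"
        using q0 by (simp add: abs_mult)
      have "\<bar>LBINT z. ?k z\<bar> \<le> (LBINT z. \<bar>?k z\<bar>)" by (rule integral_abs_bound)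
      also have "\<dots> \<le> (LBINT z. norm (H x) * (\<phi> z * (norm z)\<^sup>2))"
      proof (rule integral_mono)
        fix z
        show "\<bar>?k z\<bar> \<le> norm (H x) * (\<phi> z * (norm z)\<^sup>2)"
          using mult_left_mono[OF kb[of z] \<phi>0[of z]] \<phi>0[of z] by (simp add: abs_mult mult_ac)
      qed (use ik g\<phi>2(1) in auto)
      also have "\<dots> = norm (H x) * (LBINT z. \<phi> z * (norm z)\<^sup>2)" by simp
      also have "\<dots> \<le> norm (H x) * real DIM('a)" by (intro mult_left_mono g\<phi>2(2)) auto
      finally have "q x * \<bar>LBINT z. ?k z\<bar> \<le> q x * (norm (H x) * real DIM('a))"
        by (intro mult_left_mono q0)
      then show ?thesis unfolding eq by (simp add: mult.assoc)
    qed
    have "(LBINT u. J \<theta> u) = (LBINT x. (LBINT z. J \<theta> (x, z)))"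
      using lborel_pair.integral_fst'[OF iJ'] by (simp add: lborel_prod)
    also have "\<bar>\<dots>\<bar> \<le> (LBINT x. \<bar>LBINT z. J \<theta> (x, z)\<bar>)" by (rule integral_abs_bound)
    also have "\<dots> \<le> (LBINT x. q x * norm (H x) * real DIM('a))"
      using lborel_pair.integrable_fst'[OF iJ'] iqH by (intro integral_mono inner) auto
    also have "\<dots> = ?B" by simp
    finally show ?thesis .
  qed
  have "\<bar>LBINT \<theta>. (LBINT v. f (\<theta>, v))\<bar> \<le> (LBINT \<theta>. \<bar>LBINT v. f (\<theta>, v)\<bar>)"
    by (rule integral_abs_bound)
  also have "\<dots> \<le> (LBINT \<theta>. ?I \<theta> * ?B)"
  proof (rule integral_mono)
    show "integrable lborel (\<lambda>\<theta>. \<bar>LBINT v. f (\<theta>, v)\<bar>)"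
      using lborel_pair.integrable_fst'[OF intf] by auto
    show "integrable lborel (\<lambda>\<theta>. ?I \<theta> * ?B)" by auto
    fix \<theta>
    have "(LBINT v. f (\<theta>, v)) = ?I \<theta> * (LBINT u. J \<theta> u)"
      by (simp add: f_def fJ Rint(1)[OF mJ])
    then show "\<bar>LBINT v. f (\<theta>, v)\<bar> \<le> ?I \<theta> * ?B"
      using JB[of \<theta>] by (simp add: abs_mult mult_left_mono)
  qed
  also have "\<dots> = pi / 2 * ?B" by simp
  finally have "\<bar>(LBINT x. \<phi> x * g x) - (LBINT x. q x * g x)\<bar> \<le> pi / 2 * ?B"
    unfolding main .
  then show "\<bar>(LBINT x. q x * g x) - (LBINT x. \<phi> x * g x)\<bar>
       \<le> pi / 2 * (real DIM('a) * (LBINT x. q x * norm (x + s x)))"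
    unfolding H_def by (subst abs_minus_commute)
qed

lemma real_card_ge_1: "1 \<le> real CARD('n::finite)"
  by (simp add: Suc_le_eq)

text \<open>The comparison applied to g / L, with the discrepancy bound inserted.\<close>

lemma t_gaussian_upper_bound:
  fixes q \<phi> g :: "real^'d^'v \<Rightarrow> real"
  assumes n: "n > 2" and m: "m = n + real CARD('v) + real CARD('d) - 1"
    and q: "has_score q (t_score n m)" "integrable lborel q" "(LBINT x. q x) = 1"
    and \<phi>: "has_score \<phi> uminus" "integrable lborel \<phi>" "(LBINT x. \<phi> x) = 1"
    and L: "L > 0" and g: "\<And>x y. \<bar>g x - g y\<bar> \<le> L * norm (x - y)"
  shows "integrable lborel (\<lambda>x. q x * g x)" "integrable lborel (\<lambda>x. \<phi> x * g x)"
    "\<bar>(LBINT x. q x * g x) - (LBINT x. \<phi> x * g x)\<bar>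
       \<le> 10 / sqrt (1 - 2 / n) * ((real CARD('v) * real CARD('d))\<^sup>2 / n) * L"
proof -
  have n0: "n > 0" using n by simp
  have m0: "m > 0" using n real_card_ge_1[where 'n='v] real_card_ge_1[where 'n='d] unfolding m by linarith
  let ?N = "real CARD('v) * real CARD('d)"
  let ?h = "\<lambda>x. g x / L"
  have h: "\<bar>?h x - ?h y\<bar> \<le> norm (x - y)" for x y
    using g[of x y] L by (simp add: diff_divide_distrib[symmetric] pos_divide_le_eq mult.commute)
  note cmp = gaussian_comparison[OF q t_second_moment(1)[OF n m q] norm_t_score_le[OF n0 m0] \<phi> h]
  have eq: "L * (p * ?h x) = p * g x" for p x using L by simp
  show "integrable lborel (\<lambda>x. q x * g x)" "integrable lborel (\<lambda>x. \<phi> x * g x)"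
    using integrable_mult_right[OF cmp(1), of L] integrable_mult_right[OF cmp(2), of L] unfolding eq by auto
  have "\<bar>(LBINT x. q x * ?h x) - (LBINT x. \<phi> x * ?h x)\<bar>
      \<le> pi / 2 * (?N * (LBINT x. q x * norm (x + t_score n m x)))"
    using cmp(3) by simp
  \<comment> \<open>Rounding pi / 2 up to 2 and the square root of 10 up to 4 gives 8, below the
    constant 10 of the theorem.\<close>
  also have "\<dots> \<le> 2 * (?N * (4 * ?N / (n * sqrt (1 - 2 / n))))"
  proof (intro mult_mono)
    show "pi / 2 \<le> 2" using pi_less_4 by simp
    have "sqrt 10 \<le> 4" by (rule real_le_lsqrt) auto
    then have "sqrt 10 * ?N / (n * sqrt (1 - 2 / n)) \<le> 4 * ?N / (n * sqrt (1 - 2 / n))"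
      using n by (intro divide_right_mono mult_right_mono) auto
    then show "(LBINT x. q x * norm (x + t_score n m x)) \<le> 4 * ?N / (n * sqrt (1 - 2 / n))"
      using t_stein_discrepancy(2)[OF n m q] by linarith
    show "0 \<le> ?N * (LBINT x. q x * norm (x + t_score n m x))"
      using has_score_nonneg[OF q(1)] by (intro mult_nonneg_nonneg integral_nonneg_AE) auto
    show "0 \<le> (LBINT x. q x * norm (x + t_score n m x))"
      using has_score_nonneg[OF q(1)] by (intro integral_nonneg_AE) auto
  qed auto
  also have "\<dots> = 8 / sqrt (1 - 2 / n) * (?N\<^sup>2 / n)"
    by (simp add: power2_eq_square mult_ac)
  also have "\<dots> \<le> 10 / sqrt (1 - 2 / n) * (?N\<^sup>2 / n)"
    using n by (intro mult_right_mono divide_right_mono) auto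
  finally have *: "\<bar>(LBINT x. q x * ?h x) - (LBINT x. \<phi> x * ?h x)\<bar> * L
      \<le> 10 / sqrt (1 - 2 / n) * (?N\<^sup>2 / n) * L"
    using L by (intro mult_right_mono) auto
  have "(LBINT x. q x * ?h x) = (LBINT x. q x * g x) / L"
    "(LBINT x. \<phi> x * ?h x) = (LBINT x. \<phi> x * g x) / L"
    by simp_all
  with * L show "\<bar>(LBINT x. q x * g x) - (LBINT x. \<phi> x * g x)\<bar>
      \<le> 10 / sqrt (1 - 2 / n) * (?N\<^sup>2 / n) * L"
    by (simp add: diff_divide_distrib[symmetric])
qed

lemma continuously_differentiable_lipschitz:
  fixes f f' :: "real \<Rightarrow> real"
  assumes "\<And>t. (f has_real_derivative f' t) (at t)" "continuous_on {a..b} f'"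
  obtains L where "L > 0" "\<And>s t. s \<in> {a..b} \<Longrightarrow> t \<in> {a..b} \<Longrightarrow> \<bar>f s - f t\<bar> \<le> L * \<bar>s - t\<bar>"
proof -
  have "bounded (f' ` {a..b})"
    by (intro compact_imp_bounded compact_continuous_image assms(2) compact_Icc)
  then obtain L where L: "L > 0" "\<forall>y\<in>f' ` {a..b}. norm y \<le> L"
    unfolding bounded_pos by blast
  show thesis
  proof (rule that[OF L(1)])
    fix s t assume "s \<in> {a..b}" "t \<in> {a..b}"
    then have "norm (f s - f t) \<le> L * norm (s - t)"
      using L(2)
      by (intro field_differentiable_bound[OF convex_real_interval(5)[of a b]
            has_field_derivative_at_within[OF assms(1)]]) auto
    then show "\<bar>f s - f t\<bar> \<le> L * \<bar>s - t\<bar>" by simp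
  qed
qed

text \<open>The truncated norm is 1-Lipschitz with values in the compact interval [0, c], where
  \<open>f\<close> has a bounded derivative. This covers radial functions that vanish outside a
  ball.\<close>

lemma truncated_norm_lipschitz:
  fixes f f' :: "real \<Rightarrow> real"
  assumes "\<And>t. (f has_real_derivative f' t) (at t)" "continuous_on {0..c} f'" "c \<ge> 0"
  obtains L where "L > 0"
    "\<And>x y :: 'a::real_normed_vector. \<bar>f (min (norm x) c) - f (min (norm y) c)\<bar> \<le> L * norm (x - y)"
proof -
  obtain L where L: "L > 0" "\<And>s t. s \<in> {0..c} \<Longrightarrow> t \<in> {0..c} \<Longrightarrow> \<bar>f s - f t\<bar> \<le> L * \<bar>s - t\<bar>"
    using continuously_differentiable_lipschitz[OF assms(1,2)] by blast
  show thesis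
  proof (rule that[OF L(1)])
    fix x y :: 'a
    have "\<bar>f (min (norm x) c) - f (min (norm y) c)\<bar> \<le> L * \<bar>min (norm x) c - min (norm y) c\<bar>"
      using assms(3) by (intro L(2)) auto
    also have "\<bar>min (norm x) c - min (norm y) c\<bar> \<le> norm (x - y)"
      using norm_triangle_ineq3[of x y] by (auto simp: min_def)
    finally show "\<bar>f (min (norm x) c) - f (min (norm y) c)\<bar> \<le> L * norm (x - y)"
      using L(1) by simp
  qed
qed

section \<open>A test function attaining the rate\<close>

text \<open>The left-hand side comes from m - n = \<nu> + d - 1 \<ge> 1: since
  \<open>X . G X\<close> is at least |X|^2 - |X|^4 / n, the gain (m - n) |X|^2 / n competes with a
  loss of at most (m / n) |X|^4 / n. For |X|^2 \<le> 1 / 4 and m \<le> 2 n the loss is at most half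
  of |X|^2 / n.\<close>

lemma t_score_inward_gap:
  fixes X :: "real^'d^'v"
  assumes m: "m = n + real CARD('v) + real CARD('d) - 1"
    and n: "n > 0" "real CARD('v) + real CARD('d) - 1 \<le> n" and X: "X \<bullet> X \<le> 1 / 4"
  shows "(X \<bullet> X) / (2 * n) \<le> - (X \<bullet> (X + t_score n m X))"
proof -
  let ?r = "X \<bullet> X" and ?G = "resolvent n X"
  have k: "1 \<le> m - n" "m \<le> 2 * n" "0 < m"
    using n real_card_ge_1[where 'n='v] real_card_ge_1[where 'n='d] unfolding m by linarith+
  have "?G ** (X ** transpose X) ** X = n *\<^sub>R (X - ?G ** X)"
    unfolding resolvent_outer[OF n(1)] by (simp add: matrix_mult_scaleR matrix_mult_diff)
  then have "n *\<^sub>R (X - ?G ** X) = ?G ** (X ** (transpose X ** X))"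
    by (simp add: matrix_mul_assoc)
  then have "n * (?r - X \<bullet> (?G ** X)) = X \<bullet> (?G ** (X ** (transpose X ** X)))"
    by (metis inner_diff_right inner_scaleR_right)
  also have "\<dots> \<le> norm X * norm (?G ** (X ** (transpose X ** X)))" by (rule norm_cauchy_schwarz)
  also have "\<dots> \<le> norm X * (norm X * (norm X * norm X))"
    by (intro mult_left_mono order_trans[OF norm_resolvent_mult[OF n(1)]]
        order_trans[OF norm_matrix_mult_frobenius] mult_left_mono)
       (use norm_matrix_mult_frobenius[of "transpose X" X] in \<open>auto simp: norm_transpose\<close>)
  also have "\<dots> = ?r * ?r" by (simp add: dot_square_norm power2_eq_square)
  also have "\<dots> \<le> ?r * (1 / 4)" by (intro mult_left_mono X) auto
  finally have 1: "n * (X \<bullet> (?G ** X)) \<ge> n * ?r - ?r / 4" by (simp add: algebra_simps)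
  have "- (X \<bullet> (X + t_score n m X)) = m / n * (X \<bullet> (?G ** X)) - ?r"
    by (simp add: t_score_def inner_add_right inner_diff_right)
  also have "\<dots> = (m / n\<^sup>2) * (n * (X \<bullet> (?G ** X))) - ?r" using n by (simp add: power2_eq_square)
  also have "\<dots> \<ge> (m / n\<^sup>2) * (n * ?r - ?r / 4) - ?r"
    using 1 k n by (intro diff_right_mono mult_left_mono) auto
  also have "(m / n\<^sup>2) * (n * ?r - ?r / 4) - ?r = ?r / n * (m - n - (m / n) / 4)"
    using n by (simp add: field_simps power2_eq_square)
  finally have 2: "?r / n * (m - n - (m / n) / 4) \<le> - (X \<bullet> (X + t_score n m X))" .
  have "m / n \<le> 2" using k n by (simp add: divide_le_eq)
  then have "(m / n) / 4 \<le> 2 / 4" by (rule divide_right_mono) simp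
  then have "1 / 2 \<le> m - n - (m / n) / 4" using k(1) by linarith
  then have "?r / n * (1 / 2) \<le> ?r / n * (m - n - (m / n) / 4)"
    using n by (intro mult_left_mono) auto
  with 2 show ?thesis by simp
qed

text \<open>The function \<open>g\<close> is the Gaussian Stein operator applied to a fixed field,
  so its Gaussian mean vanishes; it does not depend on \<open>n\<close>. The auxiliary
  \<open>h\<close> is the inner product of that field with x. As \<open>h\<close> is Lipschitz, the
  upper bound already proved keeps its T mean above half of its Gaussian mean
  \<open>I\<close>.\<close>

lemma t_gaussian_lower_bound:
  fixes \<phi> :: "real^'d^'v \<Rightarrow> real"
  assumes \<phi>: "has_score \<phi> uminus" "integrable lborel \<phi>" "(LBINT x. \<phi> x) = 1" and pos: "\<And>x. 0 < \<phi> x"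
  obtains g :: "real^'d^'v \<Rightarrow> real" and L \<delta> n0 where "L > 0" "\<delta> > 0" "n0 > 2"
    "\<And>x y. \<bar>g x - g y\<bar> \<le> L * norm (x - y)"
    "\<And>n m q. n0 \<le> n \<Longrightarrow> m = n + real CARD('v) + real CARD('d) - 1 \<Longrightarrow> has_score q (t_score n m)
       \<Longrightarrow> integrable lborel q \<Longrightarrow> (LBINT x. q x) = 1
       \<Longrightarrow> \<delta> / n \<le> (LBINT x. q x * g x) - (LBINT x. \<phi> x * g x)"
proof -
  define N where "N = real CARD('v) * real CARD('d)"
  define g where "g x = cutoff (1/4) x * (N - x \<bullet> x) - 4 * max 0 (1/4 - x \<bullet> x) * (x \<bullet> x)" for x :: "real^'d^'v"
  define h where "h x = cutoff (1/4) x * (x \<bullet> x)" for x :: "real^'d^'v"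
  \<comment> \<open>The radius 1 / 2 is where the cutoff with parameter 1 / 4 vanishes. Beyond it
    both sides are 0, so \<open>h\<close> and \<open>g\<close> become polynomials in the truncated
    norm.\<close>
  have trunc: "max 0 (1/4 - x \<bullet> x) = 1/4 - (min (norm x) (1/2))\<^sup>2"
      "max 0 (1/4 - x \<bullet> x) * (x \<bullet> x) = (1/4 - (min (norm x) (1/2))\<^sup>2) * (min (norm x) (1/2))\<^sup>2" for x :: "real^'d^'v"
  proof -
    have eq: "x \<bullet> x = (norm x)\<^sup>2" by (simp add: power2_norm_eq_inner)
    have "max 0 (1/4 - x \<bullet> x) = 1/4 - (min (norm x) (1/2))\<^sup>2
      \<and> max 0 (1/4 - x \<bullet> x) * (x \<bullet> x) = (1/4 - (min (norm x) (1/2))\<^sup>2) * (min (norm x) (1/2))\<^sup>2"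
    proof (cases "norm x \<le> 1/2")
      case True
      then have "(norm x)\<^sup>2 \<le> (1/2)\<^sup>2" by (intro power_mono) auto
      then have "x \<bullet> x \<le> 1/4" unfolding eq by (simp add: power2_eq_square)
      then show ?thesis using True by (simp add: eq max_def min_def)
    next
      case False
      then have "(1/2)\<^sup>2 \<le> (norm x)\<^sup>2" by (intro power_mono) auto
      then have "1/4 \<le> x \<bullet> x" unfolding eq by (simp add: power2_eq_square)
      then show ?thesis using False by (simp add: max_def min_def power2_eq_square)
    qed
    then show "max 0 (1/4 - x \<bullet> x) = 1/4 - (min (norm x) (1/2))\<^sup>2"
      "max 0 (1/4 - x \<bullet> x) * (x \<bullet> x) = (1/4 - (min (norm x) (1/2))\<^sup>2) * (min (norm x) (1/2))\<^sup>2"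
      by auto
  qed
  have h_trunc: "h x = (\<lambda>t. (1/4 - t\<^sup>2)\<^sup>2 * t\<^sup>2) (min (norm x) (1/2))" for x
  proof -
    have "h x = max 0 (1/4 - x \<bullet> x) * (max 0 (1/4 - x \<bullet> x) * (x \<bullet> x))"
      by (simp add: h_def cutoff_def power2_eq_square mult.assoc)
    then show ?thesis unfolding trunc(2) unfolding trunc(1) by (simp add: power2_eq_square mult_ac)
  qed
  have g_trunc: "g x = (\<lambda>t. (1/4 - t\<^sup>2)\<^sup>2 * N - (1/4 - t\<^sup>2)\<^sup>2 * t\<^sup>2 - 4 * ((1/4 - t\<^sup>2) * t\<^sup>2)) (min (norm x) (1/2))" for x
  proof -
    have "g x = cutoff (1/4) x * N - h x - 4 * (max 0 (1/4 - x \<bullet> x) * (x \<bullet> x))"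
      by (simp add: g_def h_def algebra_simps)
    then show ?thesis unfolding h_trunc trunc(2) unfolding trunc(1) cutoff_def by simp
  qed
  obtain Lh where Lh: "Lh > 0" "\<And>x y. \<bar>h x - h y\<bar> \<le> Lh * norm (x - y)"
  proof -
    have d: "((\<lambda>t. (1/4 - t\<^sup>2)\<^sup>2 * t\<^sup>2) has_real_derivative
        (2 * (1/4 - t\<^sup>2) * (- (2 * t)) * t\<^sup>2 + (1/4 - t\<^sup>2)\<^sup>2 * (2 * t))) (at t)" for t :: real
      by (auto intro!: derivative_eq_intros)
    show thesis
      by (rule truncated_norm_lipschitz[OF d, of "1/2", where 'a = "real^'d^'v"])
         (auto intro!: continuous_intros that simp: h_trunc)
  qed
  obtain Lg where Lg: "Lg > 0" "\<And>x y. \<bar>g x - g y\<bar> \<le> Lg * norm (x - y)"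
  proof -
    have d: "((\<lambda>t. (1/4 - t\<^sup>2)\<^sup>2 * N - (1/4 - t\<^sup>2)\<^sup>2 * t\<^sup>2 - 4 * ((1/4 - t\<^sup>2) * t\<^sup>2)) has_real_derivative
        (2 * (1/4 - t\<^sup>2) * (- (2 * t)) * N - (2 * (1/4 - t\<^sup>2) * (- (2 * t)) * t\<^sup>2 + (1/4 - t\<^sup>2)\<^sup>2 * (2 * t))
         - 4 * (- (2 * t) * t\<^sup>2 + (1/4 - t\<^sup>2) * (2 * t)))) (at t)" for t :: real
      by (auto intro!: derivative_eq_intros simp: algebra_simps power2_eq_square power3_eq_cube)
    show thesis
      by (rule truncated_norm_lipschitz[OF d, of "1/2", where 'a = "real^'d^'v"])
         (auto intro!: continuous_intros that simp: g_trunc)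
  qed
  have h0: "0 \<le> h x" for x by (simp add: h_def cutoff_nonneg)
  have cg: "continuous_on UNIV g" and ch: "continuous_on UNIV h"
    unfolding g_def[abs_def] h_def[abs_def] by (intro continuous_intros)+
  have c\<phi>: "continuous_on UNIV \<phi>" using \<phi>(1) by (rule has_score_continuous)
  have ih: "integrable lborel (\<lambda>x. \<phi> x * h x)"
    by (rule integrable_lborel_compact_support[of _ "1/4"]) (auto intro!: continuous_intros c\<phi> ch simp: h_def cutoff_eq_0)
  define I where "I = (LBINT x. \<phi> x * h x)"
  have I: "I > 0"
  proof -
    obtain e :: "real^'d^'v" where e: "norm e = 1" using norm_Basis SOME_Basis by blast
    \<comment> \<open>On this ball the norm stays strictly between 0 and 1 / 2, so \<open>h\<close>
      is positive there.\<close>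
    let ?B = "ball ((1/4) *\<^sub>R e) (1/8)"
    have hB: "h x > 0" if "x \<in> ?B" for x
    proof -
      have "norm ((1/4) *\<^sub>R e - x) < 1/8" using that by (simp add: dist_norm)
      moreover have "\<bar>1/4 - norm x\<bar> \<le> norm ((1/4) *\<^sub>R e - x)"
        using e norm_triangle_ineq3[of "(1/4) *\<^sub>R e" x] by simp
      ultimately have "1/8 < norm x" "norm x < 1/2" by linarith+
      then have "0 < min (norm x) (1/2)" "min (norm x) (1/2) < 1/2" by auto
      then have "(min (norm x) (1/2))\<^sup>2 < (1/2)\<^sup>2" "0 < (min (norm x) (1/2))\<^sup>2"
        using power_strict_mono[of "min (norm x) (1/2)" "1/2" 2] by auto
      then show ?thesis unfolding h_trunc by (simp add: power2_eq_square)
    qed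
    have "I \<noteq> 0"
    proof
      assume "I = 0"
      then have "AE x in lborel. \<phi> x * h x = 0"
        unfolding I_def using pos h0 ih by (subst (asm) integral_nonneg_eq_0_iff_AE) (auto simp: less_imp_le)
      then have "AE x in lborel. x \<notin> ?B"
        by (rule AE_mp) (use pos hB in \<open>auto intro!: AE_I2 simp: less_le\<close>)
      then have "emeasure lborel ?B = 0"
        by (subst (asm) AE_iff_measurable[of ?B]) auto
      then show False using emeasure_lborel_ball_pos[of "1/8" "(1/4) *\<^sub>R e"] by simp
    qed
    moreover have "0 \<le> I" unfolding I_def using pos h0 by (intro integral_nonneg_AE) (auto simp: less_imp_le)
    ultimately show ?thesis by simp
  qed
  have ibp: "(LBINT x. p x * (cutoff (1/4) x * (N + x \<bullet> s x) - 4 * max 0 (1/4 - x \<bullet> x) * (x \<bullet> x))) = 0"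
    if "has_score p s" for p :: "real^'d^'v \<Rightarrow> real" and s
  proof -
    have "(\<Sum>b\<in>(Basis :: (real^'d^'v) set). b \<bullet> b) = N"
      by (simp add: N_def inner_same_Basis cong: sum.cong)
    then show ?thesis
      using score_ibp_cutoff[OF that has_derivative_ident, of "1/4"] by simp
  qed
  \<comment> \<open>The bound 3 makes 10 / sqrt(1 - 2 / n) at most 20; the sum of the dimensions
    gives the hypothesis \<nu> + d - 1 \<le> n of the gap lemma; the last entry makes the error 20
    N^2 Lh / n at most I / 2.\<close>
  define n0 where "n0 = max 3 (max (real CARD('v) + real CARD('d)) (40 * N\<^sup>2 * Lh / I))"
  show thesis
  proof (rule that[OF Lg(1) _ _ Lg(2)])
    show "I / 4 > 0" using I by simp
    show "n0 > 2" by (simp add: n0_def)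
    fix n m and q :: "real^'d^'v \<Rightarrow> real"
    assume n0: "n0 \<le> n" and m: "m = n + real CARD('v) + real CARD('d) - 1"
      and q: "has_score q (t_score n m)" "integrable lborel q" "(LBINT x. q x) = 1"
    have n: "3 \<le> n" "real CARD('v) + real CARD('d) \<le> n" "40 * N\<^sup>2 * Lh / I \<le> n"
      using n0 by (auto simp: n0_def)
    have nn: "n > 2" "n > 0" using n by auto
    have q0: "0 \<le> q x" for x using q(1) by (rule has_score_nonneg)
    have cq: "continuous_on UNIV q" using q(1) by (rule has_score_continuous)
    have cs: "continuous_on UNIV (t_score n m :: real^'d^'v \<Rightarrow> _)" using q(1) by (simp add: has_score_def)
    have "(LBINT x. \<phi> x * g x) = 0" using ibp[OF \<phi>(1)] by (simp add: g_def)
    moreover have "(LBINT x. q x * h x) / (2 * n) \<le> (LBINT x. q x * g x)"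
    proof -
      let ?k = "\<lambda>x. q x * (cutoff (1/4) x * - (x \<bullet> (x + t_score n m x)))"
      have i1: "integrable lborel ?k"
        by (rule integrable_lborel_compact_support[of _ "1/4"]) (auto intro!: continuous_intros cq cs simp: cutoff_eq_0)
      have i2: "integrable lborel (\<lambda>x. q x * g x)"
        by (rule integrable_lborel_compact_support[of _ "1/4"]) (auto intro!: continuous_intros cq cg simp: g_def cutoff_eq_0)
      have i3: "integrable lborel (\<lambda>x. q x * h x)"
        by (rule integrable_lborel_compact_support[of _ "1/4"]) (auto intro!: continuous_intros cq ch simp: h_def cutoff_eq_0)
      \<comment> \<open>The integrand is the integration by parts identity for \<open>q\<close>: its
        score replaces the Gaussian score in \<open>g\<close>, and the difference is the cutoff
        times - x . (x + s x).\<close>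
      have "(LBINT x. q x * g x - ?k x) = 0"
        using ibp[OF q(1)] by (simp add: g_def inner_add_right algebra_simps)
      then have "(LBINT x. q x * g x) = (LBINT x. ?k x)" using i1 i2 by simp
      also have "\<dots> \<ge> (LBINT x. q x * h x / (2 * n))"
      proof (rule integral_mono[OF _ i1])
        show "integrable lborel (\<lambda>x. q x * h x / (2 * n))" using i3 by simp
        fix x :: "real^'d^'v"
        have "cutoff (1/4) x * ((x \<bullet> x) / (2 * n)) \<le> cutoff (1/4) x * - (x \<bullet> (x + t_score n m x))"
        proof (cases "x \<bullet> x \<le> 1 / 4")
          case True
          have "real CARD('v) + real CARD('d) - 1 \<le> n" using n(2) by linarith
          from t_score_inward_gap[OF m nn(2) this True] show ?thesis
            by (rule mult_left_mono) (rule cutoff_nonneg)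
        qed (simp add: cutoff_eq_0)
        from mult_left_mono[OF this q0[of x]]
        show "q x * h x / (2 * n) \<le> ?k x" by (simp add: h_def)
      qed
      finally show ?thesis by simp
    qed
    moreover have "I / 2 \<le> (LBINT x. q x * h x)"
    proof -
      have "1 / 2 \<le> sqrt (1 - 2 / n)"
      proof (rule real_le_rsqrt)
        have "2 / n \<le> 2 / 3" using n by (intro divide_left_mono) auto
        then show "(1 / 2)\<^sup>2 \<le> 1 - 2 / n" by (simp add: power2_eq_square)
      qed
      then have "10 / sqrt (1 - 2 / n) \<le> 10 / (1 / 2)" by (intro divide_left_mono mult_pos_pos) linarith+
      then have "10 / sqrt (1 - 2 / n) * (N\<^sup>2 / n) * Lh \<le> 20 * (N\<^sup>2 / n) * Lh"
        using nn Lh by (intro mult_right_mono) auto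
      also have "\<dots> \<le> I / 2" using n(3) I nn by (simp add: field_simps)
      finally show ?thesis
        using t_gaussian_upper_bound(3)[OF nn(1) m q \<phi> Lh, folded N_def I_def] by linarith
    qed
    ultimately show "I / 4 / n \<le> (LBINT x. q x * g x) - (LBINT x. \<phi> x * g x)"
      using nn divide_right_mono[of "I / 2" "(LBINT x. q x * h x)" "2 * n"] by simp
  qed
qed

section \<open>Reduction to identity matrices\<close>

text \<open>Change of variables with \<open>c\<close> in the role of the absolute Jacobian
  determinant, left unevaluated.\<close>

lemma lborel_linear_substitution:
  fixes L :: "'a::euclidean_space \<Rightarrow> 'b::euclidean_space"
  assumes L: "linear L" "bij L"
  shows "\<exists>c>0. \<forall>f\<in>(borel_measurable borel :: ('b \<Rightarrow> real) set). (LBINT y. c * f (L y)) = (LBINT x. f x)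
    \<and> (integrable lborel (\<lambda>y. c * f (L y)) \<longleftrightarrow> integrable lborel f)"
proof -
  obtain k :: real where k: "k > 0" "distr lborel borel L = density lborel (\<lambda>_. ennreal k)"
    using lborel_distr_linear[OF L] .
  have [measurable]: "L \<in> borel_measurable borel"
    using L(1) by (simp add: borel_measurable_continuous_onI linear_continuous_on linear_linear)
  show ?thesis
  proof (intro exI[of _ "1 / k"] conjI ballI)
    show "1 / k > 0" using k by simp
    fix f :: "'b \<Rightarrow> real" assume f [measurable]: "f \<in> borel_measurable borel"
    have "(LBINT y. f (L y)) = (\<integral>x. f x \<partial>(density lborel (\<lambda>_. ennreal k)))"
      unfolding k(2)[symmetric] by (rule integral_distr[symmetric]) auto
    also have "\<dots> = k * (LBINT x. f x)"
      using k(1) by (subst integral_density) auto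
    finally show "(LBINT y. 1 / k * f (L y)) = (LBINT x. f x)" using k(1) by simp
    have "integrable lborel (\<lambda>y. f (L y)) \<longleftrightarrow> integrable (density lborel (\<lambda>_. ennreal k)) f"
      unfolding k(2)[symmetric] by (rule integrable_distr_eq[symmetric]) auto
    also have "\<dots> \<longleftrightarrow> integrable lborel (\<lambda>x. k * f x)"
      using k(1) by (subst integrable_density) auto
    finally have "integrable lborel (\<lambda>y. f (L y)) \<longleftrightarrow> integrable lborel f"
      using k(1) by simp
    moreover have "integrable lborel (\<lambda>y. 1 / k * f (L y)) \<longleftrightarrow> 1 / k = 0 \<or> integrable lborel (\<lambda>y. f (L y))"
      by (rule integrable_mult_left_iff)
    ultimately show "integrable lborel (\<lambda>y. 1 / k * f (L y)) \<longleftrightarrow> integrable lborel f"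
      using k(1) by simp
  qed
qed

text \<open>Even the sign of the constant is read off from the total mass: for nonpositive
  \<open>C\<close> the conversion to \<open>ennreal\<close> would truncate the density to 0.\<close>

lemma distributed_normalization:
  fixes X :: "'a \<Rightarrow> 'b::euclidean_space"
  assumes P: "prob_space P" and X: "distributed P lborel X (\<lambda>x. ennreal (p x))"
    and p: "\<And>x. p x = C * k x" "\<And>x. 0 < k x" "continuous_on UNIV k"
  shows "C > 0" "integrable lborel p" "(LBINT x. p x) = 1"
    and "\<And>g. g \<in> borel_measurable borel \<Longrightarrow> (\<integral>\<omega>. g (X \<omega>) \<partial>P) = (LBINT x. p x * g x)"
    and "\<And>g. g \<in> borel_measurable borel \<Longrightarrow> integrable P (\<lambda>\<omega>. g (X \<omega>)) \<longleftrightarrow> integrable lborel (\<lambda>x. p x * g x)"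
proof -
  interpret prob_space P by fact
  have [measurable]: "k \<in> borel_measurable borel" using p(3) by (rule borel_measurable_continuous_onI)
  have pk: "p = (\<lambda>x. C * k x)" using p(1) by auto
  have [measurable]: "p \<in> borel_measurable borel" unfolding pk by simp
  have [measurable]: "X \<in> measurable P borel" using distributed_measurable[OF X] by simp
  have "emeasure (distr P lborel X) (space lborel) = 1"
    using distributed_measurable[OF X] emeasure_space_1 by (subst emeasure_distr) auto
  then have one: "(\<integral>\<^sup>+x. ennreal (p x) \<partial>lborel) = 1"
    unfolding distributed_distr_eq_density[OF X] by (simp add: emeasure_density)
  show C: "C > 0"
  proof (rule ccontr)
    assume "\<not> C > 0"
    then have "p x \<le> 0" for x unfolding p(1) using p(2)[of x] by (intro mult_nonpos_nonneg) auto
    then have "(\<integral>\<^sup>+x. ennreal (p x) \<partial>lborel) = 0" by (simp add: ennreal_neg)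
    with one show False by simp
  qed
  have p0: "0 \<le> p x" for x unfolding p(1) using C p(2)[of x] by simp
  show i: "integrable lborel p" by (rule integrableI_nonneg) (use p0 one in auto)
  show "(LBINT x. p x) = 1"
    using one nn_integral_eq_integral[OF i] p0 by simp
  fix g :: "'b \<Rightarrow> real" assume [measurable]: "g \<in> borel_measurable borel"
  have "(\<integral>\<omega>. g (X \<omega>) \<partial>P) = (\<integral>x. g x \<partial>(distr P lborel X))"
    using distributed_measurable[OF X] by (intro integral_distr[symmetric]) auto
  then show "(\<integral>\<omega>. g (X \<omega>) \<partial>P) = (LBINT x. p x * g x)"
    unfolding distributed_distr_eq_density[OF X] using p0 by (subst (asm) integral_density) auto
  have "integrable P (\<lambda>\<omega>. g (X \<omega>)) \<longleftrightarrow> integrable (distr P lborel X) g"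
    using distributed_measurable[OF X] by (intro integrable_distr_eq[symmetric]) auto
  then show "integrable P (\<lambda>\<omega>. g (X \<omega>)) \<longleftrightarrow> integrable lborel (\<lambda>x. p x * g x)"
    unfolding distributed_distr_eq_density[OF X] using p0 by (subst (asm) integrable_density) auto
qed

section \<open>Vectorization and the Kronecker product\<close>

lemma matrix_inv_eqI:
  fixes A B :: "real^'n^'n"
  assumes "A ** B = mat 1"
  shows "matrix_inv A = B"
proof -
  have BA: "B ** A = mat 1" using assms matrix_left_right_inverse by blast
  then have "invertible A" using assms unfolding invertible_def by blast
  then have "B ** (A ** matrix_inv A) = B" by (simp add: matrix_inv_mult)
  then show ?thesis by (simp add: matrix_mul_assoc BA)
qed

lemma linear_vec_columns_transpose: "linear (\<lambda>X :: real^'d^'v. vec_columns (transpose X))"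
  by (rule linearI) (auto simp: vec_columns_def transpose_def vec_eq_iff)

lemma bij_vec_columns_transpose: "bij (\<lambda>X :: real^'d^'v. vec_columns (transpose X))"
proof (rule o_bij)
  let ?U = "\<lambda>u :: real^('v \<times> 'd). (\<chi> i j. u $ (i, j)) :: real^'d^'v"
  show "?U \<circ> (\<lambda>X. vec_columns (transpose X)) = id"
    by (auto simp: vec_columns_def transpose_def vec_eq_iff fun_eq_iff)
  show "(\<lambda>X. vec_columns (transpose X)) \<circ> ?U = id"
    by (auto simp: vec_columns_def transpose_def vec_eq_iff fun_eq_iff)
qed

lemma inner_vec_columns_transpose:
  "vec_columns (transpose X) \<bullet> vec_columns (transpose Y) = (X :: real^'d^'v) \<bullet> Y"
  by (simp add: inner_vec_def vec_columns_def transpose_def sum.cartesian_product case_prod_beta'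
      flip: UNIV_Times_UNIV)

lemma kronecker_mult_vec_columns:
  fixes \<Psi> :: "real^'v^'v" and \<Sigma> :: "real^'d^'d" and X :: "real^'d^'v"
  shows "kronecker \<Psi> \<Sigma> *v vec_columns (transpose X) = vec_columns (transpose (\<Psi> ** X ** transpose \<Sigma>))"
proof -
  have "(\<Sum>p\<in>(UNIV :: ('v \<times> 'd) set). \<Psi> $ i $ fst p * \<Sigma> $ j $ snd p * X $ fst p $ snd p)
     = (\<Sum>l\<in>UNIV. (\<Sum>k\<in>UNIV. \<Psi> $ i $ k * X $ k $ l) * \<Sigma> $ j $ l)" for i j
  proof -
    have "(\<Sum>p\<in>(UNIV :: ('v \<times> 'd) set). \<Psi> $ i $ fst p * \<Sigma> $ j $ snd p * X $ fst p $ snd p)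
      = (\<Sum>k\<in>UNIV. \<Sum>l\<in>UNIV. \<Psi> $ i $ k * \<Sigma> $ j $ l * X $ k $ l)"
      by (simp add: sum.cartesian_product case_prod_beta' flip: UNIV_Times_UNIV)
    also have "\<dots> = (\<Sum>l\<in>UNIV. \<Sum>k\<in>UNIV. \<Psi> $ i $ k * \<Sigma> $ j $ l * X $ k $ l)" by (rule sum.swap)
    also have "\<dots> = (\<Sum>l\<in>UNIV. (\<Sum>k\<in>UNIV. \<Psi> $ i $ k * X $ k $ l) * \<Sigma> $ j $ l)"
      by (intro sum.cong refl) (simp add: sum_distrib_left mult_ac)
    finally show ?thesis .
  qed
  then show ?thesis
    by (simp add: vec_eq_iff matrix_vector_mult_def matrix_matrix_mult_def kronecker_def vec_columns_def transpose_def)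
qed

text \<open>Every vector is a vectorized matrix, on which the two Kronecker products act in
  succession by multiplication from both sides and cancel.\<close>

lemma matrix_inv_kronecker:
  fixes \<Psi> P :: "real^'v^'v" and \<Sigma> R :: "real^'d^'d"
  assumes "\<Psi> ** P = mat 1" "\<Sigma> ** R = mat 1"
  shows "matrix_inv (kronecker \<Psi> \<Sigma>) = kronecker P R"
proof (rule matrix_inv_eqI)
  have "(kronecker \<Psi> \<Sigma> ** kronecker P R) *v u = mat 1 *v u" for u
  proof -
    obtain X :: "real^'d^'v" where u: "u = vec_columns (transpose X)"
      using surjD[OF bij_is_surj[OF bij_vec_columns_transpose], of u] by blast
    have "transpose R ** transpose \<Sigma> = mat 1"
      using arg_cong[OF assms(2), of transpose] by (simp add: matrix_transpose_mul transpose_mat)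
    moreover have "\<Psi> ** (P ** X ** transpose R) ** transpose \<Sigma> = (\<Psi> ** P) ** X ** (transpose R ** transpose \<Sigma>)"
      by (simp add: matrix_mul_assoc)
    ultimately have "\<Psi> ** (P ** X ** transpose R) ** transpose \<Sigma> = X" using assms(1) by simp
    then show ?thesis
      by (simp add: u kronecker_mult_vec_columns flip: matrix_vector_mul_assoc)
  qed
  then show "kronecker \<Psi> \<Sigma> ** kronecker P R = mat 1" by (simp add: matrix_eq)
qed

text \<open>The bound is immediate for \<open>transpose A\<close>, because |A^T w|^2 = w . A A^T w.
  It passes to \<open>A\<close> through |A x|^2 = x . A^T (A x).\<close>

lemma norm_factor_le:
  fixes A :: "real^'n^'n"
  shows "norm (A *v x) \<le> sqrt (spectral_norm (A ** transpose A)) * norm x"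
proof -
  let ?\<sigma> = "spectral_norm (A ** transpose A)"
  have bl: "bounded_linear (\<lambda>x. (A ** transpose A) *v x)" by (rule matrix_vector_mul_bounded_linear)
  have s0: "0 \<le> ?\<sigma>" unfolding spectral_norm_def by (rule onorm_pos_le[OF bl])
  have t: "norm (transpose A *v w) \<le> sqrt ?\<sigma> * norm w" for w
  proof -
    have "(norm (transpose A *v w))\<^sup>2 = w \<bullet> ((A ** transpose A) *v w)"
      by (simp only: power2_norm_eq_inner matrix_vector_mul_assoc[symmetric] dot_lmul_matrix[symmetric]
          transpose_matrix_vector)
    also have "\<dots> \<le> norm w * norm ((A ** transpose A) *v w)" by (rule norm_cauchy_schwarz)
    also have "\<dots> \<le> norm w * (?\<sigma> * norm w)"
      unfolding spectral_norm_def by (intro mult_left_mono onorm[OF bl]) auto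
    also have "\<dots> = (sqrt ?\<sigma> * norm w)\<^sup>2" using s0 by (simp add: power_mult_distrib) (simp add: power2_eq_square)
    finally show ?thesis using s0 by (simp add: power2_le_iff_abs_le)
  qed
  have "(norm (A *v x))\<^sup>2 = x \<bullet> (transpose A *v (A *v x))"
    by (metis dot_lmul_matrix inner_commute power2_norm_eq_inner transpose_matrix_vector)
  also have "\<dots> \<le> norm x * norm (transpose A *v (A *v x))" by (rule norm_cauchy_schwarz)
  also have "\<dots> \<le> norm x * (sqrt ?\<sigma> * norm (A *v x))" by (intro mult_left_mono t) auto
  finally have *: "norm (A *v x) * norm (A *v x) \<le> (sqrt ?\<sigma> * norm x) * norm (A *v x)"
    by (simp add: power2_eq_square mult_ac)
  show ?thesis
  proof (cases "A *v x = 0")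
    case False
    with * show ?thesis by simp
  qed (use s0 in simp)
qed

text \<open>After substituting A Y B^T the matrix is the Gram matrix of Y conjugated by
  \<open>transpose A\<close>, so the determinant is unchanged.\<close>

lemma det_transformed_gram:
  fixes A A' :: "real^'v^'v" and B B' :: "real^'d^'d" and Y :: "real^'d^'v"
  assumes A: "A' ** A = mat 1" "A ** A' = mat 1" and B: "B' ** B = mat 1" "B ** B' = mat 1"
  shows "det (mat 1 + (1 / n) *\<^sub>R ((transpose A' ** A') ** (A ** Y ** transpose B) ** (transpose B' ** B')
      ** transpose (A ** Y ** transpose B))) = det (gram n Y)"
proof -
  have tA: "transpose A' ** transpose A = mat 1"
    using arg_cong[OF A(2), of transpose] by (simp add: matrix_transpose_mul transpose_mat)
  have tB: "transpose B ** transpose B' = mat 1"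
    using arg_cong[OF B(1), of transpose] by (simp add: matrix_transpose_mul transpose_mat)
  have "(transpose A' ** A') ** (A ** Y ** transpose B) ** (transpose B' ** B') ** transpose (A ** Y ** transpose B)
     = transpose A' ** (A' ** A) ** Y ** (transpose B ** transpose B') ** (B' ** B) ** transpose Y ** transpose A"
    by (simp add: matrix_transpose_mul transpose_transpose matrix_mul_assoc)
  also have "\<dots> = transpose A' ** (Y ** transpose Y) ** transpose A"
    by (simp add: A B tB matrix_mul_assoc)
  finally have "mat 1 + (1 / n) *\<^sub>R ((transpose A' ** A') ** (A ** Y ** transpose B) ** (transpose B' ** B')
      ** transpose (A ** Y ** transpose B)) = transpose A' ** gram n Y ** transpose A"
    by (simp add: gram_def matrix_mult_add matrix_mult_scaleR tA)
  then have "det (mat 1 + (1 / n) *\<^sub>R ((transpose A' ** A') ** (A ** Y ** transpose B) ** (transpose B' ** B')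
      ** transpose (A ** Y ** transpose B))) = det (transpose A' ** transpose A) * det (gram n Y)"
    by (simp add: det_mul)
  then show ?thesis by (simp add: tA)
qed

text \<open>Says that \<open>\<mu>\<close> is the image under \<open>L\<close> of the measure with Lebesgue density \<open>q\<close>, in the form in
  which it is used.\<close>

definition has_pullback_density ::
    "'b::euclidean_space measure \<Rightarrow> ('a::euclidean_space \<Rightarrow> 'b) \<Rightarrow> ('a \<Rightarrow> real) \<Rightarrow> bool" where
  "has_pullback_density \<mu> L q \<longleftrightarrow> (\<forall>g\<in>borel_measurable borel.
     (\<integral>x. g x \<partial>\<mu>) = (LBINT y. q y * g (L y))
     \<and> (integrable \<mu> g \<longleftrightarrow> integrable lborel (\<lambda>y. q y * g (L y))))"

lemma has_pullback_densityI:
  assumes "\<And>g. g \<in> borel_measurable borel \<Longrightarrow> (\<integral>x. g x \<partial>\<mu>) = (LBINT y. q y * g (L y))"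
    and "\<And>g. g \<in> borel_measurable borel \<Longrightarrow> integrable \<mu> g \<longleftrightarrow> integrable lborel (\<lambda>y. q y * g (L y))"
  shows "has_pullback_density \<mu> L q"
  unfolding has_pullback_density_def by (intro ballI conjI assms)

lemma has_pullback_densityD:
  assumes "has_pullback_density \<mu> L q" "g \<in> borel_measurable borel"
  shows "(\<integral>x. g x \<partial>\<mu>) = (LBINT y. q y * g (L y))"
    and "integrable \<mu> g \<longleftrightarrow> integrable lborel (\<lambda>y. q y * g (L y))"
  using bspec[OF assms(1)[unfolded has_pullback_density_def] assms(2)] by simp_all

text \<open>One and the same \<open>L Y = A Y B^T\<close> reduces both laws, so they can be compared
  after the reduction. The norm bound on \<open>L\<close> is the source of the spectral norms in the
  theorem.\<close>

lemma matrix_law_reduction: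
  fixes \<Psi> :: "real^'v^'v" and \<Sigma> :: "real^'d^'d"
    and P :: "'a measure" and Z :: "'a \<Rightarrow> real^'d^'v"
  assumes "pos_def \<Psi>" "pos_def \<Sigma>"
    and P: "prob_space P" and Z: "matrix_normal_distributed P Z 0 \<Psi> \<Sigma>"
  obtains L :: "real^'d^'v \<Rightarrow> real^'d^'v" and \<phi> where "linear L" "bij L"
    "\<And>Y. norm (L Y) \<le> sqrt (spectral_norm \<Psi>) * sqrt (spectral_norm \<Sigma>) * norm Y"
    "has_score \<phi> uminus" "integrable lborel \<phi>" "(LBINT x. \<phi> x) = 1" "\<And>x. 0 < \<phi> x"
    "has_pullback_density (distr P borel Z) L \<phi>"
    "\<And>n (Q :: 'b measure) T. n > 0 \<Longrightarrow> prob_space Q \<Longrightarrow> matrix_t_distributed Q T n \<Psi> \<Sigma> \<Longrightarrow>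
       \<exists>q. has_score q (t_score n (n + real CARD('v) + real CARD('d) - 1)) \<and> integrable lborel q
         \<and> (LBINT x. q x) = 1 \<and> has_pullback_density (distr Q borel T) L q"
proof -
  obtain A :: "real^'v^'v" where \<Psi>: "\<Psi> = A ** transpose A" and invA: "invertible A"
    using assms(1) by (rule pos_def_factorization)
  obtain B :: "real^'d^'d" where \<Sigma>: "\<Sigma> = B ** transpose B" and invB: "invertible B"
    using assms(2) by (rule pos_def_factorization)
  define A' where "A' = matrix_inv A"
  define B' where "B' = matrix_inv B"
  have A: "A' ** A = mat 1" "A ** A' = mat 1" and B: "B' ** B = mat 1" "B ** B' = mat 1"
    unfolding A'_def B'_def by (simp_all add: matrix_inv_mult invA invB)
  have tA: "transpose A ** transpose A' = mat 1"
    using arg_cong[OF A(1), of transpose] by (simp add: matrix_transpose_mul transpose_mat)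
  have tB: "transpose B ** transpose B' = mat 1" "transpose B' ** transpose B = mat 1"
    using arg_cong[OF B(1), of transpose] arg_cong[OF B(2), of transpose]
    by (simp_all add: matrix_transpose_mul transpose_mat)
  define L where "L Y = A ** Y ** transpose B" for Y :: "real^'d^'v"
  have \<Psi>i: "\<Psi> ** (transpose A' ** A') = mat 1"
  proof -
    have "\<Psi> ** (transpose A' ** A') = A ** (transpose A ** transpose A') ** A'"
      unfolding \<Psi> by (simp add: matrix_mul_assoc)
    then show ?thesis by (simp add: tA A)
  qed
  have \<Sigma>i: "\<Sigma> ** (transpose B' ** B') = mat 1"
  proof -
    have "\<Sigma> ** (transpose B' ** B') = B ** (transpose B ** transpose B') ** B'"
      unfolding \<Sigma> by (simp add: matrix_mul_assoc)
    then show ?thesis by (simp add: tB B)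
  qed
  have linL: "linear L"
    unfolding L_def by (rule linearI) (simp_all add: matrix_mult_add matrix_mult_scaleR)
  have bijL: "bij L"
  proof (rule o_bij)
    have "A' ** (A ** Y ** transpose B) ** transpose B' = (A' ** A) ** Y ** (transpose B ** transpose B')" for Y :: "real^'d^'v"
      by (simp add: matrix_mul_assoc)
    then show "(\<lambda>X. A' ** X ** transpose B') \<circ> L = id" by (auto simp: L_def A tB fun_eq_iff)
    have "A ** (A' ** Y ** transpose B') ** transpose B = (A ** A') ** Y ** (transpose B' ** transpose B)" for Y :: "real^'d^'v"
      by (simp add: matrix_mul_assoc)
    then show "L \<circ> (\<lambda>X. A' ** X ** transpose B') = id" by (auto simp: L_def A tB fun_eq_iff)
  qed
  have normL: "norm (L Y) \<le> sqrt (spectral_norm \<Psi>) * sqrt (spectral_norm \<Sigma>) * norm Y" for Y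
  proof -
    have s0: "0 \<le> spectral_norm \<Psi>" "0 \<le> spectral_norm \<Sigma>"
      unfolding spectral_norm_def by (intro onorm_pos_le matrix_vector_mul_bounded_linear)+
    have "norm (L Y) = norm (A ** (Y ** transpose B))" by (simp add: L_def matrix_mul_assoc)
    also have "\<dots> \<le> sqrt (spectral_norm \<Psi>) * norm (Y ** transpose B)"
      unfolding \<Psi> by (rule norm_matrix_mult_le[OF norm_factor_le]) (use s0 \<Psi> in simp)
    also have "norm (Y ** transpose B) = norm (B ** transpose Y)"
      by (metis matrix_transpose_mul norm_transpose transpose_transpose)
    also have "norm (B ** transpose Y) \<le> sqrt (spectral_norm \<Sigma>) * norm (transpose Y)"
      unfolding \<Sigma> by (rule norm_matrix_mult_le[OF norm_factor_le]) (use s0 \<Sigma> in simp)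
    finally show ?thesis using s0 by (simp add: norm_transpose mult_left_mono mult.assoc)
  qed
  let ?V = "\<lambda>X :: real^'d^'v. vec_columns (transpose X)"
  let ?K = "kronecker \<Psi> \<Sigma>"
  let ?p = "mv_normal_density (?V 0) ?K"
  define C where "C = 1 / sqrt ((2 * pi) ^ CARD('v \<times> 'd) * det ?K)"
  have V0: "?V 0 = 0" using linear_0[OF linear_vec_columns_transpose] .
  have p_eq: "?p u = C * exp (- (u \<bullet> (matrix_inv ?K *v u)) / 2)" for u
    by (simp add: mv_normal_density_def V0 C_def)
  have cont: "continuous_on UNIV (\<lambda>u. exp (- (u \<bullet> (matrix_inv ?K *v u)) / 2))"
    by (intro continuous_intros linear_continuous_on matrix_vector_mul_bounded_linear) auto
  have dZ: "distributed P lborel (\<lambda>\<omega>. ?V (Z \<omega>)) (\<lambda>x. ennreal (?p x))"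
    using Z by (simp add: matrix_normal_distributed_def)
  note nZ = distributed_normalization[OF P dZ p_eq exp_gt_zero cont]
  have W: "linear (\<lambda>Y. ?V (L Y))" "bij (\<lambda>Y. ?V (L Y))"
    using linear_compose[OF linL linear_vec_columns_transpose] bij_comp[OF bijL bij_vec_columns_transpose]
    by (simp_all add: o_def)
  obtain c where c0: "c > 0" and cB: "\<forall>f\<in>(borel_measurable borel :: (real^('v \<times> 'd) \<Rightarrow> real) set).
      (LBINT y. c * f (?V (L y))) = (LBINT x. f x)
      \<and> (integrable lborel (\<lambda>y. c * f (?V (L y))) \<longleftrightarrow> integrable lborel f)"
    using lborel_linear_substitution[OF W] by (elim exE conjE) (rule that)
  note c = c0 bspec[OF cB, THEN conjunct1] bspec[OF cB, THEN conjunct2]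
  \<comment> \<open>The vectorization rule turns the quadratic form into a matrix inner product,
    where the inverse factors \<open>A'\<close> and \<open>B'\<close> cancel against
    \<open>A\<close> and \<open>B\<close>.\<close>
  have quad: "?V (L Y) \<bullet> (matrix_inv ?K *v ?V (L Y)) = Y \<bullet> Y" for Y
  proof -
    have "?V (L Y) \<bullet> (matrix_inv ?K *v ?V (L Y))
       = L Y \<bullet> ((transpose A' ** A') ** L Y ** transpose (transpose B' ** B'))"
      by (simp only: matrix_inv_kronecker[OF \<Psi>i \<Sigma>i] kronecker_mult_vec_columns inner_vec_columns_transpose)
    also have "(transpose A' ** A') ** L Y ** transpose (transpose B' ** B')
       = transpose A' ** (A' ** A) ** Y ** (transpose B ** transpose B') ** B'"
      by (simp add: L_def matrix_transpose_mul transpose_transpose matrix_mul_assoc)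
    also have "\<dots> = transpose A' ** Y ** B'" by (simp add: A tB)
    also have "L Y \<bullet> (transpose A' ** Y ** B') = (A ** Y) \<bullet> (transpose A' ** Y ** B' ** B)"
      unfolding L_def by (simp only: inner_matrix_mult_right transpose_transpose)
    also have "\<dots> = Y \<bullet> (transpose A ** (transpose A' ** Y ** B' ** B))"
      by (rule inner_matrix_mult_left)
    also have "transpose A ** (transpose A' ** Y ** B' ** B) = (transpose A ** transpose A') ** Y ** (B' ** B)"
      by (simp only: matrix_mul_assoc)
    finally show ?thesis by (simp add: tA B)
  qed
  define \<phi> where "\<phi> Y = c * C * exp (- (Y \<bullet> Y) / 2)" for Y :: "real^'d^'v"
  have \<phi>p: "c * ?p (?V (L Y)) = \<phi> Y" for Y by (simp add: p_eq quad \<phi>_def)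
  have pm: "?p \<in> borel_measurable borel"
    unfolding p_eq[abs_def] by (intro borel_measurable_continuous_onI continuous_on_mult continuous_on_const cont)
  have \<phi>: "integrable lborel \<phi>" "(LBINT x. \<phi> x) = 1"
    using c(2,3)[OF pm] nZ(2,3) by (simp_all add: \<phi>p)
  have \<phi>_pos: "0 < \<phi> x" for x using c(1) nZ(1) by (simp add: \<phi>_def)
  have \<phi>_score: "has_score \<phi> uminus"
  proof -
    have "((\<lambda>Y. exp (- (Y \<bullet> Y) / 2)) has_derivative (\<lambda>h. exp (- (x \<bullet> x) / 2) * (- x \<bullet> h))) (at x)" for x :: "real^'d^'v"
      by (rule derivative_eq_intros refl | simp add: inner_commute algebra_simps)+
    then have "has_score (\<lambda>Y :: real^'d^'v. exp (- (Y \<bullet> Y) / 2)) uminus"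
      unfolding has_score_def by (auto intro!: continuous_intros)
    from has_score_cmult[OF this, of "c * C"] show ?thesis
      using c(1) nZ(1) by (simp add: \<phi>_def[abs_def])
  qed
  \<comment> \<open>\<open>U\<close> undoes the vectorization. The normal law is stated for the
    vectorized variable, and \<open>U\<close> recovers from it the measurability of \<open>Z\<close>
    and the integrals of functions of \<open>Z\<close>.\<close>
  define U where "U u = (\<chi> i j. u $ (i, j))" for u :: "real^('v \<times> 'd)"
  have UV: "U (?V X) = X" for X
    by (simp add: U_def vec_columns_def transpose_def vec_eq_iff)
  have "linear U" by (rule linearI) (simp_all add: U_def vec_eq_iff)
  then have Um [measurable]: "U \<in> borel_measurable borel"
    by (simp add: borel_measurable_continuous_onI linear_continuous_on linear_linear)
  have Zm [measurable]: "Z \<in> measurable P borel"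
  proof -
    have "(\<lambda>\<omega>. U (?V (Z \<omega>))) \<in> measurable P borel"
      using distributed_measurable[OF dZ] by (intro measurable_compose[OF _ Um]) auto
    then show ?thesis by (simp add: UV)
  qed
  have gZ: "has_pullback_density (distr P borel Z) L \<phi>"
  proof (rule has_pullback_densityI)
    fix g :: "real^'d^'v \<Rightarrow> real" assume g [measurable]: "g \<in> borel_measurable borel"
    have gU: "(\<lambda>u. g (U u)) \<in> borel_measurable borel" by measurable
    have pgU: "(\<lambda>u. ?p u * g (U u)) \<in> borel_measurable borel" using pm gU by measurable
    show "(\<integral>X. g X \<partial>(distr P borel Z)) = (LBINT y. \<phi> y * g (L y))"
      using nZ(4)[OF gU] c(2)[OF pgU] by (simp add: integral_distr UV mult.assoc[symmetric] \<phi>p)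
    show "integrable (distr P borel Z) g \<longleftrightarrow> integrable lborel (\<lambda>y. \<phi> y * g (L y))"
      using nZ(5)[OF gU] c(3)[OF pgU] by (simp add: integrable_distr_eq UV mult.assoc[symmetric] \<phi>p)
  qed
  have tQ: "\<exists>q. has_score q (t_score n (n + real CARD('v) + real CARD('d) - 1)) \<and> integrable lborel q
         \<and> (LBINT x. q x) = 1 \<and> has_pullback_density (distr Q borel T) L q"
    if n: "n > 0" and Q: "prob_space Q" and T: "matrix_t_distributed Q T n \<Psi> \<Sigma>"
    for n and Q :: "'b measure" and T
  proof -
    let ?m = "n + real CARD('v) + real CARD('d) - 1"
    let ?t = "matrix_t_density n \<Psi> \<Sigma>"
    let ?k = "\<lambda>X :: real^'d^'v. det (mat 1 + (1 / n) *\<^sub>R (matrix_inv \<Psi> ** X ** matrix_inv \<Sigma> ** transpose X)) powr (- (?m / 2))"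
    define D where "D = multivariate_Gamma CARD('v) (?m / 2)
       / ((pi * n) powr (real CARD('v) * real CARD('d) / 2) * multivariate_Gamma CARD('v) ((n + real CARD('v) - 1) / 2)
          * det \<Psi> powr (real CARD('d) / 2) * det \<Sigma> powr (real CARD('v) / 2))"
    have t_eq: "?t X = D * ?k X" for X by (simp add: matrix_t_density_def D_def Let_def)
    have det_L: "det (mat 1 + (1 / n) *\<^sub>R (matrix_inv \<Psi> ** L Y ** matrix_inv \<Sigma> ** transpose (L Y))) = det (gram n Y)" for Y
      unfolding matrix_inv_eqI[OF \<Psi>i] matrix_inv_eqI[OF \<Sigma>i] L_def by (rule det_transformed_gram[OF A B])
    have det_pos: "0 < det (mat 1 + (1 / n) *\<^sub>R (matrix_inv \<Psi> ** X ** matrix_inv \<Sigma> ** transpose X))" for X :: "real^'d^'v"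
    proof -
      obtain Y where "X = L Y" using surjD[OF bij_is_surj[OF bijL], of X] by blast
      then show ?thesis using det_L det_gram_pos[OF n] by metis
    qed
    have k_pos: "0 < ?k X" for X using det_pos[of X] by simp
    have cont_det: "continuous_on UNIV (det :: real^'v^'v \<Rightarrow> real)"
      unfolding det_def[abs_def] by (intro continuous_intros)
    have cont_k: "continuous_on UNIV ?k"
    proof (rule continuous_on_powr)
      show "continuous_on UNIV (\<lambda>X :: real^'d^'v. det (mat 1 + (1 / n) *\<^sub>R (matrix_inv \<Psi> ** X ** matrix_inv \<Sigma> ** transpose X)))"
        by (rule continuous_on_compose2[OF cont_det]) (auto intro!: continuous_intros)
      show "\<forall>X\<in>UNIV. det (mat 1 + (1 / n) *\<^sub>R (matrix_inv \<Psi> ** (X :: real^'d^'v) ** matrix_inv \<Sigma> ** transpose X)) \<noteq> 0"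
        using det_pos by (simp add: less_imp_neq[THEN not_sym])
    qed (rule continuous_on_const)
    have dT: "distributed Q lborel T (\<lambda>x. ennreal (?t x))"
      using T by (simp add: matrix_t_distributed_def)
    note nT = distributed_normalization[OF Q dT t_eq k_pos cont_k]
    obtain c' where c0': "c' > 0" and cB': "\<forall>f\<in>(borel_measurable borel :: (real^'d^'v \<Rightarrow> real) set).
        (LBINT y. c' * f (L y)) = (LBINT x. f x)
        \<and> (integrable lborel (\<lambda>y. c' * f (L y)) \<longleftrightarrow> integrable lborel f)"
      using lborel_linear_substitution[OF linL bijL] by (elim exE conjE) (rule that)
    note c' = c0' bspec[OF cB', THEN conjunct1] bspec[OF cB', THEN conjunct2]
    define q where "q Y = c' * D * t_kernel n ?m Y" for Y :: "real^'d^'v"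
    have qt: "c' * ?t (L Y) = q Y" for Y by (simp add: t_eq det_L q_def t_kernel_def)
    have tm [measurable]: "?t \<in> borel_measurable borel"
      unfolding t_eq[abs_def] by (intro borel_measurable_continuous_onI continuous_on_mult continuous_on_const cont_k)
    have "has_score q (t_score n ?m)"
      using has_score_cmult[OF has_score_t_kernel[OF n], of "c' * D"] c'(1) nT(1) by (simp add: q_def[abs_def])
    moreover have "integrable lborel q" "(LBINT x. q x) = 1"
      using c'(2,3)[OF tm] nT(2,3) by (simp_all add: qt)
    moreover have "has_pullback_density (distr Q borel T) L q"
    proof (rule has_pullback_densityI)
      fix g :: "real^'d^'v \<Rightarrow> real" assume g [measurable]: "g \<in> borel_measurable borel"
      have [measurable]: "T \<in> measurable Q borel" using distributed_measurable[OF dT] by simp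
      have tg: "(\<lambda>x. ?t x * g x) \<in> borel_measurable borel" by measurable
      show "(\<integral>X. g X \<partial>(distr Q borel T)) = (LBINT y. q y * g (L y))"
        "integrable (distr Q borel T) g \<longleftrightarrow> integrable lborel (\<lambda>y. q y * g (L y))"
        using nT(4,5)[OF g] c'(2,3)[OF tg]
        by (simp_all add: integral_distr integrable_distr_eq mult.assoc[symmetric] qt)
    qed
    ultimately show ?thesis by blast
  qed
  show thesis by (rule that[OF linL bijL normL \<phi>_score \<phi> \<phi>_pos gZ tQ])
qed

section \<open>Wasserstein bounds and the conclusion\<close>

lemma wasserstein_le:
  assumes "integrable \<mu> norm" "integrable \<eta> norm"
    and "\<And>g. (\<And>X Y. \<bar>g X - g Y\<bar> \<le> norm (X - Y)) \<Longrightarrow> \<bar>(\<integral>X. g X \<partial>\<mu>) - (\<integral>X. g X \<partial>\<eta>)\<bar> \<le> C"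
  shows "wasserstein \<mu> \<eta> \<le> ereal C"
  using assms unfolding wasserstein_def frobenius_norm_eq_norm[abs_def] by (auto intro!: SUP_least)

text \<open>If a first moment is infinite the distance is infinity by definition, so the inequality
  holds in that case too.\<close>

lemma le_wasserstein:
  assumes "\<And>X Y. \<bar>g X - g Y\<bar> \<le> norm (X - Y)"
  shows "ereal \<bar>(\<integral>X. g X \<partial>\<mu>) - (\<integral>X. g X \<partial>\<eta>)\<bar> \<le> wasserstein \<mu> \<eta>"
  using assms unfolding wasserstein_def frobenius_norm_eq_norm[abs_def] by (auto intro!: SUP_upper)

text \<open>Optimality of the rate is expressed by a matching lower bound: \<open>c\<close> is
  chosen after the matrices and before \<open>n\<close>, and the bound holds for all large
  \<open>n\<close>.\<close>

theorem proposition4: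
  fixes \<Psi> :: "real^'v^'v" and \<Sigma> :: "real^'d^'d"
    and P :: "'a measure" and Z :: "'a \<Rightarrow> real^'d^'v"
  assumes "pos_def \<Psi>" and "pos_def \<Sigma>"
    and "prob_space P" and "matrix_normal_distributed P Z 0 \<Psi> \<Sigma>"
  shows "(\<forall>n>2. \<forall>(Q :: 'b measure) (T :: 'b \<Rightarrow> real^'d^'v).
            prob_space Q \<and> matrix_t_distributed Q T n \<Psi> \<Sigma> \<longrightarrow>
            wasserstein (distr Q borel T) (distr P borel Z)
              \<le> ereal (10 / sqrt (1 - 2 / n) * ((real CARD('v) * real CARD('d))\<^sup>2 / n)
                        * sqrt (spectral_norm \<Psi>) * sqrt (spectral_norm \<Sigma>)))
       \<and> (\<exists>c>0. \<forall>\<^sub>F n in at_top. \<forall>(Q :: 'b measure) (T :: 'b \<Rightarrow> real^'d^'v).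
            prob_space Q \<and> matrix_t_distributed Q T n \<Psi> \<Sigma> \<longrightarrow>
            ereal (c / n) \<le> wasserstein (distr Q borel T) (distr P borel Z))"
proof -
  obtain L :: "real^'d^'v \<Rightarrow> real^'d^'v" and \<phi> where L: "linear L" "bij L"
    and nL: "\<And>Y. norm (L Y) \<le> sqrt (spectral_norm \<Psi>) * sqrt (spectral_norm \<Sigma>) * norm Y"
    and \<phi>: "has_score \<phi> uminus" "integrable lborel \<phi>" "(LBINT x. \<phi> x) = 1" and \<phi>_pos: "\<And>x. 0 < \<phi> x"
    and Z: "has_pullback_density (distr P borel Z) L \<phi>"
    and T: "\<And>n (Q :: 'b measure) T. n > 0 \<Longrightarrow> prob_space Q \<Longrightarrow> matrix_t_distributed Q T n \<Psi> \<Sigma> \<Longrightarrow>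
       \<exists>q. has_score q (t_score n (n + real CARD('v) + real CARD('d) - 1)) \<and> integrable lborel q
         \<and> (LBINT x. q x) = 1 \<and> has_pullback_density (distr Q borel T) L q"
    by (rule matrix_law_reduction[OF assms, where 'b = 'b]) (rule that; assumption)
  interpret L: linear L by fact
  define K where "K = sqrt (spectral_norm \<Psi>) * sqrt (spectral_norm \<Sigma>)"
  \<comment> \<open>The injective map \<open>L\<close> does not annihilate a unit vector, so its
    upper norm bound is positive and may serve as Lipschitz constant.\<close>
  have K: "K > 0"
  proof -
    obtain e :: "real^'d^'v" where e: "norm e = 1" using norm_Basis SOME_Basis by blast
    then have "L e \<noteq> 0" using bij_is_inj[OF L(2)] L.zero by (metis injD norm_zero zero_neq_one)
    then have "0 < norm (L e)" by simp
    also have "\<dots> \<le> K * norm e" unfolding K_def by (rule nL)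
    finally show ?thesis using e by simp
  qed
  have lip: "\<bar>g (L x) - g (L y)\<bar> \<le> K * norm (x - y)"
    if "\<And>X Y. \<bar>g X - g Y\<bar> \<le> norm (X - Y)" for g :: "real^'d^'v \<Rightarrow> real" and x y
    using that[of "L x" "L y"] nL[of "x - y"] by (simp add: K_def L.diff)
  have upper: "wasserstein (distr Q borel T) (distr P borel Z)
      \<le> ereal (10 / sqrt (1 - 2 / n) * ((real CARD('v) * real CARD('d))\<^sup>2 / n) * K)"
    if n: "n > 2" and Q: "prob_space Q" "matrix_t_distributed Q T n \<Psi> \<Sigma>" for n and Q :: "'b measure" and T
  proof -
    have n0: "n > 0" using n by simp
    obtain q where q: "has_score q (t_score n (n + real CARD('v) + real CARD('d) - 1))"
        "integrable lborel q" "(LBINT x. q x) = 1"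
      and gT: "has_pullback_density (distr Q borel T) L q"
      using T[OF n0 Q] by blast
    note gT = has_pullback_densityD[OF gT] and Z = has_pullback_densityD[OF Z]
    note bound = t_gaussian_upper_bound[OF n refl q \<phi> K lip]
    show ?thesis
    proof (rule wasserstein_le)
      have "\<bar>norm X - norm Y\<bar> \<le> norm (X - Y)" for X Y :: "real^'d^'v" by (rule norm_triangle_ineq3)
      from bound(1,2)[OF this]
      show "integrable (distr Q borel T) norm" "integrable (distr P borel Z) norm"
        by (simp_all add: gT(2) Z(2))
      fix g :: "real^'d^'v \<Rightarrow> real" assume g: "\<And>X Y. \<bar>g X - g Y\<bar> \<le> norm (X - Y)"
      have "g \<in> borel_measurable borel" using g by (intro borel_measurable_continuous_onI lipschitz_continuous_on_UNIV)
      then show "\<bar>(\<integral>X. g X \<partial>(distr Q borel T)) - (\<integral>X. g X \<partial>(distr P borel Z))\<bar>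
        \<le> 10 / sqrt (1 - 2 / n) * ((real CARD('v) * real CARD('d))\<^sup>2 / n) * K"
        using bound(3)[OF g] by (simp only: gT(1) Z(1))
    qed
  qed
  obtain g :: "real^'d^'v \<Rightarrow> real" and M \<delta> n0 where g: "M > 0" "\<delta> > 0" "n0 > 2"
    "\<And>x y. \<bar>g x - g y\<bar> \<le> M * norm (x - y)"
    "\<And>n m q. n0 \<le> n \<Longrightarrow> m = n + real CARD('v) + real CARD('d) - 1 \<Longrightarrow> has_score q (t_score n m)
       \<Longrightarrow> integrable lborel q \<Longrightarrow> (LBINT x. q x) = 1
       \<Longrightarrow> \<delta> / n \<le> (LBINT x. q x * g x) - (LBINT x. \<phi> x * g x)"
    by (rule t_gaussian_lower_bound[OF \<phi> \<phi>_pos]) (rule that; assumption)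
  obtain B where B: "B > 0" "\<And>x. B * norm x \<le> norm (L x)"
    by (rule linear_inj_bounded_below_pos[OF L(1) bij_is_inj[OF L(2)]]) (rule that; assumption)
  \<comment> \<open>The inverse of \<open>L\<close> expands norms by at most 1 / B, so
    \<open>g\<close> composed with it is M / B-Lipschitz; the factor B / M normalizes it to an
    admissible test function.\<close>
  define h where "h X = B / M * g (inv L X)" for X
  have hL: "h (L y) = B / M * g y" for y unfolding h_def using inv_f_f[OF bij_is_inj[OF L(2)]] by simp
  have h: "\<bar>h X - h Y\<bar> \<le> norm (X - Y)" for X Y
  proof -
    obtain x y where xy: "X = L x" "Y = L y"
      using surjD[OF bij_is_surj[OF L(2)]] by metis
    have "\<bar>h X - h Y\<bar> = B / M * \<bar>g x - g y\<bar>"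
      unfolding xy hL right_diff_distrib[symmetric] abs_mult using B(1) g(1) by simp
    also have "\<dots> \<le> B / M * (M * norm (x - y))" using B(1) g(1) by (intro mult_left_mono g(4)) auto
    also have "\<dots> = B * norm (x - y)" using g(1) by simp
    also have "\<dots> \<le> norm (X - Y)" using B(2)[of "x - y"] by (simp add: xy L.diff)
    finally show ?thesis .
  qed
  have hm: "h \<in> borel_measurable borel" using h by (intro borel_measurable_continuous_onI lipschitz_continuous_on_UNIV)
  have lower: "ereal (B / M * \<delta> / n) \<le> wasserstein (distr Q borel T) (distr P borel Z)"
    if n: "n \<ge> n0" and Q: "prob_space Q" "matrix_t_distributed Q T n \<Psi> \<Sigma>" for n and Q :: "'b measure" and T
  proof -
    have "n > 0" using n g(3) by simp
    from T[OF this Q] obtain q where q: "has_score q (t_score n (n + real CARD('v) + real CARD('d) - 1))"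
        "integrable lborel q" "(LBINT x. q x) = 1"
      and gT: "has_pullback_density (distr Q borel T) L q"
      by blast
    note gT = has_pullback_densityD(1)[OF gT hm] and Z = has_pullback_densityD(1)[OF Z hm]
    have c: "p * (B / M * t) = B / M * (p * t)" for p t :: real by simp
    have "B / M * (\<delta> / n) \<le> B / M * ((LBINT x. q x * g x) - (LBINT x. \<phi> x * g x))"
      using B(1) g(1) by (intro mult_left_mono g(5)[OF n refl q]) auto
    also have "\<dots> = (\<integral>X. h X \<partial>(distr Q borel T)) - (\<integral>X. h X \<partial>(distr P borel Z))"
      unfolding gT Z hL c by (simp only: integral_mult_right_zero right_diff_distrib)
    also have "\<dots> \<le> \<bar>\<dots>\<bar>" by simp
    finally have "ereal (B / M * \<delta> / n) \<le> ereal \<bar>(\<integral>X. h X \<partial>(distr Q borel T)) - (\<integral>X. h X \<partial>(distr P borel Z))\<bar>"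
      by simp
    also have "\<dots> \<le> wasserstein (distr Q borel T) (distr P borel Z)" by (rule le_wasserstein[OF h])
    finally show ?thesis .
  qed
  have "\<forall>\<^sub>F n in at_top. \<forall>(Q :: 'b measure) (T :: 'b \<Rightarrow> real^'d^'v).
      prob_space Q \<and> matrix_t_distributed Q T n \<Psi> \<Sigma> \<longrightarrow>
      ereal (B / M * \<delta> / n) \<le> wasserstein (distr Q borel T) (distr P borel Z)"
    using eventually_ge_at_top[of n0] by eventually_elim (use lower in blast)
  moreover have "B / M * \<delta> > 0" using B(1) g(1,2) by simp
  ultimately show ?thesis using upper unfolding K_def mult.assoc by blast
qed

end
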